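(* Let $M$ be a Turing machine, $r$ a binary string with $M(r)=1$, and $\pi=\langle\varphi_0,\dots,\varphi_n\rangle$ a normal proof of $M(r)=1$. Then the following formula is provable in ZFC: $\forall s\,\big(\mathbf{CK}_{\pi}(\langle\mathbf{T}_{\langle M,s\rangle},\mathbf{AL}\rangle,\pi)=1\to M(s)=1\big)$, where $s$ ranges over binary strings.
   Context: Turing machines $M=(Q,\Gamma,\delta,q_0,q_{halt})$ have tape alphabet $\Gamma=\{0,1,\sqcup,\triangleright\}$. Proofs from a recursive theory: for $\langle T,al\rangle$ with $T$ a set of formulas of set theory and $al$ an algorithm deciding membership in $T$, $\langle T,al\rangle\vdash^{\pi}\varphi$ means $\pi=\langle\varphi_0,\dots,\varphi_n\rangle$, $\varphi_n=\varphi$, and each $\varphi_i$ is (1) a logical axiom, (2) a ZFC axiom, (3) in $T$, (4) obtained by modus ponens: $\varphi_j=(\varphi_k\to\varphi_i)$ for some $j,k<i$, or (5) $\varphi_i=\forall x_k\varphi_j$ for some $j<i$. Adjoint checker: record for each $i$ a justification of $\varphi_i$ of one of kinds (1)–(5) (with indices $j,k$ for (4),(5)). $\mathbf{CK}_\pi$ on input $(\langle U,b\rangle,\sigma)$, $\sigma=\langle\psi_0,\dots,\psi_m\rangle$, returns $0$ if $m\ne n$, and otherwise $1$ iff each recorded justification is valid for $\psi_i$ (kind (3) checked by using $b$ to decide $\psi_i\in U$; kinds (4),(5) with the same indices). Formalization of computations: for binary $s=s_0\dots s_l$, a constant $t$ denotes the computation table of $M$ on $s$, $t_{i,j}\in\Gamma\times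 Q\times\{0,1\}$. $\mathbf{def}_M$ is a fixed finite formula sequence depending only on $M$ asserting $t$ is a table of $M$; $\mathbf{input}_s$ is the sequence $\forall j\,(j>l+1\to t_{0,j}=(\sqcup,q_0,0))$, $t_{0,0}=(\triangleright,q_0,1)$, $t_{0,1}=(s_0,q_0,0)$, …, $t_{0,l+1}=(s_l,q_0,0)$. $\mathbf{T}_{\langle M,s\rangle}$ is $\mathbf{def}_M$ followed by $\mathbf{input}_s$; $\mathbf{AL}$ decides membership in $\mathbf{T}_{\langle M,s\rangle}$ by successive comparison. A normal proof of $M(r)=1$ is a $\pi$ with $\langle\mathbf{T}_{\langle M,r\rangle},\mathbf{AL}\rangle\vdash^{\pi}\exists i\,t_{i,1}=(1,q_{halt},1)$. *)

theory Defs
  imports Main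
begin

section \<open>The language of set theory with a constant for computation tables\<close>

text \<open>
  \<open>Ct\<close> is the constant \<open>t\<close> denoting a computation table.  Formulas in
  which it does not occur are the formulas of the language \<open>{\<in>}\<close>.
\<close>

datatype tm = Var nat | Ct

datatype fm = Eq tm tm | Mem tm tm | Neg fm | Imp fm fm | All nat fm

definition And :: "fm \<Rightarrow> fm \<Rightarrow> fm" where "And a b = Neg (Imp a (Neg b))"
definition Or :: "fm \<Rightarrow> fm \<Rightarrow> fm" where "Or a b = Imp (Neg a) b"
definition Iff :: "fm \<Rightarrow> fm \<Rightarrow> fm" where "Iff a b = And (Imp a b) (Imp b a)"
definition Ex :: "nat \<Rightarrow> fm \<Rightarrow> fm" where "Ex x a = Neg (All x (Neg a))"
definition Bot :: fm where "Bot = Neg (All 0 (Eq (Var 0) (Var 0)))"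

definition Conj :: "fm list \<Rightarrow> fm" where "Conj as = foldr And as (Neg Bot)"
definition Disj :: "fm list \<Rightarrow> fm" where "Disj as = foldr Or as Bot"

primrec fv :: "fm \<Rightarrow> nat set" where
  "fv (Eq s t) = {x. Var x \<in> {s, t}}"
| "fv (Mem s t) = {x. Var x \<in> {s, t}}"
| "fv (Neg a) = fv a"
| "fv (Imp a b) = fv a \<union> fv b"
| "fv (All x a) = fv a - {x}"

primrec t_free :: "fm \<Rightarrow> bool" where
  "t_free (Eq s t) = (Ct \<notin> {s, t})"
| "t_free (Mem s t) = (Ct \<notin> {s, t})"
| "t_free (Neg a) = t_free a"
| "t_free (Imp a b) = (t_free a \<and> t_free b)"
| "t_free (All x a) = t_free a"

definition substt :: "nat \<Rightarrow> tm \<Rightarrow> tm \<Rightarrow> tm" where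
  "substt x u s = (if s = Var x then u else s)"

primrec subst :: "nat \<Rightarrow> tm \<Rightarrow> fm \<Rightarrow> fm" where
  "subst x u (Eq s t) = Eq (substt x u s) (substt x u t)"
| "subst x u (Mem s t) = Mem (substt x u s) (substt x u t)"
| "subst x u (Neg a) = Neg (subst x u a)"
| "subst x u (Imp a b) = Imp (subst x u a) (subst x u b)"
| "subst x u (All y a) = All y (if y = x then a else subst x u a)"

primrec free_for :: "tm \<Rightarrow> nat \<Rightarrow> fm \<Rightarrow> bool" where
  "free_for u x (Eq s t) = True"
| "free_for u x (Mem s t) = True"
| "free_for u x (Neg a) = free_for u x a"
| "free_for u x (Imp a b) = (free_for u x a \<and> free_for u x b)"
| "free_for u x (All y a) = (x \<notin> fv (All y a) \<or> (u \<noteq> Var y \<and> free_for u x a))"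


section \<open>Set-theoretic notions as formulas\<close>

text \<open>
  Quantifiers binding a variable that is fresh for the terms in the list \<open>ps\<close>.  The list has to
  contain every term occurring free in the body, apart from the bound variable itself.
\<close>

primrec idx :: "tm \<Rightarrow> nat" where "idx (Var n) = Suc n" | "idx Ct = 0"

definition fresh :: "tm list \<Rightarrow> nat" where "fresh ps = foldr max (map idx ps) 0"

definition all :: "tm list \<Rightarrow> (tm \<Rightarrow> fm) \<Rightarrow> fm" where
  "all ps F = All (fresh ps) (F (Var (fresh ps)))"

definition ex :: "tm list \<Rightarrow> (tm \<Rightarrow> fm) \<Rightarrow> fm" where
  "ex ps F = Ex (fresh ps) (F (Var (fresh ps)))"

definition all2 :: "tm list \<Rightarrow> (tm \<Rightarrow> tm \<Rightarrow> fm) \<Rightarrow> fm" where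
  "all2 ps F = all ps (\<lambda>x. all (x # ps) (F x))"
definition all3 :: "tm list \<Rightarrow> (tm \<Rightarrow> tm \<Rightarrow> tm \<Rightarrow> fm) \<Rightarrow> fm" where
  "all3 ps F = all ps (\<lambda>x. all2 (x # ps) (F x))"
definition ex2 :: "tm list \<Rightarrow> (tm \<Rightarrow> tm \<Rightarrow> fm) \<Rightarrow> fm" where
  "ex2 ps F = ex ps (\<lambda>x. ex (x # ps) (F x))"
definition ex3 :: "tm list \<Rightarrow> (tm \<Rightarrow> tm \<Rightarrow> tm \<Rightarrow> fm) \<Rightarrow> fm" where
  "ex3 ps F = ex ps (\<lambda>x. ex2 (x # ps) (F x))"
definition ex4 :: "tm list \<Rightarrow> (tm \<Rightarrow> tm \<Rightarrow> tm \<Rightarrow> tm \<Rightarrow> fm) \<Rightarrow> fm" where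
  "ex4 ps F = ex ps (\<lambda>x. ex3 (x # ps) (F x))"

definition ex1 :: "tm list \<Rightarrow> (tm \<Rightarrow> fm) \<Rightarrow> fm" where
  "ex1 ps F = ex ps (\<lambda>y. all (y # ps) (\<lambda>z. Iff (F z) (Eq z y)))"

definition sub_fm :: "tm \<Rightarrow> tm \<Rightarrow> fm" where
  "sub_fm x y = all [x, y] (\<lambda>z. Imp (Mem z x) (Mem z y))"

definition empty_fm :: "tm \<Rightarrow> fm" where
  "empty_fm x = all [x] (\<lambda>z. Neg (Mem z x))"

definition succ_fm :: "tm \<Rightarrow> tm \<Rightarrow> fm" where \<comment> \<open>\<open>y = x \<union> {x}\<close>\<close>
  "succ_fm x y = all [x, y] (\<lambda>z. Iff (Mem z y) (Or (Mem z x) (Eq z x)))"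

definition upair_fm :: "tm \<Rightarrow> tm \<Rightarrow> tm \<Rightarrow> fm" where \<comment> \<open>\<open>p = {x, y}\<close>\<close>
  "upair_fm x y p = all [x, y, p] (\<lambda>z. Iff (Mem z p) (Or (Eq z x) (Eq z y)))"

definition pair_fm :: "tm \<Rightarrow> tm \<Rightarrow> tm \<Rightarrow> fm" where \<comment> \<open>\<open>p = (x, y) = {{x}, {x, y}}\<close>\<close>
  "pair_fm x y p = ex2 [x, y, p] (\<lambda>a b.
     And (upair_fm x x a) (And (upair_fm x y b) (upair_fm a b p)))"

definition inductive_fm :: "tm \<Rightarrow> fm" where
  "inductive_fm w = And
     (ex [w] (\<lambda>z. And (empty_fm z) (Mem z w)))
     (all [w] (\<lambda>x. Imp (Mem x w) (ex [x, w] (\<lambda>y. And (succ_fm x y) (Mem y w)))))"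

definition nat_fm :: "tm \<Rightarrow> fm" where \<comment> \<open>\<open>n \<in> \<omega>\<close>\<close>
  "nat_fm n = all [n] (\<lambda>w. Imp (inductive_fm w) (Mem n w))"

definition app_fm :: "tm \<Rightarrow> tm \<Rightarrow> tm \<Rightarrow> fm" where \<comment> \<open>\<open>f(x) = y\<close>, for a function \<open>f\<close>\<close>
  "app_fm f x y = ex [f, x, y] (\<lambda>p. And (pair_fm x y p) (Mem p f))"

definition seq_fm :: "tm \<Rightarrow> tm \<Rightarrow> fm" where
    \<comment> \<open>\<open>f\<close> is a finite sequence of length \<open>n\<close>, i.e. a function with domain \<open>n \<in> \<omega>\<close>\<close>
  "seq_fm f n = And (nat_fm n) (And
     (all [f, n] (\<lambda>p. Imp (Mem p f) (ex2 [f, n, p] (\<lambda>i y. And (Mem i n) (pair_fm i y p)))))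
     (all [f, n] (\<lambda>i. Imp (Mem i n) (ex1 [f, n, i] (\<lambda>y. app_fm f i y)))))"

text \<open>
  \<open>numv k x y\<close> says that the variable \<open>x\<close> is the \<open>k\<close>-th von Neumann numeral, using only
  \<open>x\<close>, \<open>y\<close> and one further bound variable, so that \<open>numv (Suc k) x y\<close> arises from
  \<open>numv k x y\<close> by filling a fixed context.
\<close>

primrec numv :: "nat \<Rightarrow> nat \<Rightarrow> nat \<Rightarrow> fm" where
  "numv 0 x y = All y (Neg (Mem (Var y) (Var x)))"
| "numv (Suc k) x y = Ex y (And (succ_fm (Var y) (Var x))
                        (Ex x (And (Eq (Var x) (Var y)) (numv k x y))))"

definition num_fm :: "nat \<Rightarrow> tm \<Rightarrow> fm" where \<comment> \<open>\<open>u\<close> is the \<open>k\<close>-th numeral\<close>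
  "num_fm k u = (let x = fresh [u] in Ex x (And (Eq (Var x) u) (numv k x (Suc x))))"

definition one_of_fm :: "nat list \<Rightarrow> tm \<Rightarrow> fm" where
  "one_of_fm ks x = Disj (map (\<lambda>k. num_fm k x) ks)"

primrec add_fm :: "nat \<Rightarrow> tm \<Rightarrow> tm \<Rightarrow> fm" where \<comment> \<open>\<open>m = k + d\<close>\<close>
  "add_fm 0 k m = Eq m k"
| "add_fm (Suc d) k m = ex [k, m] (\<lambda>p. And (add_fm d k p) (succ_fm p m))"

definition entry_fm :: "tm \<Rightarrow> nat \<Rightarrow> tm \<Rightarrow> fm" where \<comment> \<open>the \<open>n\<close>-th entry of \<open>f\<close> is \<open>y\<close>\<close>
  "entry_fm f n y = ex [f, y] (\<lambda>i. And (num_fm n i) (app_fm f i y))"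

definition length_fm :: "tm \<Rightarrow> nat \<Rightarrow> fm" where \<comment> \<open>\<open>f\<close> is a sequence of length \<open>n\<close>\<close>
  "length_fm f n = ex [f] (\<lambda>d. And (num_fm n d) (seq_fm f d))"


section \<open>ZFC and proofs\<close>

inductive logical_axiom :: "fm \<Rightarrow> bool" where
  "logical_axiom (Imp a (Imp b a))"
| "logical_axiom (Imp (Imp a (Imp b c)) (Imp (Imp a b) (Imp a c)))"
| "logical_axiom (Imp (Imp (Neg a) (Neg b)) (Imp b a))"
| "free_for u x a \<Longrightarrow> logical_axiom (Imp (All x a) (subst x u a))"
| "x \<notin> fv a \<Longrightarrow> logical_axiom (Imp (All x (Imp a b)) (Imp a (All x b)))"
| "logical_axiom (Eq s s)"
| "logical_axiom (Imp (Eq s t) (Imp (Eq s u) (Eq t u)))"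
| "logical_axiom (Imp (Eq s t) (Imp (Mem s u) (Mem t u)))"
| "logical_axiom (Imp (Eq s t) (Imp (Mem u s) (Mem u t)))"

definition zfc_single :: "fm list" where
  "zfc_single =
   [\<comment> \<open>extensionality\<close>
    all2 [] (\<lambda>x y. Imp (all [x, y] (\<lambda>z. Iff (Mem z x) (Mem z y))) (Eq x y)),
    \<comment> \<open>pairing\<close>
    all2 [] (\<lambda>x y. ex [x, y] (\<lambda>z. upair_fm x y z)),
    \<comment> \<open>union\<close>
    all [] (\<lambda>x. ex [x] (\<lambda>y. all [x, y] (\<lambda>z.
      Iff (Mem z y) (ex [x, y, z] (\<lambda>w. And (Mem z w) (Mem w x)))))),
    \<comment> \<open>power set\<close>
    all [] (\<lambda>x. ex [x] (\<lambda>y. all [x, y] (\<lambda>z. Iff (Mem z y) (sub_fm z x)))),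
    \<comment> \<open>infinity\<close>
    ex [] inductive_fm,
    \<comment> \<open>foundation\<close>
    all [] (\<lambda>x. Imp (ex [x] (\<lambda>y. Mem y x))
      (ex [x] (\<lambda>y. And (Mem y x) (Neg (ex [x, y] (\<lambda>z. And (Mem z x) (Mem z y))))))),
    \<comment> \<open>choice: a disjoint family of nonempty sets has a transversal\<close>
    all [] (\<lambda>x. Imp
      (And (all [x] (\<lambda>y. Imp (Mem y x) (ex [x, y] (\<lambda>z. Mem z y))))
           (all2 [x] (\<lambda>y z. Imp (And (Mem y x) (And (Mem z x) (Neg (Eq y z))))
              (Neg (ex [x, y, z] (\<lambda>w. And (Mem w y) (Mem w z)))))))
      (ex [x] (\<lambda>c. all [x, c] (\<lambda>y. Imp (Mem y x)
        (ex1 [x, c, y] (\<lambda>z. And (Mem z y) (Mem z c)))))))]"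

text \<open>
  The schemas may have parameters, and, as usual for the theory in the extended language, the
  constant \<open>t\<close> may occur in them.
\<close>

inductive zfc_axiom :: "fm \<Rightarrow> bool" where
  single: "a \<in> set zfc_single \<Longrightarrow> zfc_axiom a"
| separation: "distinct [x, y, z] \<Longrightarrow> y \<notin> fv a \<Longrightarrow>
    zfc_axiom (Ex y (All x (Iff (Mem (Var x) (Var y)) (And (Mem (Var x) (Var z)) a))))"
| replacement: "distinct [x, y, z, u] \<Longrightarrow> u \<notin> fv a \<Longrightarrow>
    zfc_axiom (Imp
      (All x (Imp (Mem (Var x) (Var z)) (Ex u (All y (Imp a (Eq (Var y) (Var u)))))))
      (Ex u (All y (Iff (Mem (Var y) (Var u)) (Ex x (And (Mem (Var x) (Var z)) a))))))"

text \<open>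
  \<open>Gen_J j k\<close> records \<open>\<phi>\<^sub>i = \<forall>x\<^sub>k \<phi>\<^sub>j\<close>; \<open>MP_J j k\<close> records \<open>\<phi>\<^sub>j = (\<phi>\<^sub>k \<rightarrow> \<phi>\<^sub>i)\<close>.
\<close>

datatype justification = Log_J | ZFC_J | Thy_J | MP_J nat nat | Gen_J nat nat

text \<open>A theory with an algorithm deciding membership in it.\<close>

type_synonym rec_theory = "fm set \<times> (fm \<Rightarrow> bool)"

fun justifies :: "rec_theory \<Rightarrow> fm list \<Rightarrow> nat \<Rightarrow> justification \<Rightarrow> bool" where
  "justifies (T, al) \<pi> i Log_J = logical_axiom (\<pi> ! i)"
| "justifies (T, al) \<pi> i ZFC_J = zfc_axiom (\<pi> ! i)"
| "justifies (T, al) \<pi> i Thy_J = (\<pi> ! i \<in> T)"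
| "justifies (T, al) \<pi> i (MP_J j k) = (j < i \<and> k < i \<and> \<pi> ! j = Imp (\<pi> ! k) (\<pi> ! i))"
| "justifies (T, al) \<pi> i (Gen_J j k) = (j < i \<and> \<pi> ! i = All k (\<pi> ! j))"

definition proves :: "rec_theory \<Rightarrow> fm list \<Rightarrow> fm \<Rightarrow> bool" where
  "proves T \<pi> a \<longleftrightarrow> \<pi> \<noteq> [] \<and> last \<pi> = a \<and> (\<forall>i < length \<pi>. \<exists>J. justifies T \<pi> i J)"

definition recorded :: "rec_theory \<Rightarrow> fm list \<Rightarrow> justification list \<Rightarrow> bool" where
  "recorded T \<pi> Js \<longleftrightarrow> length Js = length \<pi> \<and> (\<forall>i < length \<pi>. justifies T \<pi> i (Js ! i))"

text \<open>Provability in ZFC itself, i.e. in the language without the constant \<open>t\<close>.\<close>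

definition zfc_provable :: "fm \<Rightarrow> bool" where
  "zfc_provable a \<longleftrightarrow> (\<exists>\<pi>. proves ({}, \<lambda>_. False) \<pi> a \<and> (\<forall>b \<in> set \<pi>. t_free b))"


section \<open>Turing machines\<close>

datatype sym = Zero | One | Blank | Start
datatype move = Lft | Stay | Rgt

record turing =
  states :: "nat set"
  delta :: "nat \<Rightarrow> sym \<Rightarrow> nat \<times> sym \<times> move"
  init :: nat
  halt :: nat

definition turing_machine :: "turing \<Rightarrow> bool" where
  "turing_machine M \<longleftrightarrow> finite (states M) \<and> init M \<in> states M \<and> halt M \<in> states M \<and>
     (\<forall>q \<in> states M. \<forall>a. fst (delta M q a) \<in> states M)"

definition bit_sym :: "bool \<Rightarrow> sym" where "bit_sym b = (if b then One else Zero)"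

fun new_pos :: "move \<Rightarrow> nat \<Rightarrow> nat" where
  "new_pos Lft j = j - 1"
| "new_pos Stay j = j"
| "new_pos Rgt j = Suc j"

text \<open>Configurations: tape contents, state, head position.\<close>

definition init_config :: "turing \<Rightarrow> bool list \<Rightarrow> (nat \<Rightarrow> sym) \<times> nat \<times> nat" where
  "init_config M s =
     ((\<lambda>j. if j = 0 then Start else if j \<le> length s then bit_sym (s ! (j - 1)) else Blank), init M, 0)"

definition step :: "turing \<Rightarrow> (nat \<Rightarrow> sym) \<times> nat \<times> nat \<Rightarrow> (nat \<Rightarrow> sym) \<times> nat \<times> nat" where
  "step M = (\<lambda>(f, q, j). if q = halt M then (f, q, j)
     else (case delta M q (f j) of (q', a, d) \<Rightarrow> (f(j := a), q', new_pos d j)))"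

definition table :: "turing \<Rightarrow> bool list \<Rightarrow> nat \<Rightarrow> nat \<Rightarrow> sym \<times> nat \<times> bool" where
  "table M s i j = (case (step M ^^ i) (init_config M s) of (f, q, h) \<Rightarrow> (f j, q, j = h))"

definition outputs_1 :: "turing \<Rightarrow> bool list \<Rightarrow> bool" where
  "outputs_1 M s \<longleftrightarrow> (\<exists>i. table M s i 1 = (One, halt M, True))"


section \<open>Formalization of computations\<close>

text \<open>Symbols and states are represented by numerals.\<close>

fun sym_num :: "sym \<Rightarrow> nat" where
  "sym_num Zero = 0" | "sym_num One = 1" | "sym_num Blank = 2" | "sym_num Start = 3"

definition triple_fm :: "tm \<Rightarrow> tm \<Rightarrow> tm \<Rightarrow> tm \<Rightarrow> fm" where \<comment> \<open>\<open>v = (a, q, h)\<close>\<close>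
  "triple_fm a q h v = ex [a, q, h, v] (\<lambda>w. And (pair_fm q h w) (pair_fm a w v))"

definition tab_fm :: "tm \<Rightarrow> tm \<Rightarrow> tm \<Rightarrow> tm \<Rightarrow> fm" where \<comment> \<open>\<open>t\<^sub>i\<^sub>,\<^sub>j = v\<close>\<close>
  "tab_fm t i j v = ex [t, i, j, v] (\<lambda>p. And (pair_fm i j p) (app_fm t p v))"

definition cell_fm :: "tm \<Rightarrow> tm \<Rightarrow> tm \<Rightarrow> tm \<Rightarrow> tm \<Rightarrow> tm \<Rightarrow> fm" where \<comment> \<open>\<open>t\<^sub>i\<^sub>,\<^sub>j = (a, q, h)\<close>\<close>
  "cell_fm t i j a q h =
     ex [t, i, j, a, q, h] (\<lambda>v. And (triple_fm a q h v) (tab_fm t i j v))"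

text \<open>
  As \<open>cell_fm\<close>, with the numerals for a given symbol, state and head flag.
\<close>

definition ncell_fm :: "tm \<Rightarrow> tm \<Rightarrow> tm \<Rightarrow> sym \<Rightarrow> nat \<Rightarrow> nat \<Rightarrow> fm" where
  "ncell_fm t i j a q h = ex3 [t, i, j] (\<lambda>x y z.
     Conj [num_fm (sym_num a) x, num_fm q y, num_fm h z, cell_fm t i j x y z])"

definition value_fm :: "turing \<Rightarrow> tm \<Rightarrow> fm" where \<comment> \<open>\<open>v \<in> \<Gamma> \<times> Q \<times> {0,1}\<close>\<close>
  "value_fm M v = ex3 [v] (\<lambda>a q h. Conj [triple_fm a q h v, one_of_fm [0, 1, 2, 3] a,
     one_of_fm (sorted_list_of_set (states M)) q, one_of_fm [0, 1] h])"

fun move_fm :: "move \<Rightarrow> tm \<Rightarrow> tm \<Rightarrow> fm" where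
  "move_fm Lft j j' = Or (succ_fm j' j) (And (empty_fm j) (empty_fm j'))"
| "move_fm Stay j j' = Eq j' j"
| "move_fm Rgt j j' = succ_fm j j'"

text \<open>
  The transition for state \<open>q \<noteq> q\<^sub>h\<^sub>a\<^sub>l\<^sub>t\<close> and scanned symbol \<open>a\<close>: if the head is at \<open>j\<close> at time
  \<open>i\<close>, with state \<open>q\<close> and symbol \<open>a\<close>, and if cell \<open>k\<close> contains \<open>b\<close> at time \<open>i\<close>, then at time
  \<open>i + 1\<close> it contains \<open>c\<close> (which is \<open>a'\<close> for \<open>k = j\<close>, and \<open>b\<close> otherwise), with the new state, and
  with the flag \<open>g\<close> that says whether \<open>k\<close> is the new head position \<open>j'\<close>.
\<close>

definition trans_fm :: "turing \<Rightarrow> tm \<Rightarrow> nat \<Rightarrow> sym \<Rightarrow> fm" where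
  "trans_fm M t q a = (case delta M q a of (q', a', d) \<Rightarrow>
     all2 [t] (\<lambda>i j. Imp (ncell_fm t i j a q 1)
       (all3 [t, i, j] (\<lambda>i' j' k. all3 [t, i, j, i', j', k] (\<lambda>b p h.
          Imp (Conj [succ_fm i i', move_fm d j j', cell_fm t i k b p h])
            (ex3 [t, i, j, i', j', k, b, p, h] (\<lambda>c r g. Conj
              [Or (And (Eq k j) (num_fm (sym_num a') c)) (And (Neg (Eq k j)) (Eq c b)),
               num_fm q' r,
               Or (And (Eq k j') (num_fm 1 g)) (And (Neg (Eq k j')) (num_fm 0 g)),
               cell_fm t i' k c r g])))))))"

definition halt_fm :: "turing \<Rightarrow> tm \<Rightarrow> sym \<Rightarrow> fm" where
  "halt_fm M t a = all2 [t] (\<lambda>i j. Imp (ncell_fm t i j a (halt M) 1)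
     (all3 [t, i, j] (\<lambda>i' k v. Imp (And (succ_fm i i') (tab_fm t i k v)) (tab_fm t i' k v))))"

text \<open>\<open>t\<close> is a function from \<open>\<omega> \<times> \<omega>\<close> to \<open>\<Gamma> \<times> Q \<times> {0,1}\<close>, and obeys the transitions.\<close>

definition def_fms :: "turing \<Rightarrow> tm \<Rightarrow> fm list" where
  "def_fms M t =
   [all [t] (\<lambda>e. Imp (Mem e t) (ex4 [t, e] (\<lambda>i j v p. Conj
      [nat_fm i, nat_fm j, value_fm M v, pair_fm i j p, pair_fm p v e]))),
    all2 [t] (\<lambda>i j. Imp (And (nat_fm i) (nat_fm j)) (ex1 [t, i, j] (\<lambda>v. tab_fm t i j v)))] @
   map (halt_fm M t) [Zero, One, Blank, Start] @
   concat (map (\<lambda>q. map (trans_fm M t q) [Zero, One, Blank, Start])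
     (sorted_list_of_set (states M - {halt M})))"

definition init_cell_fm :: "turing \<Rightarrow> tm \<Rightarrow> tm \<Rightarrow> sym \<Rightarrow> nat \<Rightarrow> fm" where
    \<comment> \<open>\<open>t\<^sub>0\<^sub>,\<^sub>j = (a, q\<^sub>0, h)\<close>\<close>
  "init_cell_fm M t j a h = ex [t, j] (\<lambda>z. And (num_fm 0 z) (ncell_fm t z j a (init M) h))"

definition blank_fm :: "turing \<Rightarrow> tm \<Rightarrow> tm \<Rightarrow> fm" where
    \<comment> \<open>\<open>\<forall>j (j > l \<rightarrow> t\<^sub>0\<^sub>,\<^sub>j = (\<squnion>, q\<^sub>0, 0))\<close>\<close>
  "blank_fm M t l = all [t, l] (\<lambda>j.
     Imp (And (nat_fm j) (Mem l j)) (init_cell_fm M t j Blank 0))"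

text \<open>
  The formulas of the input sequence mention exactly one numeral that depends on the input; it
  is introduced as the value of the variable \<open>x\<^sub>0\<close> by an outermost existential quantifier.
\<close>

definition with_num :: "nat \<Rightarrow> fm \<Rightarrow> fm" where
  "with_num k a = Ex 0 (And (numv k 0 1) a)"

definition input_fms :: "turing \<Rightarrow> tm \<Rightarrow> bool list \<Rightarrow> fm list" where
  "input_fms M t s =
     [with_num (length s) (blank_fm M t (Var 0)),
      with_num 0 (init_cell_fm M t (Var 0) Start 1)] @
     map (\<lambda>k. with_num (Suc k) (init_cell_fm M t (Var 0) (bit_sym (s ! k)) 0)) [0..<length s]"

definition Thy :: "turing \<Rightarrow> bool list \<Rightarrow> fm list" where
  "Thy M s = def_fms M Ct @ input_fms M Ct s"

primrec AL :: "fm list \<Rightarrow> fm \<Rightarrow> bool" where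
  "AL [] a = False"
| "AL (b # bs) a = (if b = a then True else AL bs a)"

lemma AL_iff: "AL bs a \<longleftrightarrow> a \<in> set bs"
  by (induction bs) auto

definition Thy_AL :: "turing \<Rightarrow> bool list \<Rightarrow> rec_theory" where
  "Thy_AL M s = (set (Thy M s), AL (Thy M s))"

definition out_fm :: "turing \<Rightarrow> tm \<Rightarrow> fm" where \<comment> \<open>\<open>\<exists>i. t\<^sub>i\<^sub>,\<^sub>1 = (1, q\<^sub>h\<^sub>a\<^sub>l\<^sub>t, 1)\<close>\<close>
  "out_fm M t = ex2 [t] (\<lambda>i j. Conj [nat_fm i, num_fm 1 j, ncell_fm t i j One (halt M) 1])"

definition normal_proof :: "turing \<Rightarrow> bool list \<Rightarrow> fm list \<Rightarrow> bool" where
  "normal_proof M r \<pi> \<longleftrightarrow> proves (Thy_AL M r) \<pi> (out_fm M Ct)"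


section \<open>Syntax inside set theory\<close>

text \<open>
  Terms and formulas are coded by sets: \<open>x\<^sub>n\<close> by \<open>(0, n)\<close>, the constant \<open>t\<close> by \<open>(1, 0)\<close>, and
  equations, membership, negation, implication and quantification by pairs with first component
  \<open>0, \<dots>, 4\<close>.  In all of the following, the last argument is the code.
\<close>

definition tag_fm :: "nat \<Rightarrow> tm \<Rightarrow> tm \<Rightarrow> fm" where
  "tag_fm k a c = ex [a, c] (\<lambda>z. And (num_fm k z) (pair_fm z a c))"

definition tag2_fm :: "nat \<Rightarrow> tm \<Rightarrow> tm \<Rightarrow> tm \<Rightarrow> fm" where
  "tag2_fm k a b c = ex [a, b, c] (\<lambda>p. And (pair_fm a b p) (tag_fm k p c))"

definition cVar :: "tm \<Rightarrow> tm \<Rightarrow> fm" where "cVar n c = tag_fm 0 n c"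
definition cCt :: "tm \<Rightarrow> fm" where "cCt c = ex [c] (\<lambda>z. And (num_fm 0 z) (tag_fm 1 z c))"
definition cEq :: "tm \<Rightarrow> tm \<Rightarrow> tm \<Rightarrow> fm" where "cEq = tag2_fm 0"
definition cMem :: "tm \<Rightarrow> tm \<Rightarrow> tm \<Rightarrow> fm" where "cMem = tag2_fm 1"
definition cNeg :: "tm \<Rightarrow> tm \<Rightarrow> fm" where "cNeg = tag_fm 2"
definition cImp :: "tm \<Rightarrow> tm \<Rightarrow> tm \<Rightarrow> fm" where "cImp = tag2_fm 3"
definition cAll :: "tm \<Rightarrow> tm \<Rightarrow> tm \<Rightarrow> fm" where "cAll = tag2_fm 4"

text \<open>\<open>code_fm a c\<close>: \<open>c\<close> is the code of the given formula \<open>a\<close>.\<close>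

primrec code_tm :: "tm \<Rightarrow> tm \<Rightarrow> fm" where
  "code_tm (Var n) c = ex [c] (\<lambda>x. And (num_fm n x) (cVar x c))"
| "code_tm Ct c = cCt c"

primrec code_fm :: "fm \<Rightarrow> tm \<Rightarrow> fm" where
  "code_fm (Eq s t) c = ex2 [c] (\<lambda>x y. Conj [code_tm s x, code_tm t y, cEq x y c])"
| "code_fm (Mem s t) c = ex2 [c] (\<lambda>x y. Conj [code_tm s x, code_tm t y, cMem x y c])"
| "code_fm (Neg a) c = ex [c] (\<lambda>x. And (code_fm a x) (cNeg x c))"
| "code_fm (Imp a b) c = ex2 [c] (\<lambda>x y. Conj [code_fm a x, code_fm b y, cImp x y c])"
| "code_fm (All n a) c = ex2 [c] (\<lambda>x y. Conj [num_fm n x, code_fm a y, cAll x y c])"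

text \<open>
  Formula schemes, with metavariables \<open>FH k\<close> for formulas, \<open>TH k\<close> for terms and \<open>VH k\<close> for
  variables; the first argument of \<open>PAll\<close> is the number of a metavariable for variables.
  \<open>scheme_fm Fs Vs Ts p c\<close> says that \<open>c\<close> is the code of the instance of \<open>p\<close> given by the codes
  of formulas \<open>Fs\<close>, the indices of variables \<open>Vs\<close> and the codes of terms \<open>Ts\<close>.
\<close>

datatype stm = TH nat | VH nat
datatype scheme = FH nat | PFm fm | PEq stm stm | PMem stm stm | PNeg scheme
  | PImp scheme scheme | PAll nat scheme

definition "PAnd p q = PNeg (PImp p (PNeg q))"
definition "PIff p q = PAnd (PImp p q) (PImp q p)"
definition "PEx v p = PNeg (PAll v (PNeg p))"

fun scheme_tm :: "tm list \<Rightarrow> tm list \<Rightarrow> stm \<Rightarrow> tm \<Rightarrow> fm" where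
  "scheme_tm Vs Ts (TH k) c = Eq c (Ts ! k)"
| "scheme_tm Vs Ts (VH k) c = cVar (Vs ! k) c"

primrec scheme_fm :: "tm list \<Rightarrow> tm list \<Rightarrow> tm list \<Rightarrow> scheme \<Rightarrow> tm \<Rightarrow> fm" where
  "scheme_fm Fs Vs Ts (FH k) c = Eq c (Fs ! k)"
| "scheme_fm Fs Vs Ts (PFm a) c = code_fm a c"
| "scheme_fm Fs Vs Ts (PEq s t) c = ex2 (c # Fs @ Vs @ Ts) (\<lambda>x y.
     Conj [scheme_tm Vs Ts s x, scheme_tm Vs Ts t y, cEq x y c])"
| "scheme_fm Fs Vs Ts (PMem s t) c = ex2 (c # Fs @ Vs @ Ts) (\<lambda>x y.
     Conj [scheme_tm Vs Ts s x, scheme_tm Vs Ts t y, cMem x y c])"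
| "scheme_fm Fs Vs Ts (PNeg p) c = ex (c # Fs @ Vs @ Ts) (\<lambda>x.
     And (scheme_fm Fs Vs Ts p x) (cNeg x c))"
| "scheme_fm Fs Vs Ts (PImp p q) c = ex2 (c # Fs @ Vs @ Ts) (\<lambda>x y.
     Conj [scheme_fm Fs Vs Ts p x, scheme_fm Fs Vs Ts q y, cImp x y c])"
| "scheme_fm Fs Vs Ts (PAll k p) c = ex (c # Fs @ Vs @ Ts) (\<lambda>x.
     And (scheme_fm Fs Vs Ts p x) (cAll (Vs ! k) x c))"

text \<open>
  Inductive definitions: \<open>x\<close> is the last entry of a finite sequence \<open>f\<close>, every entry \<open>y = f(i)\<close>
  of which satisfies \<open>F f i y\<close>.  The parameters occurring in \<open>F\<close> are listed in \<open>ps\<close>.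
\<close>

definition deriv_fm :: "tm list \<Rightarrow> (tm \<Rightarrow> tm \<Rightarrow> tm \<Rightarrow> fm) \<Rightarrow> tm \<Rightarrow> fm" where
  "deriv_fm ps F x = ex3 (x # ps) (\<lambda>n m f. Conj
     [succ_fm n m, seq_fm f m, app_fm f n x,
      all2 (n # m # f # x # ps) (\<lambda>i y. Imp (And (Mem i m) (app_fm f i y)) (F f i y))])"

definition prev_fm :: "tm \<Rightarrow> tm \<Rightarrow> tm \<Rightarrow> fm" where
  "prev_fm f i y = ex [f, i, y] (\<lambda>j. And (Mem j i) (app_fm f j y))"

definition is_tm_fm :: "tm \<Rightarrow> fm" where
  "is_tm_fm c = Or (ex [c] (\<lambda>n. And (nat_fm n) (cVar n c))) (cCt c)"

definition is_fm_fm :: "tm \<Rightarrow> fm" where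
  "is_fm_fm = deriv_fm [] (\<lambda>f i y. Disj
    [ex2 [f, i, y] (\<lambda>a b. Conj [is_tm_fm a, is_tm_fm b, Or (cEq a b y) (cMem a b y)]),
     ex [f, i, y] (\<lambda>a. And (prev_fm f i a) (cNeg a y)),
     ex2 [f, i, y] (\<lambda>a b. Conj [prev_fm f i a, prev_fm f i b, cImp a b y]),
     ex2 [f, i, y] (\<lambda>n a. Conj [nat_fm n, prev_fm f i a, cAll n a y])])"

definition not_free_fm :: "tm \<Rightarrow> tm \<Rightarrow> fm" where \<comment> \<open>\<open>x\<^sub>v\<close> is not free in the formula \<open>c\<close>\<close>
  "not_free_fm v = deriv_fm [v] (\<lambda>f i y. Disj
    [ex2 [v, f, i, y] (\<lambda>a b. Conj [is_tm_fm a, is_tm_fm b, Neg (cVar v a), Neg (cVar v b),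
       Or (cEq a b y) (cMem a b y)]),
     ex [v, f, i, y] (\<lambda>a. And (prev_fm f i a) (cNeg a y)),
     ex2 [v, f, i, y] (\<lambda>a b. Conj [prev_fm f i a, prev_fm f i b, cImp a b y]),
     ex2 [v, f, i, y] (\<lambda>n a. Conj [nat_fm n, prev_fm f i a, cAll n a y]),
     ex [v, f, i, y] (\<lambda>a. And (is_fm_fm a) (cAll v a y))])"

definition subst_tm_fm :: "tm \<Rightarrow> tm \<Rightarrow> tm \<Rightarrow> tm \<Rightarrow> fm" where
  "subst_tm_fm v u a b = And (is_tm_fm a)
     (Or (And (cVar v a) (Eq b u)) (And (Neg (cVar v a)) (Eq b a)))"

text \<open>
  \<open>b\<close> is the result of substituting the term \<open>u\<close> for \<open>x\<^sub>v\<close> in the formula \<open>a\<close>, and \<open>u\<close> is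
  free for \<open>x\<^sub>v\<close> in \<open>a\<close>.  The entries of the derivation are pairs \<open>(a, b)\<close>.
\<close>

definition subst_fm :: "tm \<Rightarrow> tm \<Rightarrow> tm \<Rightarrow> tm \<Rightarrow> fm" where
  "subst_fm v u a b = ex [v, u, a, b] (\<lambda>c. And (pair_fm a b c) (deriv_fm [v, u] (\<lambda>f i y.
     ex2 [v, u, f, i, y] (\<lambda>a b. And (pair_fm a b y) (Disj
      [ex4 [v, u, f, i, a, b] (\<lambda>a1 a2 b1 b2. Conj
         [subst_tm_fm v u a1 b1, subst_tm_fm v u a2 b2,
          Or (And (cEq a1 a2 a) (cEq b1 b2 b)) (And (cMem a1 a2 a) (cMem b1 b2 b))]),
       ex3 [v, u, f, i, a, b] (\<lambda>a1 b1 p. Conj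
         [pair_fm a1 b1 p, prev_fm f i p, cNeg a1 a, cNeg b1 b]),
       ex4 [v, u, f, i, a, b] (\<lambda>a1 a2 b1 b2. ex2 [v, u, f, i, a, b, a1, a2, b1, b2] (\<lambda>p q. Conj
         [pair_fm a1 b1 p, prev_fm f i p, pair_fm a2 b2 q, prev_fm f i q,
          cImp a1 a2 a, cImp b1 b2 b])),
       And (not_free_fm v a) (Eq b a),
       ex4 [v, u, f, i, a, b] (\<lambda>n a1 b1 p. Conj
         [nat_fm n, Neg (Eq n v), Neg (cVar n u), pair_fm a1 b1 p, prev_fm f i p,
          cAll n a1 a, cAll n b1 b])]))) c))"

definition prop_schemes :: "scheme list" where
  "prop_schemes =
   [PImp (FH 0) (PImp (FH 1) (FH 0)),
    PImp (PImp (FH 0) (PImp (FH 1) (FH 2))) (PImp (PImp (FH 0) (FH 1)) (PImp (FH 0) (FH 2))),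
    PImp (PImp (PNeg (FH 0)) (PNeg (FH 1))) (PImp (FH 1) (FH 0))]"

definition eq_schemes :: "scheme list" where
  "eq_schemes =
   [PEq (TH 0) (TH 0),
    PImp (PEq (TH 0) (TH 1)) (PImp (PEq (TH 0) (TH 2)) (PEq (TH 1) (TH 2))),
    PImp (PEq (TH 0) (TH 1)) (PImp (PMem (TH 0) (TH 2)) (PMem (TH 1) (TH 2))),
    PImp (PEq (TH 0) (TH 1)) (PImp (PMem (TH 2) (TH 0)) (PMem (TH 2) (TH 1)))]"

definition logical_axiom_fm :: "tm \<Rightarrow> fm" where
  "logical_axiom_fm x = Disj (
     map (\<lambda>p. ex3 [x] (\<lambda>a b c. Conj
       [is_fm_fm a, is_fm_fm b, is_fm_fm c, scheme_fm [a, b, c] [] [] p x])) prop_schemes @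
     map (\<lambda>p. ex3 [x] (\<lambda>s t u. Conj
       [is_tm_fm s, is_tm_fm t, is_tm_fm u, scheme_fm [] [] [s, t, u] p x])) eq_schemes @
     [ex4 [x] (\<lambda>v u a b. Conj
       [nat_fm v, is_tm_fm u, is_fm_fm a, subst_fm v u a b,
        scheme_fm [a, b] [v] [] (PImp (PAll 0 (FH 0)) (FH 1)) x]),
      ex3 [x] (\<lambda>v a b. Conj
       [nat_fm v, is_fm_fm a, is_fm_fm b, not_free_fm v a,
        scheme_fm [a, b] [v] []
          (PImp (PAll 0 (PImp (FH 0) (FH 1))) (PImp (FH 0) (PAll 0 (FH 1)))) x])])"

definition separation_scheme :: scheme where
  "separation_scheme = PEx 1 (PAll 0 (PIff (PMem (VH 0) (VH 1)) (PAnd (PMem (VH 0) (VH 2)) (FH 0))))"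

definition replacement_scheme :: scheme where
  "replacement_scheme = PImp
     (PAll 0 (PImp (PMem (VH 0) (VH 2)) (PEx 3 (PAll 1 (PImp (FH 0) (PEq (VH 1) (VH 3)))))))
     (PEx 3 (PAll 1 (PIff (PMem (VH 1) (VH 3)) (PEx 0 (PAnd (PMem (VH 0) (VH 2)) (FH 0))))))"

definition zfc_axiom_fm :: "tm \<Rightarrow> fm" where
  "zfc_axiom_fm c = Disj (
     map (\<lambda>a. code_fm a c) zfc_single @
     [ex4 [c] (\<lambda>a x y z. Conj
       [is_fm_fm a, nat_fm x, nat_fm y, nat_fm z,
        Neg (Eq x y), Neg (Eq x z), Neg (Eq y z), not_free_fm y a,
        scheme_fm [a] [x, y, z] [] separation_scheme c]),
      ex4 [c] (\<lambda>a x y z. ex [c, a, x, y, z] (\<lambda>u. Conj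
       [is_fm_fm a, nat_fm x, nat_fm y, nat_fm z, nat_fm u,
        Neg (Eq x y), Neg (Eq x z), Neg (Eq y z), Neg (Eq x u), Neg (Eq y u), Neg (Eq z u),
        not_free_fm u a, scheme_fm [a] [x, y, z, u] [] replacement_scheme c]))])"


section \<open>The theories, the checker and the machine inside set theory\<close>

definition bool_val_fm :: "fm \<Rightarrow> tm \<Rightarrow> fm" where \<comment> \<open>\<open>v\<close> is \<open>1\<close> if \<open>a\<close> holds, and \<open>0\<close> otherwise\<close>
  "bool_val_fm a v = Or (And a (num_fm 1 v)) (And (Neg a) (num_fm 0 v))"

text \<open>
  \<open>AL_fm U y v\<close>: searching the finite sequence \<open>U\<close> for \<open>y\<close>, by comparison with the entries,
  returns \<open>v\<close>.
\<close>

definition AL_fm :: "tm \<Rightarrow> tm \<Rightarrow> tm \<Rightarrow> fm" where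
  "AL_fm U y v = bool_val_fm (ex [U, y] (\<lambda>k. app_fm U k y)) v"

text \<open>
  \<open>b U y v\<close> stands for: the algorithm \<open>b\<close>, asked whether \<open>y \<in> U\<close>, returns \<open>v\<close>.
\<close>

definition valid_fm ::
  "(tm \<Rightarrow> tm \<Rightarrow> tm \<Rightarrow> fm) \<Rightarrow> tm \<Rightarrow> tm \<Rightarrow> nat \<Rightarrow> justification \<Rightarrow> fm" where
  "valid_fm b U \<sigma> i J = ex [U, \<sigma>] (\<lambda>y. And (entry_fm \<sigma> i y) (case J of
     Log_J \<Rightarrow> logical_axiom_fm y
   | ZFC_J \<Rightarrow> zfc_axiom_fm y
   | Thy_J \<Rightarrow> ex [U, \<sigma>, y] (\<lambda>v. And (num_fm 1 v) (b U y v))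
   | MP_J j k \<Rightarrow> ex2 [U, \<sigma>, y] (\<lambda>c a. Conj [entry_fm \<sigma> j c, entry_fm \<sigma> k a, cImp a y c])
   | Gen_J j k \<Rightarrow> ex2 [U, \<sigma>, y] (\<lambda>a x. Conj [entry_fm \<sigma> j a, num_fm k x, cAll x a y])))"

text \<open>
  \<open>CK_fm Js b U \<sigma> v\<close>: the checker given by the recorded justifications \<open>Js\<close> returns \<open>v\<close> on
  input \<open>(\<langle>U, b\<rangle>, \<sigma>)\<close>.
\<close>

definition CK_fm ::
  "justification list \<Rightarrow> (tm \<Rightarrow> tm \<Rightarrow> tm \<Rightarrow> fm) \<Rightarrow> tm \<Rightarrow> tm \<Rightarrow> tm \<Rightarrow> fm" where
  "CK_fm Js b U \<sigma> v = bool_val_fm (And (length_fm \<sigma> (length Js))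
     (Conj (map (\<lambda>i. valid_fm b U \<sigma> i (Js ! i)) [0..<length Js]))) v"

definition code_seq_fm :: "fm list \<Rightarrow> tm \<Rightarrow> fm" where
  "code_seq_fm \<pi> p = And (length_fm p (length \<pi>))
     (Conj (map (\<lambda>i. ex [p] (\<lambda>y. And (entry_fm p i y) (code_fm (\<pi> ! i) y))) [0..<length \<pi>]))"

definition binary_fm :: "tm \<Rightarrow> tm \<Rightarrow> fm" where \<comment> \<open>\<open>s\<close> is a binary string of length \<open>l\<close>\<close>
  "binary_fm s l = And (seq_fm s l)
     (all2 [s, l] (\<lambda>k y. Imp (app_fm s k y) (one_of_fm [0, 1] y)))"

text \<open>\<open>num_code_fm k c\<close>: \<open>c\<close> is the code of \<open>numv k 0 1\<close>, where \<open>k\<close> is now a set.\<close>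

definition num_code_fm :: "tm \<Rightarrow> tm \<Rightarrow> fm" where
  "num_code_fm k c = ex2 [k, c] (\<lambda>m f. Conj
     [succ_fm k m, seq_fm f m, app_fm f k c,
      all2 [k, c, m, f] (\<lambda>i y. Imp (And (Mem i m) (app_fm f i y)) (Or
        (And (empty_fm i) (code_fm (numv 0 0 1) y))
        (ex4 [m, f, i, y] (\<lambda>j a x0 x1. Conj
          [succ_fm j i, app_fm f j a, num_fm 0 x0, num_fm 1 x1,
           scheme_fm [a] [x0, x1] []
             (PEx 1 (PAnd (PFm (succ_fm (Var 1) (Var 0)))
                (PEx 0 (PAnd (PFm (Eq (Var 0) (Var 1))) (FH 0))))) y]))))])"

text \<open>\<open>with_num_code_fm k a c\<close>: \<open>c\<close> is the code of \<open>with_num k a\<close>, where \<open>k\<close> is now a set.\<close>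

definition with_num_code_fm :: "tm \<Rightarrow> fm \<Rightarrow> tm \<Rightarrow> fm" where
  "with_num_code_fm k a c = ex2 [k, c] (\<lambda>d x0. Conj
     [num_code_fm k d, num_fm 0 x0, scheme_fm [d] [x0] [] (PEx 0 (PAnd (FH 0) (PFm a))) c])"

text \<open>
  \<open>U\<close> is the finite sequence of the codes of the formulas of \<open>Thy M s\<close>, where \<open>s\<close> is now a set.
\<close>

definition Thy_fm :: "turing \<Rightarrow> tm \<Rightarrow> tm \<Rightarrow> fm" where
  "Thy_fm M s U = (let D = length (def_fms M Ct) in ex2 [s, U] (\<lambda>l d. Conj
     [binary_fm s l, add_fm (D + 2) l d, seq_fm U d,
      Conj (map (\<lambda>i. ex [U] (\<lambda>y. And (entry_fm U i y) (code_fm (def_fms M Ct ! i) y))) [0..<D]),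
      ex [U, l] (\<lambda>y. And (entry_fm U D y) (with_num_code_fm l (blank_fm M Ct (Var 0)) y)),
      ex [U] (\<lambda>y. And (entry_fm U (D + 1) y)
        (code_fm (with_num 0 (init_cell_fm M Ct (Var 0) Start 1)) y)),
      all [s, U, l] (\<lambda>k. Imp (Mem k l) (ex4 [s, U, l, k] (\<lambda>i y k' a. Conj
        [add_fm (D + 2) k i, app_fm U i y, succ_fm k k', app_fm s k a,
         Or (And (num_fm 0 a) (with_num_code_fm k' (init_cell_fm M Ct (Var 0) Zero 0) y))
            (And (num_fm 1 a) (with_num_code_fm k' (init_cell_fm M Ct (Var 0) One 0) y))])))]))"

text \<open>\<open>t\<close> is the computation table of \<open>M\<close> on the binary string \<open>s\<close>.\<close>

definition table_fm :: "turing \<Rightarrow> tm \<Rightarrow> tm \<Rightarrow> fm" where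
  "table_fm M s t = And (Conj (def_fms M t)) (ex [s, t] (\<lambda>l. Conj
     [binary_fm s l, blank_fm M t l,
      ex [t] (\<lambda>j. And (num_fm 0 j) (init_cell_fm M t j Start 1)),
      all3 [s, t, l] (\<lambda>k a j. Imp (Conj [Mem k l, app_fm s k a, succ_fm k j])
        (Or (And (num_fm 0 a) (init_cell_fm M t j Zero 0))
            (And (num_fm 1 a) (init_cell_fm M t j One 0))))]))"

definition outputs_1_fm :: "turing \<Rightarrow> tm \<Rightarrow> fm" where \<comment> \<open>\<open>M(s) = 1\<close>\<close>
  "outputs_1_fm M s = ex [s] (\<lambda>t. And (table_fm M s t) (out_fm M t))"

text \<open>\<open>\<forall>s (CK\<^sub>\<pi>(\<langle>T\<^sub>\<langle>\<^sub>M\<^sub>,\<^sub>s\<^sub>\<rangle>, AL\<rangle>, \<pi>) = 1 \<rightarrow> M(s) = 1)\<close>, \<open>s\<close> ranging over binary strings.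
  The theory, the proof and the output of the checker are defined objects, whose definitions are
  \<open>Thy_fm\<close>, \<open>code_seq_fm\<close> and \<open>CK_fm\<close>.\<close>

definition checker_formula :: "turing \<Rightarrow> fm list \<Rightarrow> justification list \<Rightarrow> fm" where
  "checker_formula M \<pi> Js = all [] (\<lambda>s. Imp (ex [s] (\<lambda>l. binary_fm s l))
     (Imp (ex3 [s] (\<lambda>U p v. Conj
            [Thy_fm M s U, code_seq_fm \<pi> p, CK_fm Js AL_fm U p v, num_fm 1 v]))
       (outputs_1_fm M s)))"

end

theory Submission
  imports Defs "HOL-Library.Countable_Set"
begin

text \<open>
  By the completeness theorem it suffices to show that the formula holds in every model of ZFC.  Let
  \<open>s\<close> be a binary string of such a model (possibly of nonstandard length) on which the checker
  accepts.  The model contains a computation table \<open>t\<close> of \<open>M\<close> on \<open>s\<close>.  Interpreting the constant by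
  \<open>t\<close>, all formulas of the standard proof \<open>\<pi>\<close> become true, by induction along \<open>\<pi>\<close>: logical and ZFC
  axioms and the rules are sound, and a formula of \<open>\<pi>\<close> that was justified by the theory for \<open>r\<close> has,
  as the checker accepts, its code in the theory for \<open>s\<close> of the model; since coding is injective, it
  is a formula about standard numerals that is true of \<open>t\<close>.  The last formula of \<open>\<pi>\<close> then says that
  \<open>M\<close> outputs \<open>1\<close> on \<open>s\<close>.
\<close>

section \<open>Semantics\<close>

text \<open>Two features of the setting shape the argument. Provability asks for a derivation in the
  language without \<open>Ct\<close>, while the schemas of \<open>zfc_axiom\<close> may mention
  \<open>Ct\<close>. Replacing \<open>Ct\<close> by a new variable answers both needs that arise: a
  derivation obtained from completeness is purged of the constant, and the ZFC axioms of a model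
  stay true however the constant is interpreted, so that it may be reinterpreted by the computation
  table. Moreover, a model may have nonstandard natural numbers. Induction along a computation
  therefore has to take place inside the model, which permits it only for definable predicates; the
  closure rules for \<open>Dfn\<close> supply definability without writing formulas. Conversely,
  that only standard numerals occur in codes of actual formulas is an induction in the metatheory,
  on the height of the formula. Completeness speaks of models on \<open>nat\<close>, since a premise
  cannot quantify over types; the term model is transported there, being countable and, as a model
  of set theory, infinite.\<close>

primrec val :: "'a \<Rightarrow> (nat \<Rightarrow> 'a) \<Rightarrow> tm \<Rightarrow> 'a" where
  "val c e (Var n) = e n"
| "val c e Ct = c"

text \<open>The equality symbol is interpreted by an arbitrary relation \<open>Q\<close>, so that the term model need
  not be a quotient.\<close>

primrec ev ::
  "('a \<Rightarrow> 'a \<Rightarrow> bool) \<Rightarrow> ('a \<Rightarrow> 'a \<Rightarrow> bool) \<Rightarrow> 'a \<Rightarrow> (nat \<Rightarrow> 'a) \<Rightarrow> fm \<Rightarrow> bool" where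
  "ev Q E c e (Eq s t) = Q (val c e s) (val c e t)"
| "ev Q E c e (Mem s t) = E (val c e s) (val c e t)"
| "ev Q E c e (Neg a) = (\<not> ev Q E c e a)"
| "ev Q E c e (Imp a b) = (ev Q E c e a \<longrightarrow> ev Q E c e b)"
| "ev Q E c e (All x a) = (\<forall>d. ev Q E c (e(x := d)) a)"

primrec vars :: "fm \<Rightarrow> nat set" where
  "vars (Eq s t) = {x. Var x \<in> {s, t}}"
| "vars (Mem s t) = {x. Var x \<in> {s, t}}"
| "vars (Neg a) = vars a"
| "vars (Imp a b) = vars a \<union> vars b"
| "vars (All x a) = insert x (vars a)"

primrec bv :: "fm \<Rightarrow> nat set" where
  "bv (Eq s t) = {}"
| "bv (Mem s t) = {}"
| "bv (Neg a) = bv a"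
| "bv (Imp a b) = bv a \<union> bv b"
| "bv (All x a) = insert x (bv a)"

text \<open>Terms do not count, so substitution preserves the height. Inductions that pass from
  \<open>All x b\<close> to an instance of \<open>b\<close>, which is not a subformula, run on
  it.\<close>

primrec height :: "fm \<Rightarrow> nat" where
  "height (Eq s t) = 0"
| "height (Mem s t) = 0"
| "height (Neg a) = Suc (height a)"
| "height (Imp a b) = Suc (height a + height b)"
| "height (All x a) = Suc (height a)"

lemma finite_tm_vars: "finite {x. Var x \<in> {s, t}}"
proof -
  have "{x. Var x \<in> {s, t}} \<subseteq> {idx s - 1, idx t - 1}" by force
  then show ?thesis using finite_subset by blast
qed

lemma finite_vars [simp]: "finite (vars a)"
  by (induction a) (simp_all only: vars.simps finite_tm_vars finite_insert finite_Un)

lemma fv_subset_vars: "fv a \<subseteq> vars a"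
  by (induction a) auto

lemma finite_fv [simp]: "finite (fv a)"
  using fv_subset_vars finite_vars finite_subset by metis

lemma ex_fresh: "finite S \<Longrightarrow> \<exists>y::nat. y \<notin> S"
  using ex_new_if_finite infinite_UNIV_nat by blast

lemma val_cong: "(\<And>x. s = Var x \<Longrightarrow> e x = e' x) \<Longrightarrow> val c e s = val c e' s"
  by (cases s) auto

lemma ev_cong: "(\<And>x. x \<in> fv a \<Longrightarrow> e x = e' x) \<Longrightarrow> ev Q E c e a = ev Q E c e' a"
proof (induction a arbitrary: e e')
  case (All x a)
  have "ev Q E c (e(x := d)) a = ev Q E c (e'(x := d)) a" for d
    by (rule All.IH) (use All.prems in auto)
  then show ?case by simp
next
  case (Eq s t)
  then have "val c e s = val c e' s" "val c e t = val c e' t" by (auto intro!: val_cong)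
  then show ?case by simp
next
  case (Mem s t)
  then have "val c e s = val c e' s" "val c e t = val c e' t" by (auto intro!: val_cong)
  then show ?case by simp
next
  case (Imp a b)
  have "ev Q E c e a = ev Q E c e' a" "ev Q E c e b = ev Q E c e' b"
    by (rule Imp.IH; use Imp.prems in simp)+
  then show ?case by simp
next
  case (Neg a)
  have "ev Q E c e a = ev Q E c e' a" by (rule Neg.IH) (use Neg.prems in simp)
  then show ?case by simp
qed

lemma val_substt [simp]: "val c e (substt x u s) = val c (e(x := val c e u)) s"
  by (cases s) (auto simp: substt_def)

lemma ev_subst:
  "free_for u x a \<Longrightarrow> ev Q E c e (subst x u a) = ev Q E c (e(x := val c e u)) a"
proof (induction a arbitrary: e)
  case (All y a)
  show ?case
  proof (cases "x \<notin> fv (All y a)")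
    case True
    have *: "ev Q E c e' (subst x u (All y a)) = ev Q E c e' (All y a)" for e'
    proof (cases "y = x")
      case False
      have "x \<notin> fv a" using True False by auto
      then have "subst x u a = a"
        by (induction a) (auto simp: substt_def)
      then show ?thesis by simp
    qed simp
    show ?thesis unfolding * by (rule ev_cong) (use True in auto)
  next
    case False
    then have u: "u \<noteq> Var y" "free_for u x a" "y \<noteq> x" using All.prems by auto
    have "val c (e(y := d)) u = val c e u" for d using u(1) by (cases u) auto
    then have "ev Q E c (e(y := d)) (subst x u a) = ev Q E c (e(x := val c e u, y := d)) a" for d
      using All.IH[OF u(2), of "e(y := d)"] fun_upd_twist[OF u(3)] by metis
    then show ?thesis using u(3) by (simp add: fun_upd_def)
  qed
qed auto

lemma height_subst [simp]: "height (subst x u a) = height a"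
  by (induction a) auto

lemma free_for_fresh: "y \<notin> vars a \<Longrightarrow> free_for (Var y) x a"
  by (induction a) auto

lemma free_for_bv: "y \<notin> bv a \<Longrightarrow> free_for (Var y) x a"
  by (induction a) auto

lemma free_for_Ct: "free_for Ct x a"
  by (induction a) auto

lemma free_for_self: "free_for (Var x) x a"
  by (induction a) auto

lemma subst_self [simp]: "subst x (Var x) a = a"
  by (induction a) (auto simp: substt_def)

lemma subst_subst_fresh: "y \<notin> vars a \<Longrightarrow> subst y (Var x) (subst x (Var y) a) = a"
proof (induction a)
  case (All z a)
  have "subst y u b = b" if "y \<notin> vars b" for u b
    using that by (induction b) (auto simp: substt_def)
  then show ?case using All by auto
qed (auto simp: substt_def)

lemma free_for_subst_fresh: "y \<notin> vars a \<Longrightarrow> free_for (Var x) y (subst x (Var y) a)"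
  using fv_subset_vars by (induction a) auto

lemma not_fv_subst: "x \<noteq> y \<Longrightarrow> x \<notin> fv (subst x (Var y) a)"
  by (induction a) (auto simp: substt_def)

lemma ev_alpha:
  assumes "y \<notin> vars a"
  shows "ev Q E c e (All y (subst x (Var y) a)) = ev Q E c e (All x a)"
proof -
  have "ev Q E c (e(y := d)) (subst x (Var y) a) = ev Q E c (e(x := d)) a" for d
    unfolding ev_subst[OF free_for_fresh[OF assms]]
    by (rule ev_cong) (use assms fv_subset_vars in auto)
  then show ?thesis by simp
qed

lemma logical_axiom_sound: "logical_axiom a \<Longrightarrow> ev (=) E c e a"
proof (induction rule: logical_axiom.induct)
  case (4 u x a)
  then show ?case by (simp add: ev_subst)
next
  case (5 x a b)
  then have "ev (=) E c (e(x := d)) a = ev (=) E c e a" for d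
    by (intro ev_cong) auto
  then show ?case by simp
qed auto


section \<open>The Hilbert calculus\<close>

inductive pr :: "fm \<Rightarrow> bool" where
  log: "logical_axiom a \<Longrightarrow> pr a"
| zfc: "zfc_axiom a \<Longrightarrow> pr a"
| mp: "pr (Imp a b) \<Longrightarrow> pr a \<Longrightarrow> pr b"
| gen: "pr a \<Longrightarrow> pr (All x a)"

text \<open>Hypotheses enter only through modus ponens, and generalization is confined to
  \<open>pr\<close>. This gives the deduction theorem without side conditions; generalization under
  hypotheses returns as \<open>ded_gen\<close>.\<close>

inductive ded :: "fm set \<Rightarrow> fm \<Rightarrow> bool" for \<Gamma> where
  hyp: "a \<in> \<Gamma> \<Longrightarrow> ded \<Gamma> a"
| th: "pr a \<Longrightarrow> ded \<Gamma> a"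
| mp: "ded \<Gamma> (Imp a b) \<Longrightarrow> ded \<Gamma> a \<Longrightarrow> ded \<Gamma> b"

lemma ax_K: "ded \<Gamma> (Imp a (Imp b a))"
  by (intro ded.th pr.log logical_axiom.intros)

lemma ax_S: "ded \<Gamma> (Imp (Imp a (Imp b c)) (Imp (Imp a b) (Imp a c)))"
  by (intro ded.th pr.log logical_axiom.intros)

lemma ax_N: "ded \<Gamma> (Imp (Imp (Neg a) (Neg b)) (Imp b a))"
  by (intro ded.th pr.log logical_axiom.intros)

lemma ded_mono: "ded \<Gamma> a \<Longrightarrow> \<Gamma> \<subseteq> \<Gamma>' \<Longrightarrow> ded \<Gamma>' a"
  by (induction rule: ded.induct) (auto intro: ded.intros)

lemma ded_weaken: "ded \<Gamma> a \<Longrightarrow> ded (insert b \<Gamma>) a"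
  by (rule ded_mono) auto

lemma ded_compact: "ded \<Gamma> a \<Longrightarrow> \<exists>\<Gamma>'. finite \<Gamma>' \<and> \<Gamma>' \<subseteq> \<Gamma> \<and> ded \<Gamma>' a"
proof (induction rule: ded.induct)
  case (hyp a)
  then show ?case by (intro exI[of _ "{a}"]) (auto intro: ded.hyp)
next
  case (th a)
  then show ?case by (intro exI[of _ "{}"]) (auto intro: ded.th)
next
  case (mp a b)
  then obtain G1 G2 where "finite G1" "G1 \<subseteq> \<Gamma>" "ded G1 (Imp a b)"
    "finite G2" "G2 \<subseteq> \<Gamma>" "ded G2 a" by blast
  moreover have "ded (G1 \<union> G2) b"
    using ded.mp[OF ded_mono[OF calculation(3)] ded_mono[OF calculation(6)]] by blast
  ultimately show ?case by (intro exI[of _ "G1 \<union> G2"]) auto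
qed

lemma deduction: "ded (insert b \<Gamma>) a \<Longrightarrow> ded \<Gamma> (Imp b a)"
proof (induction rule: ded.induct)
  case (hyp a)
  show ?case
  proof (cases "a = b")
    case True
    have "ded \<Gamma> (Imp (Imp b (Imp (Imp b b) b)) (Imp (Imp b (Imp b b)) (Imp b b)))" by (rule ax_S)
    from ded.mp[OF ded.mp[OF this ax_K] ax_K] show ?thesis unfolding True .
  next
    case False
    then have "ded \<Gamma> a" using hyp by (auto intro: ded.hyp)
    then show ?thesis by (rule ded.mp[OF ax_K])
  qed
next
  case (th a)
  then show ?case by (intro ded.mp[OF ax_K] ded.th)
next
  case (mp a c)
  show ?case by (rule ded.mp[OF ded.mp[OF ax_S mp.IH(1)] mp.IH(2)])
qed

lemma ded_imp: "ded \<Gamma> (Imp b a) \<longleftrightarrow> ded (insert b \<Gamma>) a"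
  using deduction ded.mp[OF ded_weaken ded.hyp[OF insertI1]] by blast

lemma ded_empty: "ded {} a \<longleftrightarrow> pr a"
proof
  show "ded {} a \<Longrightarrow> pr a"
    by (induction rule: ded.induct) (auto intro: pr.mp)
qed (rule ded.th)

lemma pr_imp: "pr (Imp a b) \<longleftrightarrow> ded {a} b"
  using ded_imp ded_empty by metis

lemma ded_exfalso: "ded \<Gamma> (Neg a) \<Longrightarrow> ded \<Gamma> a \<Longrightarrow> ded \<Gamma> b"
  by (rule ded.mp[OF ded.mp[OF ax_N ded.mp[OF ax_K]]])

lemma pr_not_Bot: "pr (All 0 (Eq (Var 0) (Var 0)))"
  by (intro pr.gen pr.log logical_axiom.intros)

text \<open>\<open>Bot\<close> is the negation of a theorem, so after the deduction theorem the
  contraposition axiom turns \<open>Imp (Neg a) Bot\<close> into an implication from that theorem to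
  \<open>a\<close>.\<close>

lemma ded_ccontr: "ded (insert (Neg a) \<Gamma>) Bot \<Longrightarrow> ded \<Gamma> a"
  unfolding Bot_def by (rule ded.mp[OF ded.mp[OF ax_N deduction] ded.th[OF pr_not_Bot]])

text \<open>Contraposition is the only axiom on negation and yields unnegated conclusions. Hence
  \<open>Neg (Neg a)\<close> is refuted instead: it yields \<open>a\<close>, and with it
  \<open>Bot\<close>.\<close>

lemma ded_negI: "ded (insert a \<Gamma>) Bot \<Longrightarrow> ded \<Gamma> (Neg a)"
proof -
  assume a: "ded (insert a \<Gamma>) Bot"
  have "ded (insert (Neg (Neg a)) \<Gamma>) a"
    by (rule ded_ccontr, rule ded_exfalso[of _ "Neg a"]) (auto intro: ded.hyp)
  moreover have "ded (insert (Neg (Neg a)) \<Gamma>) (Imp a Bot)"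
    by (rule ded_weaken[OF deduction[OF a]])
  ultimately show ?thesis by (rule ded_ccontr[OF ded.mp[rotated]])
qed

text \<open>Each hypothesis is discharged, the implication is generalized, and the axiom that moves
  a quantifier past an antecedent without \<open>x\<close> brings the hypothesis back. The induction
  on the hypotheses needs their finiteness.\<close>

lemma ded_gen:
  assumes "finite \<Gamma>" "ded \<Gamma> a" "\<And>b. b \<in> \<Gamma> \<Longrightarrow> x \<notin> fv b"
  shows "ded \<Gamma> (All x a)"
  using assms
proof (induction \<Gamma> arbitrary: a rule: finite_induct)
  case empty
  then show ?case using ded_empty pr.gen by metis
next
  case (insert b \<Gamma>)
  then have "ded \<Gamma> (All x (Imp b a))" by (metis deduction insertI2)
  moreover have "ded \<Gamma> (Imp (All x (Imp b a)) (Imp b (All x a)))"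
    by (intro ded.th pr.log logical_axiom.intros) (use insert.prems in auto)
  ultimately show ?case unfolding ded_imp[symmetric] by (rule ded.mp[rotated])
qed

lemma ded_inst: "ded \<Gamma> (All x a) \<Longrightarrow> free_for u x a \<Longrightarrow> ded \<Gamma> (subst x u a)"
  by (rule ded.mp[OF ded.th[OF pr.log[OF logical_axiom.intros(4)]]])

lemma pr_All_mono: "pr (Imp a b) \<Longrightarrow> pr (Imp (All x a) (All x b))"
proof -
  assume ab: "pr (Imp a b)"
  have "ded {All x a} a"
    using ded_inst[of "{All x a}" x a "Var x"] free_for_self by (simp add: ded.hyp)
  then have "ded {All x a} b" by (rule ded.mp[OF ded.th[OF ab]])
  then show ?thesis unfolding pr_imp by (rule ded_gen[rotated]) auto
qed

lemma pr_Neg_mono: "pr (Imp a b) \<Longrightarrow> pr (Imp (Neg b) (Neg a))"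
proof -
  assume ab: "pr (Imp a b)"
  have "ded {a, Neg b} a" "ded {a, Neg b} (Neg b)" by (auto intro: ded.hyp)
  then have "ded {a, Neg b} Bot"
    using ded.mp[OF ded.th[OF ab]] ded_exfalso by blast
  then show ?thesis unfolding pr_imp by (rule ded_negI)
qed

lemma pr_Imp_mono: "pr (Imp a' a) \<Longrightarrow> pr (Imp b b') \<Longrightarrow> pr (Imp (Imp a b) (Imp a' b'))"
proof -
  assume *: "pr (Imp a' a)" "pr (Imp b b')"
  have "ded {a', Imp a b} a'" "ded {a', Imp a b} (Imp a b)" by (auto intro: ded.hyp)
  then have "ded {a', Imp a b} b'"
    using ded.mp[OF ded.th[OF *(1)]] ded.mp[OF ded.th[OF *(2)]] ded.mp[of _ a b] by blast
  then show ?thesis unfolding pr_imp by (rule deduction)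
qed

lemma pr_trans: "pr (Imp a b) \<Longrightarrow> pr (Imp b c) \<Longrightarrow> pr (Imp a c)"
  unfolding pr_imp[of a] using ded.mp[OF ded.th] by blast

lemma pr_alpha:
  assumes "y \<notin> vars a" "x \<noteq> y"
  shows "pr (Imp (All x a) (All y (subst x (Var y) a)))"
    and "pr (Imp (All y (subst x (Var y) a)) (All x a))"
proof -
  have "ded {All x a} (subst x (Var y) a)"
    by (intro ded_inst ded.hyp free_for_fresh assms) simp
  then show "pr (Imp (All x a) (All y (subst x (Var y) a)))"
    unfolding pr_imp by (rule ded_gen[rotated]) (use assms fv_subset_vars in auto)
  let ?b = "subst x (Var y) a"
  have "ded {All y ?b} (subst y (Var x) ?b)"
    by (intro ded_inst ded.hyp free_for_subst_fresh assms) simp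
  then have "ded {All y ?b} a" using subst_subst_fresh assms by simp
  then show "pr (Imp (All y ?b) (All x a))"
    unfolding pr_imp by (rule ded_gen[rotated]) (use assms not_fv_subst in auto)
qed

text \<open>The instantiation axiom demands that the term be free for the variable, whereas the
  quantifier case of the truth lemma instantiates with every term. A variant with other bound
  variables, equivalent both in the calculus and in all structures, removes the obstacle; its height
  is kept so that the induction of the truth lemma still applies.\<close>

lemma rename_bound:
  "\<exists>a'. v \<notin> bv a' \<and> height a' = height a \<and> pr (Imp a a') \<and> pr (Imp a' a) \<and>
     (\<forall>(Q :: 'a \<Rightarrow> 'a \<Rightarrow> bool) E c e. ev Q E c e a' = ev Q E c e a)"
proof (induction "height a" arbitrary: a rule: less_induct)
  case less
  have refl: "pr (Imp b b)" for b unfolding pr_imp by (auto intro: ded.hyp)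
  show ?case
  proof (cases a)
    case (Neg b)
    then obtain b' where "v \<notin> bv b'" "height b' = height b" "pr (Imp b b')" "pr (Imp b' b)"
      "\<forall>(Q :: 'a \<Rightarrow> 'a \<Rightarrow> bool) E c e. ev Q E c e b' = ev Q E c e b"
      using less[of b] by auto
    then show ?thesis using Neg pr_Neg_mono by (intro exI[of _ "Neg b'"]) auto
  next
    case (Imp b d)
    then obtain b' where "v \<notin> bv b'" "height b' = height b" "pr (Imp b b')" "pr (Imp b' b)"
      "\<forall>(Q :: 'a \<Rightarrow> 'a \<Rightarrow> bool) E c e. ev Q E c e b' = ev Q E c e b"
      using less[of b] by auto
    moreover obtain d' where "v \<notin> bv d'" "height d' = height d" "pr (Imp d d')" "pr (Imp d' d)"
      "\<forall>(Q :: 'a \<Rightarrow> 'a \<Rightarrow> bool) E c e. ev Q E c e d' = ev Q E c e d"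
      using less[of d] Imp by auto
    ultimately show ?thesis using Imp pr_Imp_mono by (intro exI[of _ "Imp b' d'"]) auto
  next
    case (All y b)
    \<comment> \<open>Fresh for \<open>b\<close>, so that renaming is sound, and distinct from
      \<open>v\<close>, so that the new quantifier does not bind \<open>v\<close>.\<close>
    obtain w where w: "w \<notin> vars b \<union> {v, y}" using ex_fresh[of "vars b \<union> {v, y}"] by auto
    define b1 where "b1 = subst y (Var w) b"
    have b1: "pr (Imp a (All w b1))" "pr (Imp (All w b1) a)"
      using pr_alpha[of w b y] w All b1_def by auto
    obtain b' where b': "v \<notin> bv b'" "height b' = height b1" "pr (Imp b1 b')" "pr (Imp b' b1)"
      "\<forall>(Q :: 'a \<Rightarrow> 'a \<Rightarrow> bool) E c e. ev Q E c e b' = ev Q E c e b1"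
      using less[of b1] b1_def All by auto
    have "\<forall>(Q :: 'a \<Rightarrow> 'a \<Rightarrow> bool) E c e. ev Q E c e (All w b') = ev Q E c e a"
      using b'(5) ev_alpha[of w b] w All b1_def by (metis UnI1 ev.simps(5))
    moreover have "pr (Imp a (All w b'))" "pr (Imp (All w b') a)"
      using b' b1 pr_All_mono pr_trans by blast+
    ultimately show ?thesis using w b' All b1_def by (intro exI[of _ "All w b'"]) auto
  qed (use refl in \<open>auto intro!: exI[of _ a]\<close>)
qed

lemma rename_free_for:
  "\<exists>a'. free_for u x a' \<and> height a' = height a \<and> pr (Imp a a') \<and>
     (\<forall>(Q :: 'a \<Rightarrow> 'a \<Rightarrow> bool) E c e. ev Q E c e a' = ev Q E c e a)"
proof (cases u)
  case (Var v)
  then show ?thesis using rename_bound[of v a] free_for_bv by metis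
next
  case Ct
  have "pr (Imp a a)" unfolding pr_imp by (auto intro: ded.hyp)
  then show ?thesis using Ct free_for_Ct by blast
qed


section \<open>Completeness\<close>

instance tm :: countable by countable_datatype
instance fm :: countable by countable_datatype

abbreviation cons :: "fm set \<Rightarrow> bool" where "cons \<Gamma> \<equiv> \<not> ded \<Gamma> Bot"

text \<open>Only finitely many formulas are added before each stage, so that a variable that does not occur
  in them can serve as a witness, and no new constants are needed.\<close>

definition witness :: "fm set \<Rightarrow> fm \<Rightarrow> fm set" where
  "witness \<Gamma> a = (case a of Neg (All x b) \<Rightarrow>
     {Neg (subst x (Var (SOME y. y \<notin> \<Union> (vars ` insert a \<Gamma>))) b)} | _ \<Rightarrow> {})"

primrec stage :: "fm \<Rightarrow> nat \<Rightarrow> fm set" where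
  "stage a 0 = {a}"
| "stage a (Suc n) = (let \<Gamma> = stage a n; b = from_nat n in
     if cons (insert b \<Gamma>) then insert b \<Gamma> \<union> witness \<Gamma> b else \<Gamma>)"

lemma finite_witness: "finite (witness \<Gamma> a)"
  by (auto simp: witness_def split: fm.splits)

lemma finite_stage: "finite (stage a n)"
  by (induction n) (auto simp: Let_def finite_witness)

lemma witness_fresh:
  assumes "finite \<Gamma>" "a = Neg (All x b)"
  shows "\<exists>y. y \<notin> \<Union> (vars ` insert a \<Gamma>) \<and> witness \<Gamma> a = {Neg (subst x (Var y) b)}"
proof -
  let ?S = "\<Union> (vars ` insert a \<Gamma>)"
  have "finite ?S" using assms by auto
  then have "(SOME y. y \<notin> ?S) \<notin> ?S" using ex_fresh someI[of "\<lambda>y. y \<notin> ?S"] by blast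
  moreover have "witness \<Gamma> a = {Neg (subst x (Var (SOME y. y \<notin> ?S)) b)}"
    unfolding witness_def assms(2) by simp
  ultimately show ?thesis by blast
qed

text \<open>Were the witness inconsistent with the rest, its instance at the fresh variable
  \<open>y\<close> would be derivable. As \<open>y\<close> occurs in none of the finitely many
  hypotheses, it can be generalized and renamed back to \<open>x\<close>, against
  \<open>Neg (All x b)\<close>.\<close>

lemma cons_witness:
  assumes "finite \<Gamma>" "cons (insert a \<Gamma>)"
  shows "cons (insert a \<Gamma> \<union> witness \<Gamma> a)"
proof (cases "\<exists>x b. a = Neg (All x b)")
  case True
  then obtain x b where a: "a = Neg (All x b)" by blast
  from witness_fresh[OF assms(1) a] obtain y where
    y0: "y \<notin> \<Union> (vars ` insert a \<Gamma>) \<and> witness \<Gamma> a = {Neg (subst x (Var y) b)}" ..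
  then have y3: "witness \<Gamma> a = {Neg (subst x (Var y) b)}" ..
  from y0 have y1: "y \<notin> vars a" "\<And>c. c \<in> \<Gamma> \<Longrightarrow> y \<notin> vars c" by simp_all
  then have y: "y \<notin> vars b" "x \<noteq> y" unfolding a by simp_all
  show ?thesis
  proof
    assume "ded (insert a \<Gamma> \<union> witness \<Gamma> a) Bot"
    then have "ded (insert a \<Gamma>) (subst x (Var y) b)"
      unfolding y3 by (intro ded_ccontr[of "subst x (Var y) b"]) simp
    then have "ded (insert a \<Gamma>) (All y (subst x (Var y) b))"
      by (rule ded_gen[rotated]) (use assms y1 fv_subset_vars in auto)
    then have "ded (insert a \<Gamma>) (All x b)"
      using ded.mp[OF ded.th[OF pr_alpha(2)[OF y]]] by blast
    moreover have "ded (insert a \<Gamma>) (Neg (All x b))" using a by (auto intro: ded.hyp)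
    ultimately show False using assms(2) ded_exfalso by blast
  qed
next
  case False
  then have "witness \<Gamma> a = {}" by (auto simp: witness_def split: fm.splits)
  then show ?thesis using assms by simp
qed

lemma stage_mono: "m \<le> n \<Longrightarrow> stage a m \<subseteq> stage a n"
proof (induction n)
  case (Suc n)
  then show ?case by (cases "m = Suc n") (auto simp: Let_def)
qed simp

lemma cons_stage: "cons {a} \<Longrightarrow> cons (stage a n)"
proof (induction n)
  case (Suc n)
  then show ?case using cons_witness[OF finite_stage, of "from_nat n" a n] by (simp add: Let_def)
qed simp

definition henkin :: "fm \<Rightarrow> fm set" where "henkin a = (\<Union>n. stage a n)"

context
  fixes a0 :: fm and \<Delta> :: "fm set"
  assumes cons0: "cons {a0}" and \<Delta>: "\<Delta> = henkin a0"
begin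

lemma start_in_henkin: "a0 \<in> \<Delta>"
  unfolding \<Delta> henkin_def by (auto intro: exI[of _ 0])

lemma stage_subset_henkin: "stage a0 n \<subseteq> \<Delta>"
  unfolding \<Delta> henkin_def by (rule UN_upper) simp

lemma cons_henkin: "cons \<Delta>"
proof
  assume "ded \<Delta> Bot"
  then obtain G where G: "finite G" "G \<subseteq> \<Delta>" "ded G Bot" using ded_compact by blast
  have "\<exists>n. G \<subseteq> stage a0 n" using G(1,2)
  proof (induction rule: finite_induct)
    case (insert b G)
    then obtain m n where "b \<in> stage a0 m" "G \<subseteq> stage a0 n"
      by (auto simp: \<Delta> henkin_def)
    then have "insert b G \<subseteq> stage a0 (max m n)"
      using stage_mono[of m "max m n" a0] stage_mono[of n "max m n" a0] by auto
    then show ?case by blast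
  qed simp
  then show False using cons_stage[OF cons0] ded_mono[OF G(3)] by blast
qed

text \<open>The formula is either accepted at the stage \<open>to_nat a\<close> that treats it, or
  already refuted by the formulas present there.\<close>

lemma henkin_dichotomy: "a \<in> \<Delta> \<or> ded \<Delta> (Neg a)"
proof (cases "ded (insert a (stage a0 (to_nat a))) Bot")
  case False
  then have "a \<in> stage a0 (Suc (to_nat a))"
    unfolding stage.simps Let_def from_nat_to_nat by (rule if_P[THEN ssubst]) simp
  then have "a \<in> \<Delta>" using stage_subset_henkin by (rule subsetD[rotated])
  then show ?thesis ..
next
  case True
  from ded_mono[OF ded_negI[OF True] stage_subset_henkin] show ?thesis ..
qed

lemma ded_henkin: "ded \<Delta> a \<longleftrightarrow> a \<in> \<Delta>"
proof
  assume a: "ded \<Delta> a"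
  show "a \<in> \<Delta>"
  proof (rule ccontr)
    assume "a \<notin> \<Delta>"
    then have "ded \<Delta> (Neg a)" using henkin_dichotomy[of a] by simp
    then show False using ded_exfalso[OF _ a] cons_henkin by simp
  qed
qed (rule ded.hyp)

lemma henkin_Neg: "Neg a \<in> \<Delta> \<longleftrightarrow> a \<notin> \<Delta>"
proof
  show "Neg a \<in> \<Delta> \<Longrightarrow> a \<notin> \<Delta>"
    using ded_exfalso[OF ded.hyp ded.hyp, of a \<Delta> Bot] cons_henkin by auto
  show "a \<notin> \<Delta> \<Longrightarrow> Neg a \<in> \<Delta>"
    using henkin_dichotomy[of a] ded_henkin[of "Neg a"] by simp
qed

lemma henkin_Imp: "Imp a b \<in> \<Delta> \<longleftrightarrow> (a \<in> \<Delta> \<longrightarrow> b \<in> \<Delta>)"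
proof -
  have "Imp a b \<in> \<Delta>" if "b \<in> \<Delta>"
    using that ded.mp[OF ax_K, of \<Delta> b a] ded_henkin by simp
  moreover have "Imp a b \<in> \<Delta>" if "a \<notin> \<Delta>"
  proof -
    have "ded (insert a \<Delta>) b"
      by (rule ded_exfalso[of _ a]; rule ded.hyp) (simp_all add: that henkin_Neg)
    then have "ded \<Delta> (Imp a b)" by (rule deduction)
    then show ?thesis using ded_henkin by simp
  qed
  moreover have "b \<in> \<Delta>" if "Imp a b \<in> \<Delta>" "a \<in> \<Delta>"
    using that ded.mp[of \<Delta> a b] ded_henkin by simp
  ultimately show ?thesis by blast
qed

lemma pr_henkin: "pr a \<Longrightarrow> a \<in> \<Delta>"
  using ded.th ded_henkin by blast

text \<open>When the enumeration reaches the negated universal formula, it is consistent with the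
  current stage, both being contained in the consistent set \<open>\<Delta>\<close>; so its witness
  was added together with it.\<close>

lemma henkin_witness:
  assumes "Neg (All x b) \<in> \<Delta>"
  shows "\<exists>y. y \<notin> vars b \<and> Neg (subst x (Var y) b) \<in> \<Delta>"
proof -
  let ?a = "Neg (All x b)"
  let ?G = "stage a0 (to_nat ?a)"
  have "insert ?a ?G \<subseteq> \<Delta>" using assms stage_subset_henkin by simp
  then have c: "cons (insert ?a ?G)" by (rule contrapos_nn[OF cons_henkin ded_mono, rotated])
  from witness_fresh[OF finite_stage refl] obtain y where
    y0: "y \<notin> \<Union> (vars ` insert ?a ?G) \<and> witness ?G ?a = {Neg (subst x (Var y) b)}" ..
  then have y: "y \<notin> vars ?a" "witness ?G ?a = {Neg (subst x (Var y) b)}" by simp_all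
  have "Neg (subst x (Var y) b) \<in> stage a0 (Suc (to_nat ?a))"
    unfolding stage.simps Let_def from_nat_to_nat y(2) by (rule if_P[OF c, THEN ssubst]) simp
  then have "Neg (subst x (Var y) b) \<in> \<Delta>" using stage_subset_henkin by (rule subsetD[rotated])
  then show ?thesis using y(1) by auto
qed

lemma val_Var [simp]: "val Ct Var u = u"
  by (cases u) auto

text \<open>The domain consists of all terms, each denoting itself. For a universal formula in
  \<open>\<Delta>\<close>, the instance at an arbitrary \<open>u\<close> is formed in a renamed
  variant of the body; for one outside, the witness variable gives a counterexample.\<close>

lemma truth: "ev (\<lambda>s t. Eq s t \<in> \<Delta>) (\<lambda>s t. Mem s t \<in> \<Delta>) Ct Var a \<longleftrightarrow> a \<in> \<Delta>"
proof (induction "height a" arbitrary: a rule: less_induct)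
  case less
  let ?ev = "ev (\<lambda>s t. Eq s t \<in> \<Delta>) (\<lambda>s t. Mem s t \<in> \<Delta>) Ct"
  show ?case
  proof (cases a)
    case (All x b)
    have "?ev (Var(x := u)) b" if ab: "All x b \<in> \<Delta>" for u
    proof -
      obtain b' where b': "free_for u x b'" "height b' = height b" "pr (Imp b b')"
        "\<forall>(Q :: tm \<Rightarrow> tm \<Rightarrow> bool) E c e. ev Q E c e b' = ev Q E c e b"
        using rename_free_for[of u x b] by (elim exE conjE)
      have "subst x u b' \<in> \<Delta>"
        using ded_inst[OF ded.mp[OF ded.th[OF pr_All_mono[OF b'(3)]] ded.hyp[OF ab]] b'(1)]
        unfolding ded_henkin .
      then have "?ev Var (subst x u b')" using less[of "subst x u b'"] b'(2) All by simp
      then show ?thesis unfolding ev_subst[OF b'(1)] using b'(4) by simp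
    qed
    moreover have "\<exists>u. \<not> ?ev (Var(x := u)) b" if nb: "All x b \<notin> \<Delta>"
    proof -
      obtain y where y: "y \<notin> vars b" "Neg (subst x (Var y) b) \<in> \<Delta>"
        using henkin_witness[OF nb[folded henkin_Neg]] by (elim exE conjE)
      then have "\<not> ?ev Var (subst x (Var y) b)"
        using less[of "subst x (Var y) b"] All henkin_Neg by simp
      then show ?thesis unfolding ev_subst[OF free_for_fresh[OF y(1)]] by auto
    qed
    ultimately show ?thesis unfolding All ev.simps by blast
  next
    case (Neg b)
    then show ?thesis using less[of b] henkin_Neg by simp
  next
    case (Imp b d)
    then show ?thesis using less[of b] less[of d] henkin_Imp by simp
  qed auto
qed

end

lemma pr_foldr_All: "pr a \<Longrightarrow> pr (foldr All xs a)"
  by (induction xs) (auto intro: pr.gen)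

lemma ev_foldr_All:
  "ev Q E c e (foldr All xs a) \<Longrightarrow> (\<And>x. x \<notin> set xs \<Longrightarrow> e' x = e x) \<Longrightarrow> ev Q E c e' a"
proof (induction xs arbitrary: e)
  case Nil
  then have "e' = e" by auto
  then show ?case using Nil by simp
next
  case (Cons x xs)
  have "ev Q E c (e(x := e' x)) (foldr All xs a)" using Cons.prems(1) by simp
  then show ?case by (rule Cons.IH) (use Cons.prems(2) in auto)
qed

text \<open>The truth lemma covers only the assignment \<open>Var\<close>. A theorem holds under
  every assignment because its universal closure is again a theorem.\<close>

theorem term_model:
  assumes "cons {a0}"
  shows "\<exists>(Q :: tm \<Rightarrow> tm \<Rightarrow> bool) E. (\<forall>a e. pr a \<longrightarrow> ev Q E Ct e a) \<and> ev Q E Ct Var a0"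
proof -
  let ?D = "henkin a0"
  let ?ev = "ev (\<lambda>s t. Eq s t \<in> ?D) (\<lambda>s t. Mem s t \<in> ?D) Ct"
  note truth' = truth[OF assms refl]
  have "?ev e a" if "pr a" for a e
  proof -
    define xs where "xs = sorted_list_of_set (fv a)"
    have "?ev Var (foldr All xs a)"
      using truth' pr_henkin[OF assms refl] pr_foldr_All[OF that] by simp
    then have "?ev (\<lambda>x. if x \<in> fv a then e x else Var x) a"
      by (rule ev_foldr_All) (simp add: xs_def)
    moreover have "?ev (\<lambda>x. if x \<in> fv a then e x else Var x) a = ?ev e a"
      by (rule ev_cong) simp
    ultimately show ?thesis by simp
  qed
  moreover have "?ev Var a0" using truth' start_in_henkin[OF assms refl] by simp
  ultimately show ?thesis by (intro exI conjI allI impI)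
qed

lemma ev_connectives [simp]:
  "ev Q E c e (And a b) \<longleftrightarrow> ev Q E c e a \<and> ev Q E c e b"
  "ev Q E c e (Or a b) \<longleftrightarrow> ev Q E c e a \<or> ev Q E c e b"
  "ev Q E c e (Iff a b) \<longleftrightarrow> (ev Q E c e a \<longleftrightarrow> ev Q E c e b)"
  "ev Q E c e (Ex x a) \<longleftrightarrow> (\<exists>d. ev Q E c (e(x := d)) a)"
  by (auto simp: And_def Or_def Iff_def Ex_def)

section \<open>From the term model to a model on \<open>nat\<close> with genuine equality\<close>

context
  fixes Q E :: "'a \<Rightarrow> 'a \<Rightarrow> bool" and c :: 'a
  assumes model: "\<forall>a e. pr a \<longrightarrow> ev Q E c e a"
begin

lemma pr_sound: "pr a \<Longrightarrow> ev Q E c e a"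
  using model by simp

lemma Q_refl: "Q x x"
  using pr_sound[of "Eq (Var 0) (Var 0)" "\<lambda>_. x"] by (simp add: pr.log logical_axiom.intros)

lemma Q_euclid: "Q x y \<Longrightarrow> Q x z \<Longrightarrow> Q y z"
  using pr_sound[of "Imp (Eq (Var 0) (Var 1)) (Imp (Eq (Var 0) (Var 2)) (Eq (Var 1) (Var 2)))"
      "(\<lambda>_. x)(1 := y, 2 := z)"]
  by (simp add: pr.log logical_axiom.intros)

lemma Q_sym: "Q x y \<Longrightarrow> Q y x"
  using Q_euclid Q_refl by blast

lemma E_cong1: "Q x y \<Longrightarrow> E x z \<Longrightarrow> E y z"
  using pr_sound[of "Imp (Eq (Var 0) (Var 1)) (Imp (Mem (Var 0) (Var 2)) (Mem (Var 1) (Var 2)))"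
      "(\<lambda>_. x)(1 := y, 2 := z)"]
  by (simp add: pr.log logical_axiom.intros)

lemma E_cong2: "Q x y \<Longrightarrow> E z x \<Longrightarrow> E z y"
  using pr_sound[of "Imp (Eq (Var 0) (Var 1)) (Imp (Mem (Var 2) (Var 0)) (Mem (Var 2) (Var 1)))"
      "(\<lambda>_. x)(1 := y, 2 := z)"]
  by (simp add: pr.log logical_axiom.intros)

lemma ex_upair: "\<exists>z. \<forall>w. E w z \<longleftrightarrow> Q w x \<or> Q w y"
proof -
  let ?a = "all2 [] (\<lambda>x y. ex [x, y] (\<lambda>z. upair_fm x y z))"
  have "zfc_axiom ?a" by (rule zfc_axiom.single) (simp add: zfc_single_def)
  then have "ev Q E c (\<lambda>_. c) ?a" by (intro pr_sound pr.zfc)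
  then show ?thesis by (simp add: all2_def all_def ex_def upair_fm_def fresh_def)
qed

lemma ex_Union: "\<exists>y. \<forall>z. E z y \<longleftrightarrow> (\<exists>w. E z w \<and> E w x)"
proof -
  let ?a = "all [] (\<lambda>x. ex [x] (\<lambda>y. all [x, y] (\<lambda>z.
      Iff (Mem z y) (ex [x, y, z] (\<lambda>w. And (Mem z w) (Mem w x))))))"
  have "zfc_axiom ?a" by (rule zfc_axiom.single) (simp add: zfc_single_def)
  then have "ev Q E c (\<lambda>_. c) ?a" by (intro pr_sound pr.zfc)
  then show ?thesis by (simp add: all_def ex_def fresh_def)
qed

text \<open>Russell's set, separated from a universal set \<open>u\<close>.\<close>

lemma no_universal_set: "\<not> (\<forall>x. E x u)"
proof
  assume u: "\<forall>x. E x u"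
  let ?a = "Ex 1 (All 0 (Iff (Mem (Var 0) (Var 1))
    (And (Mem (Var 0) (Var 2)) (Neg (Mem (Var 0) (Var 0))))))"
  have "zfc_axiom ?a" by (rule zfc_axiom.separation) auto
  then have "ev Q E c (\<lambda>_. u) ?a" by (intro pr_sound pr.zfc)
  then show False using u by auto
qed

text \<open>With finitely many classes, adjoining one representative after another by pairing and
  union would give a set that contains a member of each class, hence by congruence
  everything.\<close>

lemma infinite_classes: "infinite (UNIV // {(x, y). Q x y})"
proof
  let ?r = "{(x, y). Q x y}"
  assume fin: "finite (UNIV // ?r)"
  have bound: "\<exists>u. \<forall>x \<in> F. E x u" if "finite F" for F
    using that
  proof (induction rule: finite_induct)
    case (insert a F)
    then obtain u where u: "\<forall>x \<in> F. E x u" by blast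
    from ex_upair[of a a] obtain s where s: "\<forall>w. E w s \<longleftrightarrow> Q w a \<or> Q w a" ..
    from ex_upair[of s u] obtain p where p: "\<forall>w. E w p \<longleftrightarrow> Q w s \<or> Q w u" ..
    from ex_Union[of p] obtain v where v: "\<forall>z. E z v \<longleftrightarrow> (\<exists>w. E z w \<and> E w p)" ..
    have "E s p" "E u p" "E a s" using s p Q_refl by simp_all
    then have "\<forall>x \<in> insert a F. E x v" using u v by auto
    then show ?case by blast
  qed simp
  obtain u where u: "\<forall>x \<in> (\<lambda>C. SOME x. x \<in> C) ` (UNIV // ?r). E x u"
    using bound[of "(\<lambda>C. SOME x. x \<in> C) ` (UNIV // ?r)"] fin by auto
  have "E x u" for x
  proof -
    have "Q x (SOME y. y \<in> ?r `` {x})" using Q_refl someI[of "\<lambda>y. y \<in> ?r `` {x}" x] by simp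
    moreover have "E (SOME y. y \<in> ?r `` {x}) u" using u by (auto simp: quotient_def)
    ultimately show ?thesis by (rule E_cong1[OF Q_sym])
  qed
  then show False using no_universal_set by blast
qed

end

lemma ev_quotient:
  assumes "surj h" "\<And>x y. h x = h y \<longleftrightarrow> Q x y" "\<And>x y. E' (h x) (h y) \<longleftrightarrow> E x y"
  shows "ev Q E c e a \<longleftrightarrow> ev (=) E' (h c) (h \<circ> e) a"
proof -
  have val: "val (h c) (\<lambda>x. h (e x)) u = h (val c e u)" for u e by (cases u) auto
  show ?thesis
  proof (induction a arbitrary: e)
    case (Eq s t)
    then show ?case using assms(2,3) val by simp
  next
    case (Mem s t)
    then show ?case using assms(2,3) val by simp
  next
    case (All x a)
    have "ev Q E c e (All x a) \<longleftrightarrow> (\<forall>d. ev (=) E' (h c) ((h \<circ> e)(x := h d)) a)"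
      using All by (simp add: fun_upd_def comp_def if_distrib)
    also have "\<dots> \<longleftrightarrow> (\<forall>d. ev (=) E' (h c) ((h \<circ> e)(x := d)) a)"
      using assms(1) by (metis surjD)
    finally show ?case by (simp add: comp_def)
  qed auto
qed

theorem completeness:
  assumes "\<And>(E :: nat \<Rightarrow> nat \<Rightarrow> bool) c e.
    (\<And>a e. zfc_axiom a \<Longrightarrow> ev (=) E c e a) \<Longrightarrow> ev (=) E c e \<phi>"
  shows "pr \<phi>"
proof (rule ccontr)
  assume "\<not> pr \<phi>"
  then have "cons {Neg \<phi>}" using ded_ccontr[of \<phi> "{}"] unfolding ded_empty by auto
  from term_model[OF this] obtain Q E :: "tm \<Rightarrow> tm \<Rightarrow> bool"
    where model: "\<forall>a e. pr a \<longrightarrow> ev Q E Ct e a" and "ev Q E Ct Var (Neg \<phi>)" by (elim exE conjE)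
  then have not_\<phi>: "\<not> ev Q E Ct Var \<phi>" by simp
  note Q = Q_refl[OF model] Q_sym[OF model] Q_euclid[OF model]
  define r where "r = {(x, y). Q x y}"
  have r: "(x, y) \<in> r \<longleftrightarrow> Q x y" for x y by (simp add: r_def)
  have eqv: "equiv UNIV r"
  proof (rule equivI)
    show "refl r" using Q(1) by (simp add: refl_on_def r)
    show "sym r" using Q(2) by (simp add: sym_def r)
    show "trans r" using Q(3)[OF Q(2)] by (simp add: trans_def r)
  qed simp
  define h where "h x = to_nat_on (UNIV // r) (r `` {x})" for x
  have q: "r `` {x} \<in> UNIV // r" for x by (rule quotientI) simp
  have cnt: "countable (UNIV // r)" unfolding quotient_def by (rule countable_UN) auto
  have bij: "bij_betw (to_nat_on (UNIV // r)) (UNIV // r) UNIV"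
    using to_nat_on_infinite[OF cnt] infinite_classes[OF model] unfolding r_def by simp
  have "surj h"
    unfolding surj_def
  proof
    fix n
    have "n \<in> to_nat_on (UNIV // r) ` (UNIV // r)" using bij_betw_imp_surj_on[OF bij] by simp
    then obtain C where C: "C \<in> UNIV // r" "n = to_nat_on (UNIV // r) C" by (elim imageE)
    from C(1) obtain x where "C = r `` {x}" by (rule quotientE)
    then show "\<exists>x. n = h x" using C(2) by (intro exI[of _ x]) (simp add: h_def)
  qed
  moreover have h: "h x = h y \<longleftrightarrow> Q x y" for x y
    unfolding h_def inj_on_eq_iff[OF bij_betw_imp_inj_on[OF bij] q q]
    using eq_equiv_class_iff[OF eqv] r by simp
  moreover define E' where "E' m n = E (inv h m) (inv h n)" for m n
  have "E' (h x) (h y) \<longleftrightarrow> E x y" for x y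
  proof -
    \<comment> \<open>\<open>inv h\<close> may pick another representative than \<open>z\<close>,
      but an equivalent one, and \<open>E\<close> respects equivalence in both arguments.\<close>
    have "Q (inv h (h z)) z" for z using h[of "inv h (h z)" z] by (simp add: f_inv_into_f)
    then show ?thesis unfolding E'_def
      using E_cong1[OF model, of "inv h (h x)" x] E_cong1[OF model, of x "inv h (h x)"]
        E_cong2[OF model, of "inv h (h y)" y] E_cong2[OF model, of y "inv h (h y)"] Q(2) by blast
  qed
  ultimately have ev: "ev Q E Ct e a \<longleftrightarrow> ev (=) E' (h Ct) (h \<circ> e) a" for e a
    by (intro ev_quotient) auto
  have "ev (=) E' (h Ct) e a" if "zfc_axiom a" for a e
  proof -
    have "h \<circ> (inv h \<circ> e) = e" using \<open>surj h\<close> by (auto simp: surj_f_inv_f)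
    then show ?thesis using ev[of "inv h \<circ> e" a] model pr.zfc[OF that] by simp
  qed
  then have "ev (=) E' (h Ct) (h \<circ> Var) \<phi>" by (rule assms)
  then show False using not_\<phi> ev by simp
qed


section \<open>Eliminating the constant\<close>

primrec rent :: "nat \<Rightarrow> tm \<Rightarrow> tm" where
  "rent z (Var n) = Var n"
| "rent z Ct = Var z"

primrec ren :: "nat \<Rightarrow> fm \<Rightarrow> fm" where
  "ren z (Eq s t) = Eq (rent z s) (rent z t)"
| "ren z (Mem s t) = Mem (rent z s) (rent z t)"
| "ren z (Neg a) = Neg (ren z a)"
| "ren z (Imp a b) = Imp (ren z a) (ren z b)"
| "ren z (All x a) = All x (ren z a)"

lemma rent_neq_Ct [simp]: "rent z s \<noteq> Ct" "Ct \<noteq> rent z s"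
  by (cases s; simp)+

lemma t_free_ren: "t_free (ren z a)"
  by (induction a) auto

lemma ren_t_free: "t_free a \<Longrightarrow> ren z a = a"
proof -
  have "s \<noteq> Ct \<Longrightarrow> rent z s = s" for s by (cases s) auto
  then show "t_free a \<Longrightarrow> ren z a = a" by (induction a) auto
qed

lemma bv_ren [simp]: "bv (ren z a) = bv a"
  by (induction a) auto

lemma bv_subset_vars: "bv a \<subseteq> vars a"
  by (induction a) auto

lemma rent_eq_Var: "Var x = rent z s \<longleftrightarrow> s = Var x \<or> (s = Ct \<and> x = z)"
  by (cases s) auto

lemma fv_ren: "fv (ren z a) \<subseteq> insert z (fv a)"
  by (induction a) (auto simp: rent_eq_Var)

lemma ev_ren: "z \<notin> bv a \<Longrightarrow> ev Q E c e (ren z a) = ev Q E (e z) e a"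
proof (induction a arbitrary: e)
  case (Eq s t)
  have "val c e (rent z u) = val (e z) e u" for u by (cases u) auto
  then show ?case by simp
next
  case (Mem s t)
  have "val c e (rent z u) = val (e z) e u" for u by (cases u) auto
  then show ?case by simp
qed auto

lemma ren_subst: "x \<noteq> z \<Longrightarrow> ren z (subst x u a) = subst x (rent z u) (ren z a)"
proof -
  assume "x \<noteq> z"
  then have "rent z (substt x u s) = substt x (rent z u) (rent z s)" for s
    by (cases s) (auto simp: substt_def)
  then show ?thesis by (induction a) auto
qed

lemma free_for_ren:
  assumes "free_for u x a" "z \<notin> bv a" "x \<noteq> z"
  shows "free_for (rent z u) x (ren z a)"
proof (cases u)
  case (Var v)
  show ?thesis using assms(1,2) unfolding Var
  proof (induction a)
    case (All y a)
    then show ?case using fv_ren[of z a] assms(3) by auto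
  qed auto
next
  case Ct
  then show ?thesis using assms(2) by (simp add: free_for_bv)
qed

text \<open>The new variable differs from every variable of the axiom, so that replacing the
  constant causes no capture and commutes with the substitution of the instantiation axiom.\<close>

lemma logical_axiom_ren: "logical_axiom a \<Longrightarrow> z \<notin> vars a \<Longrightarrow> logical_axiom (ren z a)"
proof (induction rule: logical_axiom.induct)
  case (4 u x a)
  then have "x \<noteq> z" "z \<notin> bv a" using bv_subset_vars by auto
  then show ?case using 4 by (simp add: ren_subst logical_axiom.intros free_for_ren)
next
  case (5 x a b)
  then have "x \<notin> fv (ren z a)" using fv_ren[of z a] by auto
  then show ?case by (simp add: logical_axiom.intros)
qed (auto intro: logical_axiom.intros)

lemma t_free_connectives [simp]:
  "t_free (And a b) \<longleftrightarrow> t_free a \<and> t_free b"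
  "t_free (Or a b) \<longleftrightarrow> t_free a \<and> t_free b"
  "t_free (Iff a b) \<longleftrightarrow> t_free a \<and> t_free b"
  "t_free (Ex x a) \<longleftrightarrow> t_free a"
  "t_free Bot"
  "t_free (all ps F) \<longleftrightarrow> t_free (F (Var (fresh ps)))"
  "t_free (ex ps F) \<longleftrightarrow> t_free (F (Var (fresh ps)))"
  by (auto simp: And_def Or_def Iff_def Ex_def Bot_def all_def ex_def)

lemma t_free_zfc_single: "a \<in> set zfc_single \<Longrightarrow> t_free a"
  by (auto simp: zfc_single_def all2_def ex1_def upair_fm_def sub_fm_def inductive_fm_def
      empty_fm_def succ_fm_def)

lemma ren_connectives [simp]:
  "ren z (And a b) = And (ren z a) (ren z b)"
  "ren z (Iff a b) = Iff (ren z a) (ren z b)"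
  "ren z (Ex x a) = Ex x (ren z a)"
  by (auto simp: And_def Iff_def Ex_def)

lemma vars_connectives [simp]:
  "vars (And a b) = vars a \<union> vars b"
  "vars (Iff a b) = vars a \<union> vars b"
  "vars (Ex x a) = insert x (vars a)"
  by (auto simp: And_def Iff_def Ex_def)

text \<open>The single axioms do not mention the constant, and in an instance of a schema the new
  variable becomes one more parameter.\<close>

lemma zfc_axiom_ren: "zfc_axiom a \<Longrightarrow> z \<notin> vars a \<Longrightarrow> zfc_axiom (ren z a)"
proof (induction rule: zfc_axiom.induct)
  case (single a)
  then show ?case using t_free_zfc_single ren_t_free zfc_axiom.single by metis
next
  case (separation x y w a)
  then have "y \<notin> fv (ren z a)" using fv_ren[of z a] by auto
  then show ?case using separation by (simp add: zfc_axiom.separation)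
next
  case (replacement x y w u a)
  then have "u \<notin> fv (ren z a)" using fv_ren[of z a] by auto
  then show ?case using replacement by (simp add: zfc_axiom.replacement)
qed

text \<open>The table is found only after the model has been given with its own value
  \<open>c\<close> of the constant. A schema instance about the constant holds for the new value
  \<open>t\<close> because the instance with a variable in its place holds for all values of that
  variable.\<close>

lemma zfc_axiom_any_constant:
  assumes "\<And>a e. zfc_axiom a \<Longrightarrow> ev (=) E c e a" "zfc_axiom a"
  shows "ev (=) E t e a"
proof -
  obtain z where z: "z \<notin> vars a" using ex_fresh finite_vars by blast
  have "ev (=) E c (e(z := t)) (ren z a)" using assms zfc_axiom_ren z by blast
  then have "ev (=) E t (e(z := t)) a" using ev_ren z bv_subset_vars by (metis fun_upd_same in_mono)
  moreover have "ev (=) E t (e(z := t)) a = ev (=) E t e a"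
    by (rule ev_cong) (use z fv_subset_vars in auto)
  ultimately show ?thesis by simp
qed

section \<open>From the inductive calculus to proof sequences\<close>

abbreviation "ZFC \<equiv> ({} :: fm set, \<lambda>_ :: fm. False)"

lemma justifies_append1:
  "i < length \<pi> \<Longrightarrow> justifies ZFC \<pi> i J \<Longrightarrow> justifies ZFC (\<pi> @ \<sigma>) i J"
  by (cases J) (auto simp: nth_append)

lemma justifies_append2:
  assumes "i < length \<sigma>" "justifies ZFC \<sigma> i J"
  shows "\<exists>J. justifies ZFC (\<pi> @ \<sigma>) (length \<pi> + i) J"
proof (cases J)
  case (MP_J j k)
  then show ?thesis using assms
    by (intro exI[of _ "MP_J (length \<pi> + j) (length \<pi> + k)"]) (auto simp: nth_append)
next
  case (Gen_J j k)
  then show ?thesis using assms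
    by (intro exI[of _ "Gen_J (length \<pi> + j) k"]) (auto simp: nth_append)
qed (use assms in \<open>auto intro: exI[of _ Log_J] exI[of _ ZFC_J]\<close>)

lemma proves_append:
  assumes "proves ZFC \<pi> a" "proves ZFC \<sigma> b"
  shows "proves ZFC (\<pi> @ \<sigma>) b"
proof -
  have "\<exists>J. justifies ZFC (\<pi> @ \<sigma>) i J" if i: "i < length (\<pi> @ \<sigma>)" for i
  proof (cases "i < length \<pi>")
    case True
    then show ?thesis using assms(1) justifies_append1 unfolding proves_def by blast
  next
    case False
    then show ?thesis
      using assms(2) justifies_append2[of "i - length \<pi>" \<sigma> _ \<pi>] i unfolding proves_def by fastforce
  qed
  then show ?thesis using assms unfolding proves_def by auto
qed

lemma proves_snoc:
  assumes "\<forall>i < length \<pi>. \<exists>J. justifies ZFC \<pi> i J" "justifies ZFC (\<pi> @ [a]) (length \<pi>) J"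
  shows "proves ZFC (\<pi> @ [a]) a"
  unfolding proves_def using assms justifies_append1 by (auto simp: less_Suc_eq) blast

lemma in_set_nth: "a \<in> set \<pi> \<Longrightarrow> \<exists>i < length \<pi>. \<pi> ! i = a"
  by (simp add: in_set_conv_nth)

lemma pr_proves: "pr a \<Longrightarrow> \<exists>\<pi>. proves ZFC \<pi> a"
proof (induction rule: pr.induct)
  case (log a)
  then show ?case using proves_snoc[of "[]" a Log_J] by auto
next
  case (zfc a)
  then show ?case using proves_snoc[of "[]" a ZFC_J] by auto
next
  case (mp a b)
  then obtain \<pi> \<sigma> where ps: "proves ZFC \<pi> (Imp a b)" "proves ZFC \<sigma> a" by blast
  define \<rho> where "\<rho> = \<pi> @ \<sigma>"
  have "proves ZFC \<rho> a" unfolding \<rho>_def using proves_append ps by blast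
  moreover have "Imp a b \<in> set \<rho>" "a \<in> set \<rho>"
    using ps last_in_set[of \<pi>] last_in_set[of \<sigma>] unfolding proves_def \<rho>_def by auto
  then obtain j k where "j < length \<rho>" "k < length \<rho>" "\<rho> ! j = Imp a b" "\<rho> ! k = a"
    using in_set_nth by metis
  then have "justifies ZFC (\<rho> @ [b]) (length \<rho>) (MP_J j k)"
    by (simp add: nth_append)
  ultimately show ?case using proves_snoc unfolding proves_def by blast
next
  case (gen a x)
  then obtain \<pi> where p: "proves ZFC \<pi> a" by blast
  then obtain j where "j < length \<pi>" "\<pi> ! j = a"
    using in_set_nth unfolding proves_def by (metis last_in_set)
  then have "justifies ZFC (\<pi> @ [All x a]) (length \<pi>) (Gen_J j x)"
    by (simp add: nth_append)
  then show ?case using p proves_snoc unfolding proves_def by blast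
qed

lemma justifies_ren:
  assumes "justifies ZFC \<pi> i J" "i < length \<pi>" "\<And>b. b \<in> set \<pi> \<Longrightarrow> z \<notin> vars b"
  shows "justifies ZFC (map (ren z) \<pi>) i J"
  using assms by (cases J) (auto simp: logical_axiom_ren zfc_axiom_ren)

text \<open>One variable that is new for the whole finite sequence replaces the constant everywhere.
  All justifications survive, and the last formula, being free of the constant, does not
  change.\<close>

theorem pr_zfc_provable:
  assumes "pr a" "t_free a"
  shows "zfc_provable a"
proof -
  obtain \<pi> where \<pi>: "proves ZFC \<pi> a" using pr_proves assms(1) by blast
  obtain z where "z \<notin> \<Union> (vars ` set \<pi>)" using ex_fresh[of "\<Union> (vars ` set \<pi>)"] by auto
  then have z: "\<And>b. b \<in> set \<pi> \<Longrightarrow> z \<notin> vars b" by auto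
  have "\<exists>J. justifies ZFC (map (ren z) \<pi>) i J" if "i < length \<pi>" for i
    using justifies_ren[OF _ that z] \<pi> that unfolding proves_def by blast
  then have "proves ZFC (map (ren z) \<pi>) a"
    using \<pi> ren_t_free[OF assms(2)] unfolding proves_def by (auto simp: last_map)
  then show ?thesis unfolding zfc_provable_def
    by (intro exI[of _ "map (ren z) \<pi>"]) (auto simp: t_free_ren)
qed


section \<open>Definable sets in a model\<close>

declare fun_upd_apply [simp del] fun_upd_same [simp]

lemma idx_le_fresh: "u \<in> set ps \<Longrightarrow> idx u \<le> fresh ps"
  unfolding fresh_def by (induction ps) auto

lemma fresh_neq: "Var n \<in> set ps \<Longrightarrow> n \<noteq> fresh ps"
  using idx_le_fresh[of "Var n" ps] by auto

lemma upd_fresh [simp]: "Var n \<in> set ps \<Longrightarrow> (e(fresh ps := d)) n = e n"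
  using fresh_neq by (simp add: fun_upd_apply)

text \<open>With \<open>fun_upd_apply\<close> removed from the simpset, this rule and
  \<open>upd_fresh\<close> evaluate parameters by looking them up in \<open>ps\<close>, without
  unfolding the nested \<open>fresh\<close> terms.\<close>

lemma val_fresh [simp]: "u \<in> set ps \<Longrightarrow> val c (e(fresh ps := d)) u = val c e u"
  by (cases u) auto

lemma ev_all [simp]:
  "ev Q E c e (all ps F) \<longleftrightarrow> (\<forall>d. ev Q E c (e(fresh ps := d)) (F (Var (fresh ps))))"
  by (simp add: all_def)

lemma ev_ex [simp]:
  "ev Q E c e (ex ps F) \<longleftrightarrow> (\<exists>d. ev Q E c (e(fresh ps := d)) (F (Var (fresh ps))))"
  by (simp add: ex_def)

lemma ev_Bot [simp]: "\<not> ev (=) E c e Bot"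
  by (simp add: Bot_def)

lemma ev_Conj [simp]: "ev (=) E c e (Conj as) \<longleftrightarrow> (\<forall>a \<in> set as. ev (=) E c e a)"
  unfolding Conj_def by (induction as) auto

lemma ev_Disj [simp]: "ev (=) E c e (Disj as) \<longleftrightarrow> (\<exists>a \<in> set as. ev (=) E c e a)"
  unfolding Disj_def by (induction as) auto

lemmas multi_quantifiers = all2_def all3_def ex2_def ex3_def ex4_def ex1_def

text \<open>Predicates that are definable with parameters.  Environments are indexed by de Bruijn indices, so
  that the closure rules below can be applied to HOL formulas without choosing variable names.\<close>

inductive Dfn :: "('a \<Rightarrow> 'a \<Rightarrow> bool) \<Rightarrow> ((nat \<Rightarrow> 'a) \<Rightarrow> bool) \<Rightarrow> bool" for E where
  mem: "f \<in> range (\<lambda>n e. e n) \<union> range (\<lambda>c e. c) \<Longrightarrow> g \<in> range (\<lambda>n e. e n) \<union> range (\<lambda>c e. c) \<Longrightarrow>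
    Dfn E (\<lambda>e. E (f e) (g e))"
| eq: "f \<in> range (\<lambda>n e. e n) \<union> range (\<lambda>c e. c) \<Longrightarrow> g \<in> range (\<lambda>n e. e n) \<union> range (\<lambda>c e. c) \<Longrightarrow>
    Dfn E (\<lambda>e. f e = g e)"
| neg: "Dfn E P \<Longrightarrow> Dfn E (\<lambda>e. \<not> P e)"
| imp: "Dfn E P \<Longrightarrow> Dfn E P' \<Longrightarrow> Dfn E (\<lambda>e. P e \<longrightarrow> P' e)"
| all: "Dfn E P \<Longrightarrow> Dfn E (\<lambda>e. \<forall>x. P (case_nat x e))"

lemma term_rename:
  "f \<in> range (\<lambda>n e. e n) \<union> range (\<lambda>c e. c) \<Longrightarrow>
   (\<lambda>e. f (\<lambda>n. e (v n))) \<in> range (\<lambda>n e. e n) \<union> range (\<lambda>c e. c)"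
  by auto

lemma Dfn_rename: "Dfn E P \<Longrightarrow> Dfn E (\<lambda>e. P (\<lambda>n. e (v n)))"
proof (induction arbitrary: v rule: Dfn.induct)
  case (all P)
  \<comment> \<open>The renaming lifted under one quantifier: index 0 is the newly bound variable
    and stays fixed.\<close>
  define w where "w = case_nat 0 (\<lambda>m. Suc (v m))"
  have eq: "(\<lambda>n. case_nat x e (w n)) = case_nat x (\<lambda>n. e (v n))" for x :: 'a and e
    by (rule ext) (simp add: w_def split: nat.split)
  have 1: "Dfn E (\<lambda>e. \<forall>x. P (\<lambda>n. case_nat x e (w n)))"
    by (rule Dfn.all[of E "\<lambda>e. P (\<lambda>n. e (w n))", OF all.IH[of w]])
  have 2: "(\<lambda>e. \<forall>x. P (\<lambda>n. case_nat x e (w n))) = (\<lambda>e. \<forall>x. P (case_nat x (\<lambda>n. e (v n))))"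
    by (rule ext, rule all_cong1, rule arg_cong[where f = P], rule eq)
  show ?case by (rule HOL.subst[where P = "Dfn E", OF 2 1])
next
  case (mem f g)
  show ?case by (rule Dfn.mem[OF term_rename[OF mem(1), of v] term_rename[OF mem(2), of v]])
next
  case (eq f g)
  show ?case by (rule Dfn.eq[OF term_rename[OF eq(1), of v] term_rename[OF eq(2), of v]])
next
  case (neg P)
  show ?case by (rule Dfn.neg[OF neg.IH])
next
  case (imp P P')
  show ?case by (rule Dfn.imp[OF imp.IH])
qed

lemma term_formula:
  fixes f :: "(nat \<Rightarrow> 'a) \<Rightarrow> 'a"
  assumes "f \<in> range (\<lambda>n e. e n) \<union> range (\<lambda>c e. c)"
  shows "\<exists>C k. finite C \<and> (\<forall>e e'. (\<forall>n<k. e n = e' n) \<longrightarrow> f e = f e') \<and>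
    (\<forall>v \<rho>. \<exists>s. \<forall>e. (\<forall>c \<in> C. e (\<rho> c) = c) \<longrightarrow> val t e s = f (\<lambda>n. e (v n)))"
proof -
  consider n where "f = (\<lambda>e. e n)" | c where "f = (\<lambda>e. c)" using assms by auto
  then show ?thesis
  proof cases
    case 1
    have form: "\<exists>s. \<forall>e. (\<forall>c \<in> {}. e (\<rho> c) = c) \<longrightarrow> val t e s = f (\<lambda>n. e (v n))" for v \<rho>
      by (rule exI[of _ "Var (v n)"]) (simp add: 1)
    have dep: "(\<forall>n'<Suc n. e n' = e' n') \<longrightarrow> f e = f e'" for e e' by (simp add: 1)
    show ?thesis
      by (intro exI[of _ "{}"] exI[of _ "Suc n"] conjI allI finite.emptyI dep form)
  next
    case 2
    have form: "\<exists>s. \<forall>e. (\<forall>c \<in> {c}. e (\<rho> c) = c) \<longrightarrow> val t e s = f (\<lambda>n. e (v n))" for v \<rho>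
      by (rule exI[of _ "Var (\<rho> c)"]) (simp add: 2)
    have dep: "(\<forall>n'<0. e n' = e' n') \<longrightarrow> f e = f e'" for e e' by (simp add: 2)
    have fin: "finite {c}" by simp
    show ?thesis by (intro exI[of _ "{c}"] exI[of _ 0] conjI allI fin dep form)
  qed
qed

text \<open>\<open>C\<close> collects the parameters and \<open>k\<close> bounds the indices on
  which the predicate depends. The formula is provided for every naming \<open>v\<close> of the
  indices and every placement \<open>\<rho>\<close> of the parameters, because a quantifier forces a
  new name for index 0 in the induction hypothesis.\<close>

lemma Dfn_formula:
  "Dfn E P \<Longrightarrow> \<exists>C k. finite C \<and> (\<forall>e e'. (\<forall>n<k. e n = e' n) \<longrightarrow> P e = P e') \<and>
    (\<forall>v \<rho>. \<exists>a. \<forall>e. (\<forall>c \<in> C. e (\<rho> c) = c) \<longrightarrow> ev (=) E t e a = P (\<lambda>n. e (v n)))"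
proof (induction rule: Dfn.induct)
  case (mem f g)
  from term_formula[OF mem(1), of t] obtain C1 k1 where 1: "finite C1"
    "\<forall>e e'. (\<forall>n<k1. e n = e' n) \<longrightarrow> f e = f e'"
    "\<forall>v \<rho>. \<exists>s. \<forall>e. (\<forall>c \<in> C1. e (\<rho> c) = c) \<longrightarrow> val t e s = f (\<lambda>n. e (v n))" by (elim exE conjE)
  from term_formula[OF mem(2), of t] obtain C2 k2 where 2: "finite C2"
    "\<forall>e e'. (\<forall>n<k2. e n = e' n) \<longrightarrow> g e = g e'"
    "\<forall>v \<rho>. \<exists>s. \<forall>e. (\<forall>c \<in> C2. e (\<rho> c) = c) \<longrightarrow> val t e s = g (\<lambda>n. e (v n))" by (elim exE conjE)
  have form: "\<exists>a. \<forall>e. (\<forall>c \<in> C1 \<union> C2. e (\<rho> c) = c) \<longrightarrow>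
    ev (=) E t e a = E (f (\<lambda>n. e (v n))) (g (\<lambda>n. e (v n)))" for v \<rho>
  proof -
    from 1(3)[rule_format, of \<rho> v] obtain s1 where
      "\<forall>e. (\<forall>c \<in> C1. e (\<rho> c) = c) \<longrightarrow> val t e s1 = f (\<lambda>n. e (v n))" ..
    moreover from 2(3)[rule_format, of \<rho> v] obtain s2 where
      "\<forall>e. (\<forall>c \<in> C2. e (\<rho> c) = c) \<longrightarrow> val t e s2 = g (\<lambda>n. e (v n))" ..
    ultimately show ?thesis by (intro exI[of _ "Mem s1 s2"]) auto
  qed
  have dep: "(\<forall>n<max k1 k2. e n = e' n) \<longrightarrow> E (f e) (g e) = E (f e') (g e')" for e e'
    by (intro impI) (simp add: 1(2)[rule_format, of e e'] 2(2)[rule_format, of e e'])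
  show ?case
    by (intro exI[of _ "C1 \<union> C2"] exI[of _ "max k1 k2"] conjI allI finite_UnI 1(1) 2(1) dep form)
next
  case (eq f g)
  from term_formula[OF eq(1), of t] obtain C1 k1 where 1: "finite C1"
    "\<forall>e e'. (\<forall>n<k1. e n = e' n) \<longrightarrow> f e = f e'"
    "\<forall>v \<rho>. \<exists>s. \<forall>e. (\<forall>c \<in> C1. e (\<rho> c) = c) \<longrightarrow> val t e s = f (\<lambda>n. e (v n))" by (elim exE conjE)
  from term_formula[OF eq(2), of t] obtain C2 k2 where 2: "finite C2"
    "\<forall>e e'. (\<forall>n<k2. e n = e' n) \<longrightarrow> g e = g e'"
    "\<forall>v \<rho>. \<exists>s. \<forall>e. (\<forall>c \<in> C2. e (\<rho> c) = c) \<longrightarrow> val t e s = g (\<lambda>n. e (v n))" by (elim exE conjE)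
  have form: "\<exists>a. \<forall>e. (\<forall>c \<in> C1 \<union> C2. e (\<rho> c) = c) \<longrightarrow>
    ev (=) E t e a = (f (\<lambda>n. e (v n)) = g (\<lambda>n. e (v n)))" for v \<rho>
  proof -
    from 1(3)[rule_format, of \<rho> v] obtain s1 where
      "\<forall>e. (\<forall>c \<in> C1. e (\<rho> c) = c) \<longrightarrow> val t e s1 = f (\<lambda>n. e (v n))" ..
    moreover from 2(3)[rule_format, of \<rho> v] obtain s2 where
      "\<forall>e. (\<forall>c \<in> C2. e (\<rho> c) = c) \<longrightarrow> val t e s2 = g (\<lambda>n. e (v n))" ..
    ultimately show ?thesis by (intro exI[of _ "Eq s1 s2"]) auto
  qed
  have dep: "(\<forall>n<max k1 k2. e n = e' n) \<longrightarrow> (f e = g e) = (f e' = g e')" for e e'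
    by (intro impI) (simp add: 1(2)[rule_format, of e e'] 2(2)[rule_format, of e e'])
  show ?case
    by (intro exI[of _ "C1 \<union> C2"] exI[of _ "max k1 k2"] conjI allI finite_UnI 1(1) 2(1) dep form)
next
  case (neg P)
  then obtain C k where 1: "finite C" "\<forall>e e'. (\<forall>n<k. e n = e' n) \<longrightarrow> P e = P e'"
    "\<forall>v \<rho>. \<exists>a. \<forall>e. (\<forall>c \<in> C. e (\<rho> c) = c) \<longrightarrow> ev (=) E t e a = P (\<lambda>n. e (v n))"
    by (elim exE conjE)
  have form: "\<exists>a. \<forall>e. (\<forall>c \<in> C. e (\<rho> c) = c) \<longrightarrow> ev (=) E t e a = (\<not> P (\<lambda>n. e (v n)))" for v \<rho>
  proof -
    from 1(3)[rule_format, of \<rho> v] obtain a where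
      "\<forall>e. (\<forall>c \<in> C. e (\<rho> c) = c) \<longrightarrow> ev (=) E t e a = P (\<lambda>n. e (v n))" ..
    then show ?thesis by (intro exI[of _ "Neg a"]) simp
  qed
  have dep: "(\<forall>n<k. e n = e' n) \<longrightarrow> (\<not> P e) = (\<not> P e')" for e e'
    by (intro impI) (simp add: 1(2)[rule_format, of e e'])
  show ?case by (intro exI[of _ C] exI[of _ k] conjI allI 1(1) dep form)
next
  case (imp P P')
  from imp.IH(1) obtain C1 k1 where 1: "finite C1" "\<forall>e e'. (\<forall>n<k1. e n = e' n) \<longrightarrow> P e = P e'"
    "\<forall>v \<rho>. \<exists>a. \<forall>e. (\<forall>c \<in> C1. e (\<rho> c) = c) \<longrightarrow> ev (=) E t e a = P (\<lambda>n. e (v n))"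
    by (elim exE conjE)
  from imp.IH(2) obtain C2 k2 where 2: "finite C2" "\<forall>e e'. (\<forall>n<k2. e n = e' n) \<longrightarrow> P' e = P' e'"
    "\<forall>v \<rho>. \<exists>a. \<forall>e. (\<forall>c \<in> C2. e (\<rho> c) = c) \<longrightarrow> ev (=) E t e a = P' (\<lambda>n. e (v n))"
    by (elim exE conjE)
  have form: "\<exists>a. \<forall>e. (\<forall>c \<in> C1 \<union> C2. e (\<rho> c) = c) \<longrightarrow>
    ev (=) E t e a = (P (\<lambda>n. e (v n)) \<longrightarrow> P' (\<lambda>n. e (v n)))" for v \<rho>
  proof -
    from 1(3)[rule_format, of \<rho> v] obtain a where
      "\<forall>e. (\<forall>c \<in> C1. e (\<rho> c) = c) \<longrightarrow> ev (=) E t e a = P (\<lambda>n. e (v n))" ..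
    moreover from 2(3)[rule_format, of \<rho> v] obtain b where
      "\<forall>e. (\<forall>c \<in> C2. e (\<rho> c) = c) \<longrightarrow> ev (=) E t e b = P' (\<lambda>n. e (v n))" ..
    ultimately show ?thesis by (intro exI[of _ "Imp a b"]) auto
  qed
  have dep: "(\<forall>n<max k1 k2. e n = e' n) \<longrightarrow> (P e \<longrightarrow> P' e) = (P e' \<longrightarrow> P' e')" for e e'
    by (intro impI) (simp add: 1(2)[rule_format, of e e'] 2(2)[rule_format, of e e'])
  show ?case
    by (intro exI[of _ "C1 \<union> C2"] exI[of _ "max k1 k2"] conjI allI finite_UnI 1(1) 2(1) dep form)
next
  case (all P)
  then obtain C k where 1: "finite C" "\<forall>e e'. (\<forall>n<k. e n = e' n) \<longrightarrow> P e = P e'"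
    "\<forall>v \<rho>. \<exists>a. \<forall>e. (\<forall>c \<in> C. e (\<rho> c) = c) \<longrightarrow> ev (=) E t e a = P (\<lambda>n. e (v n))"
    by (elim exE conjE)
  have form: "\<exists>a. \<forall>e. (\<forall>c \<in> C. e (\<rho> c) = c) \<longrightarrow>
    ev (=) E t e a = (\<forall>x. P (case_nat x (\<lambda>n. e (v n))))" for v \<rho>
  proof -
    \<comment> \<open>The bound variable must avoid the parameters and the names of the indices
      below \<open>k\<close>; a clash with a higher index is harmless, since the predicate does not
      depend on it.\<close>
    obtain w where w: "w \<notin> \<rho> ` C \<union> v ` {..<k}"
      using ex_fresh[of "\<rho> ` C \<union> v ` {..<k}"] 1(1) by auto
    from 1(3)[rule_format, of \<rho> "case_nat w v"] obtain a where a: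
      "\<forall>e. (\<forall>c \<in> C. e (\<rho> c) = c) \<longrightarrow> ev (=) E t e a = P (\<lambda>n. e (case_nat w v n))" ..
    have "ev (=) E t e (All w a) = (\<forall>x. P (case_nat x (\<lambda>n. e (v n))))"
      if e: "\<forall>c \<in> C. e (\<rho> c) = c" for e
    proof -
      have "ev (=) E t (e(w := x)) a = P (case_nat x (\<lambda>n. e (v n)))" for x
      proof -
        have "\<forall>c \<in> C. (e(w := x)) (\<rho> c) = c" using e w by (auto simp: fun_upd_apply)
        then have "ev (=) E t (e(w := x)) a = P (\<lambda>n. (e(w := x)) (case_nat w v n))"
          using a by simp
        also have "\<dots> = P (case_nat x (\<lambda>n. e (v n)))"
          by (rule 1(2)[rule_format]) (use w in \<open>auto simp: fun_upd_apply split: nat.splits\<close>)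
        finally show ?thesis .
      qed
      then show ?thesis by simp
    qed
    then show ?thesis by (intro exI[of _ "All w a"]) simp
  qed
  have dep: "(\<forall>n<k. e n = e' n) \<longrightarrow> (\<forall>x. P (case_nat x e)) = (\<forall>x. P (case_nat x e'))" for e e'
  proof
    assume "\<forall>n<k. e n = e' n"
    then have "P (case_nat x e) = P (case_nat x e')" for x
      by (intro 1(2)[rule_format]) (auto split: nat.splits)
    then show "(\<forall>x. P (case_nat x e)) = (\<forall>x. P (case_nat x e'))" by simp
  qed
  show ?case by (intro exI[of _ C] exI[of _ k] conjI allI 1(1) dep form)
qed

lemma Dfn_ev: "Dfn E (\<lambda>e. ev (=) E t e a)"
proof (induction a)
  have val: "(\<lambda>e. val t e s) \<in> range (\<lambda>n e. e n) \<union> range (\<lambda>c e. c)" for s by (cases s) auto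
  {
    case (Eq s u)
    show ?case using Dfn.eq[OF val val, of E s u] by simp
  next
    case (Mem s u)
    show ?case using Dfn.mem[OF val val, of E s u] by simp
  next
    case (Neg a)
    then show ?case by (simp add: Dfn.neg)
  next
    case (Imp a b)
    then show ?case by (simp add: Dfn.imp)
  next
    case (All x a)
    \<comment> \<open>Translates named variables to de Bruijn indices: the quantified
      \<open>x\<close> reads index 0, every other variable its shifted index.\<close>
    define w where "w n = (if n = x then 0 else Suc n)" for n
    have eq: "(\<lambda>n. case_nat d e (w n)) = e(x := d)" for d :: 'a and e
      by (rule ext) (simp add: w_def fun_upd_apply)
    have 1: "Dfn E (\<lambda>e. \<forall>d. ev (=) E t (\<lambda>n. case_nat d e (w n)) a)"
      by (rule Dfn.all[of E "\<lambda>e. ev (=) E t (\<lambda>n. e (w n)) a", OF Dfn_rename[OF All.IH, of w]])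
    have 2: "(\<lambda>e. \<forall>d. ev (=) E t (\<lambda>n. case_nat d e (w n)) a) = (\<lambda>e. ev (=) E t e (All x a))"
      by (rule ext) (simp add: eq)
    show ?case by (rule HOL.subst[where P = "Dfn E", OF 2 1])
  }
qed

section \<open>Closure rules for definable predicates and terms\<close>

lemma Dfn_all: "Dfn E (\<lambda>e. P (\<lambda>n. e (Suc n)) (e 0)) \<Longrightarrow> Dfn E (\<lambda>e. \<forall>x. P e x)"
  using Dfn.all[of E "\<lambda>e. P (\<lambda>n. e (Suc n)) (e 0)"] by simp

lemma Dfn_conj: "Dfn E P \<Longrightarrow> Dfn E P' \<Longrightarrow> Dfn E (\<lambda>e. P e \<and> P' e)"
  using Dfn.neg[OF Dfn.imp[OF _ Dfn.neg, of E P P']] by simp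

lemma Dfn_disj: "Dfn E P \<Longrightarrow> Dfn E P' \<Longrightarrow> Dfn E (\<lambda>e. P e \<or> P' e)"
  using Dfn.imp[OF Dfn.neg, of E P P'] by (simp add: disj_imp)

lemma Dfn_iff: "Dfn E P \<Longrightarrow> Dfn E P' \<Longrightarrow> Dfn E (\<lambda>e. P e \<longleftrightarrow> P' e)"
  using Dfn_conj[OF Dfn.imp Dfn.imp, of E P P' P' P] by (simp add: iff_conv_conj_imp)

lemma Dfn_ex: "Dfn E (\<lambda>e. P (\<lambda>n. e (Suc n)) (e 0)) \<Longrightarrow> Dfn E (\<lambda>e. \<exists>x. P e x)"
  using Dfn.neg[OF Dfn_all[of E "\<lambda>e x. \<not> P e x", OF Dfn.neg]] by simp

lemma Dfn_const: "Dfn E (\<lambda>e. p)"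
proof -
  have "Dfn E (\<lambda>e. (undefined :: 'a) = undefined)" by (rule Dfn.eq) auto
  then have "Dfn E (\<lambda>e. True)" by simp
  then show ?thesis using Dfn.neg[of E "\<lambda>e. True"] by (cases p) auto
qed

text \<open>The quantifier ranges over a finite set of the metatheory and thus amounts to a finite
  disjunction. States and symbols, which are not elements of the model, are quantified in this
  way.\<close>

lemma Dfn_bex: "finite S \<Longrightarrow> (\<And>n. n \<in> S \<Longrightarrow> Dfn E (P n)) \<Longrightarrow> Dfn E (\<lambda>e. \<exists>n \<in> S. P n e)"
proof (induction S rule: finite_induct)
  case empty
  show ?case using Dfn_const[of E False] by simp
next
  case (insert n S)
  have "Dfn E (\<lambda>e. P n e \<or> (\<exists>n \<in> S. P n e))"
    by (rule Dfn_disj[OF _ insert.IH]) (use insert.prems in simp_all)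
  then show ?case by simp
qed

text \<open>A term is definable if its graph is: index 0 holds the value, and the environment of the
  term is shifted by one.\<close>

definition Dt :: "('a \<Rightarrow> 'a \<Rightarrow> bool) \<Rightarrow> ((nat \<Rightarrow> 'a) \<Rightarrow> 'a) \<Rightarrow> bool" where
  "Dt E f \<longleftrightarrow> Dfn E (\<lambda>e. e 0 = f (\<lambda>n. e (Suc n)))"

lemma Dt_var: "Dt E (\<lambda>e. e n)"
  unfolding Dt_def by (rule Dfn.eq) auto

lemma Dt_const: "Dt E (\<lambda>e. c)"
  unfolding Dt_def by (rule Dfn.eq) auto

text \<open>\<open>P e (f e)\<close> is read as the existence of an \<open>x\<close> with
  \<open>x = f e\<close> and \<open>P e x\<close>, so that a definable graph suffices.\<close>

lemma Dfn_subst: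
  assumes "Dfn E (\<lambda>e. P (\<lambda>n. e (Suc n)) (e 0))" "Dt E f"
  shows "Dfn E (\<lambda>e. P e (f e))"
proof -
  have "Dfn E (\<lambda>e. \<exists>x. x = f e \<and> P e x)"
    by (rule Dfn_ex, rule Dfn_conj) (use assms in \<open>simp_all add: Dt_def\<close>)
  then show ?thesis by simp
qed

lemma Dfn_subst2:
  assumes "Dfn E (\<lambda>e. R (e 0) (e 1))" "Dt E f" "Dt E g"
  shows "Dfn E (\<lambda>e. R (f e) (g e))"
proof -
  have "Dfn E (\<lambda>e. R (e 0) (g (\<lambda>n. e (Suc n))))"
  proof (rule Dfn_subst[of E "\<lambda>e y. R (e 0) y"])
    show "Dfn E (\<lambda>e. R (e (Suc 0)) (e 0))"
      using Dfn_rename[OF assms(1), of "\<lambda>n. if n = 0 then 1 else 0"] by simp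
    show "Dt E (\<lambda>e. g (\<lambda>n. e (Suc n)))"
      using Dfn_rename[OF assms(3)[unfolded Dt_def], of "\<lambda>n. case n of 0 \<Rightarrow> 0 | Suc m \<Rightarrow> Suc (Suc m)"]
      unfolding Dt_def by simp
  qed
  then show ?thesis by (rule Dfn_subst[of E "\<lambda>e x. R x (g e)"]) (rule assms(2))
qed

lemma Dt_subst2:
  assumes "Dfn E (\<lambda>e. e 0 = F (e 1) (e 2))" "Dt E f" "Dt E g"
  shows "Dt E (\<lambda>e. F (f e) (g e))"
proof -
  have shift: "Dt E (\<lambda>e. h (\<lambda>n. e (Suc n)))" if "Dt E h" for h
    using Dfn_rename[OF that[unfolded Dt_def], of "\<lambda>n. case n of 0 \<Rightarrow> 0 | Suc m \<Rightarrow> Suc (Suc m)"]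
    unfolding Dt_def by simp
  have "Dfn E (\<lambda>e. e 0 = F (e 1) (g (\<lambda>n. e (Suc (Suc n)))))"
  proof (rule Dfn_subst[of E "\<lambda>e y. e 0 = F (e 1) y"])
    show "Dfn E (\<lambda>e. e (Suc 0) = F (e (Suc 1)) (e 0))"
      using Dfn_rename[OF assms(1), of "\<lambda>n. if n = 0 then 1 else if n = 1 then 2 else 0"]
      by (simp add: numeral_2_eq_2)
    show "Dt E (\<lambda>e. g (\<lambda>n. e (Suc (Suc n))))" using shift[OF shift[OF assms(3)]] .
  qed
  \<comment> \<open>\<open>Dfn_subst\<close> eliminates the variable at index 0, so the value of
    \<open>F\<close> and its first argument change places.\<close>
  then have "Dfn E (\<lambda>e. e 1 = F (e 0) (g (\<lambda>n. e (Suc (Suc n)))))"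
    using Dfn_rename[of E "\<lambda>e. e 0 = F (e 1) (g (\<lambda>n. e (Suc (Suc n))))"
        "\<lambda>n. if n = 0 then 1 else if n = 1 then 0 else n"] by simp
  then have "Dfn E (\<lambda>e. e 0 = F (f (\<lambda>n. e (Suc n))) (g (\<lambda>n. e (Suc n))))"
    by (intro Dfn_subst[of E "\<lambda>e x. e 0 = F x (g (\<lambda>n. e (Suc n)))"] shift assms(2)) simp
  then show ?thesis unfolding Dt_def .
qed

lemma Dfn_eq: "Dt E f \<Longrightarrow> Dt E g \<Longrightarrow> Dfn E (\<lambda>e. f e = g e)"
  by (rule Dfn_subst2) (rule Dfn.eq; auto)

lemma Dfn_mem: "Dt E f \<Longrightarrow> Dt E g \<Longrightarrow> Dfn E (\<lambda>e. E (f e) (g e))"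
  by (rule Dfn_subst2) (rule Dfn.mem; auto)

lemmas dfn_intros = Dfn_conj Dfn_disj Dfn_iff Dfn.imp Dfn.neg Dfn_all Dfn_ex Dfn_eq Dfn_mem
  Dt_var Dt_const


section \<open>Set theory in a model\<close>

locale zf =
  fixes E :: "'a \<Rightarrow> 'a \<Rightarrow> bool" (infix "\<epsilon>" 50) and c0 :: 'a
  assumes zfc_true: "zfc_axiom a \<Longrightarrow> ev (=) E c0 e a"
begin

abbreviation "sat \<equiv> ev (=) E"

lemma single_true: "a \<in> set zfc_single \<Longrightarrow> sat c0 e a"
  by (rule zfc_true[OF zfc_axiom.single])

lemma set_ext: "(\<And>z. z \<epsilon> x \<longleftrightarrow> z \<epsilon> y) \<Longrightarrow> x = y"
  using single_true[of "zfc_single ! 0" "\<lambda>_. c0"] by (simp add: zfc_single_def multi_quantifiers)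

text \<open>The parameters of the predicate are elements of the model without names in the language.
  An injection \<open>\<rho>\<close> that avoids 0, the variable of the separated element, assigns
  them to variables, and the schema is evaluated under that assignment.\<close>

lemma separation:
  assumes "Dfn E (\<lambda>e. P (e 0))"
  shows "\<exists>y. \<forall>x. x \<epsilon> y \<longleftrightarrow> x \<epsilon> z \<and> P x"
proof -
  from Dfn_formula[OF assms, of c0] obtain C k where C: "finite C"
    and "\<forall>e e' :: nat \<Rightarrow> 'a. (\<forall>n<k. e n = e' n) \<longrightarrow> P (e 0) = P (e' 0)"
    and form: "\<forall>(v :: nat \<Rightarrow> nat) \<rho>. \<exists>a. \<forall>e. (\<forall>c \<in> C. e (\<rho> c) = c) \<longrightarrow> sat c0 e a = P (e (v 0))"
    by (elim exE conjE)
  obtain f :: "'a \<Rightarrow> nat" where f: "inj_on f C" using finite_imp_inj_to_nat_seg[OF C] by auto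
  define \<rho> where "\<rho> c = Suc (f c)" for c
  have \<rho>0: "\<rho> c \<noteq> 0" for c by (simp add: \<rho>_def)
  have \<rho>: "inj_on \<rho> C" using f by (auto simp: inj_on_def \<rho>_def)
  from form[rule_format, of \<rho> "\<lambda>_. 0"] obtain a where
    a: "\<forall>e. (\<forall>c \<in> C. e (\<rho> c) = c) \<longrightarrow> sat c0 e a = P (e 0)" ..
  let ?S = "fv a \<union> \<rho> ` C \<union> {0}"
  obtain y' where y': "y' \<notin> ?S" using ex_fresh[of ?S] C by auto
  obtain z' where z': "z' \<notin> insert y' ?S" using ex_fresh[of "insert y' ?S"] C by auto
  define e where "e n = (if n = z' then z else inv_into C \<rho> n)" for n
  have "zfc_axiom (Ex y' (All 0 (Iff (Mem (Var 0) (Var y')) (And (Mem (Var 0) (Var z')) a))))"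
    by (rule zfc_axiom.separation) (use y' z' in auto)
  from zfc_true[OF this, of e] obtain d where
    d: "\<forall>x. x \<epsilon> d \<longleftrightarrow> x \<epsilon> z \<and> sat c0 (e(y' := d, 0 := x)) a"
    using y' z' by (auto simp: e_def fun_upd_apply)
  have "sat c0 (e(y' := d, 0 := x)) a = P x" for x
  proof -
    have "\<forall>c \<in> C. (e(y' := d, 0 := x)) (\<rho> c) = c"
      using y' z' inv_into_f_f[OF \<rho>] by (auto simp: e_def fun_upd_apply \<rho>0)
    then show ?thesis using a by simp
  qed
  then show ?thesis using d by blast
qed

definition the_set :: "('a \<Rightarrow> bool) \<Rightarrow> 'a" where
  "the_set P = (THE y. \<forall>x. x \<epsilon> y \<longleftrightarrow> P x)"

text \<open>The first part computes membership. The second turns a defining property into an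
  equation, which is how the abbreviations for set-theoretic notions are evaluated.\<close>

lemma the_set:
  assumes "\<exists>y. \<forall>x. x \<epsilon> y \<longleftrightarrow> P x"
  shows "x \<epsilon> the_set P \<longleftrightarrow> P x" and "(\<forall>x. x \<epsilon> y \<longleftrightarrow> P x) \<longleftrightarrow> y = the_set P"
proof -
  have "\<exists>!y. \<forall>x. x \<epsilon> y \<longleftrightarrow> P x" using assms set_ext by (simp add: Ex1_def) metis
  from theI'[OF this] have *: "\<forall>x. x \<epsilon> the_set P \<longleftrightarrow> P x" unfolding the_set_def .
  then show "x \<epsilon> the_set P \<longleftrightarrow> P x" ..
  show "(\<forall>x. x \<epsilon> y \<longleftrightarrow> P x) \<longleftrightarrow> y = the_set P"
    using * set_ext[of y "the_set P"] by auto
qed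

definition "emp = the_set (\<lambda>z. False)"
definition "upair x y = the_set (\<lambda>z. z = x \<or> z = y)"
definition "bigun x = the_set (\<lambda>z. \<exists>w. z \<epsilon> w \<and> w \<epsilon> x)"
definition "pow x = the_set (\<lambda>z. \<forall>w. w \<epsilon> z \<longrightarrow> w \<epsilon> x)"
definition "suc x = the_set (\<lambda>z. z \<epsilon> x \<or> z = x)"
definition "pair x y = upair (upair x x) (upair x y)"

lemma emp_ex: "\<exists>y. \<forall>z. z \<epsilon> y \<longleftrightarrow> False"
  using separation[of "\<lambda>_. False", OF Dfn_const] by simp

lemmas mem_emp [simp] = the_set(1)[OF emp_ex, folded emp_def, simplified]
lemmas eq_emp = the_set(2)[OF emp_ex, folded emp_def, simplified]

lemma upair_ex: "\<exists>p. \<forall>z. z \<epsilon> p \<longleftrightarrow> z = x \<or> z = y"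
  using single_true[of "zfc_single ! 1" "\<lambda>_. c0"]
  by (simp add: zfc_single_def multi_quantifiers upair_fm_def)

lemmas mem_upair [simp] = the_set(1)[OF upair_ex, folded upair_def]
lemmas eq_upair = the_set(2)[OF upair_ex, folded upair_def]

lemma bigun_ex: "\<exists>p. \<forall>z. z \<epsilon> p \<longleftrightarrow> (\<exists>w. z \<epsilon> w \<and> w \<epsilon> x)"
  using single_true[of "zfc_single ! 2" "\<lambda>_. c0"] by (simp add: zfc_single_def)

lemmas mem_bigun [simp] = the_set(1)[OF bigun_ex, folded bigun_def]

lemma pow_ex: "\<exists>p. \<forall>z. z \<epsilon> p \<longleftrightarrow> (\<forall>w. w \<epsilon> z \<longrightarrow> w \<epsilon> x)"
  using single_true[of "zfc_single ! 3" "\<lambda>_. c0"] by (simp add: zfc_single_def sub_fm_def)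

lemmas mem_pow [simp] = the_set(1)[OF pow_ex, folded pow_def]

lemma suc_ex: "\<exists>p. \<forall>z. z \<epsilon> p \<longleftrightarrow> z \<epsilon> x \<or> z = x"
  by (rule exI[of _ "bigun (upair x (upair x x))"]) (auto simp: conj_disj_distribL ex_disj_distrib)

lemmas mem_suc [simp] = the_set(1)[OF suc_ex, folded suc_def]
lemmas eq_suc = the_set(2)[OF suc_ex, folded suc_def]

lemma upair_eq: "upair x y = upair u v \<longleftrightarrow> x = u \<and> y = v \<or> x = v \<and> y = u"
proof
  assume "upair x y = upair u v"
  then have "z = x \<or> z = y \<longleftrightarrow> z = u \<or> z = v" for z using mem_upair by metis
  then show "x = u \<and> y = v \<or> x = v \<and> y = u" by metis
qed (auto intro!: set_ext)

lemma pair_eq [simp]: "pair x y = pair u v \<longleftrightarrow> x = u \<and> y = v"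
  unfolding pair_def upair_eq by auto

lemma suc_neq_emp [simp]: "suc x \<noteq> emp" "emp \<noteq> suc x"
  using mem_suc[of x x] mem_emp[of x] by metis+

lemma sat_empty [simp]: "sat t e (empty_fm u) \<longleftrightarrow> val t e u = emp"
  by (simp add: empty_fm_def eq_emp)

lemma sat_succ [simp]: "sat t e (succ_fm u v) \<longleftrightarrow> val t e v = suc (val t e u)"
  by (simp add: succ_fm_def eq_suc)

lemma sat_upair [simp]: "sat t e (upair_fm u v p) \<longleftrightarrow> val t e p = upair (val t e u) (val t e v)"
  by (simp add: upair_fm_def eq_upair)

lemma sat_pair [simp]: "sat t e (pair_fm u v p) \<longleftrightarrow> val t e p = pair (val t e u) (val t e v)"
  by (simp add: pair_fm_def pair_def multi_quantifiers)

section \<open>The natural numbers of a model\<close>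

definition "inductive_set w \<longleftrightarrow> emp \<epsilon> w \<and> (\<forall>x. x \<epsilon> w \<longrightarrow> suc x \<epsilon> w)"
text \<open>It may have nonstandard elements; the standard ones are the numerals
  \<open>nm k\<close>.\<close>

definition "om = the_set (\<lambda>n. \<forall>w. inductive_set w \<longrightarrow> n \<epsilon> w)"

lemma sat_inductive [simp]: "sat t e (inductive_fm w) \<longleftrightarrow> inductive_set (val t e w)"
  by (simp add: inductive_fm_def inductive_set_def)

lemma om_ex: "\<exists>y. \<forall>n. n \<epsilon> y \<longleftrightarrow> (\<forall>w. inductive_set w \<longrightarrow> n \<epsilon> w)"
proof -
  obtain w where w: "inductive_set w"
    using single_true[of "zfc_single ! 4" "\<lambda>_. c0"] by (auto simp: zfc_single_def)
  have "Dfn E (\<lambda>e. \<forall>w. inductive_set w \<longrightarrow> e 0 \<epsilon> w)"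
    using Dfn_ev[of E c0 "nat_fm (Var 0)"] by (simp add: nat_fm_def)
  from separation[OF this, of w] show ?thesis using w by blast
qed

lemmas mem_om = the_set(1)[OF om_ex, folded om_def]

lemma sat_nat [simp]: "sat t e (nat_fm u) \<longleftrightarrow> val t e u \<epsilon> om"
  by (simp add: nat_fm_def mem_om)

lemma emp_om [simp]: "emp \<epsilon> om"
  by (simp add: mem_om inductive_set_def)

lemma suc_om [intro]: "n \<epsilon> om \<Longrightarrow> suc n \<epsilon> om"
  unfolding mem_om by (metis inductive_set_def)

text \<open>The elements satisfying \<open>P\<close> have to form a set, which is inductive by the
  last two assumptions. Hence every induction over \<open>om\<close> below carries a definability
  condition.\<close>

lemma om_induct:
  assumes "n \<epsilon> om" "Dfn E (\<lambda>e. P (e 0))" "P emp" "\<And>n. n \<epsilon> om \<Longrightarrow> P n \<Longrightarrow> P (suc n)"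
  shows "P n"
proof -
  from separation[OF assms(2), of om] obtain y where y: "\<forall>x. x \<epsilon> y \<longleftrightarrow> x \<epsilon> om \<and> P x" ..
  then have "inductive_set y" unfolding inductive_set_def using assms(3,4) suc_om by auto
  then have "n \<epsilon> y" using assms(1) mem_om by simp
  then show ?thesis using y by simp
qed

lemma Dt_pair: "Dt E f \<Longrightarrow> Dt E g \<Longrightarrow> Dt E (\<lambda>e. pair (f e) (g e))"
  using Dfn_ev[of E c0 "pair_fm (Var 1) (Var 2) (Var 0)"] by (intro Dt_subst2[of E pair]) simp_all

lemma Dt_suc: "Dt E f \<Longrightarrow> Dt E (\<lambda>e. suc (f e))"
  using Dfn_ev[of E c0 "succ_fm (Var 1) (Var 0)"]
  by (intro Dt_subst2[of E "\<lambda>x y. suc x" f f]) simp_all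

lemmas dfns = dfn_intros Dt_pair Dt_suc

lemma om_mem: "n \<epsilon> om \<Longrightarrow> i \<epsilon> n \<Longrightarrow> i \<epsilon> om"
proof -
  assume n: "n \<epsilon> om"
  have "\<forall>i. i \<epsilon> n \<longrightarrow> i \<epsilon> om"
    by (rule om_induct[OF n, of "\<lambda>n. \<forall>i. i \<epsilon> n \<longrightarrow> i \<epsilon> om"]) (intro dfns | auto)+
  then show "i \<epsilon> n \<Longrightarrow> i \<epsilon> om" by simp
qed

lemma om_trans: "n \<epsilon> om \<Longrightarrow> i \<epsilon> n \<Longrightarrow> j \<epsilon> i \<Longrightarrow> j \<epsilon> n"
proof -
  assume n: "n \<epsilon> om"
  have "\<forall>i. i \<epsilon> n \<longrightarrow> (\<forall>j. j \<epsilon> i \<longrightarrow> j \<epsilon> n)"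
    by (rule om_induct[OF n, of "\<lambda>n. \<forall>i. i \<epsilon> n \<longrightarrow> (\<forall>j. j \<epsilon> i \<longrightarrow> j \<epsilon> n)"])
      (intro dfns | auto)+
  then show "i \<epsilon> n \<Longrightarrow> j \<epsilon> i \<Longrightarrow> j \<epsilon> n" by simp
qed

lemma om_irrefl: "n \<epsilon> om \<Longrightarrow> \<not> n \<epsilon> n"
proof -
  assume n: "n \<epsilon> om"
  show ?thesis
  proof (rule om_induct[OF n, of "\<lambda>n. \<not> n \<epsilon> n"])
    show "Dfn E (\<lambda>e. \<not> e 0 \<epsilon> e 0)" by (intro dfns)
    fix n assume n: "n \<epsilon> om" and i: "\<not> n \<epsilon> n"
    show "\<not> suc n \<epsilon> suc n"
    proof
      assume "suc n \<epsilon> suc n"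
      then have "suc n \<epsilon> n \<or> suc n = n" by simp
      moreover have "n \<epsilon> suc n" by simp
      ultimately show False using om_trans[OF n] i by metis
    qed
  qed simp
qed

lemma suc_inj: "m \<epsilon> om \<Longrightarrow> n \<epsilon> om \<Longrightarrow> suc m = suc n \<Longrightarrow> m = n"
proof (rule ccontr)
  assume *: "m \<epsilon> om" "n \<epsilon> om" "suc m = suc n" "m \<noteq> n"
  then have "m \<epsilon> n" "n \<epsilon> m" using mem_suc[of m m] mem_suc[of n n] mem_suc[of m n] mem_suc[of n m] by metis+
  then have "m \<epsilon> m" using om_trans[OF *(1)] by metis
  then show False using om_irrefl *(1) by simp
qed

lemma om_cases: "n \<epsilon> om \<Longrightarrow> n = emp \<or> (\<exists>m. m \<epsilon> om \<and> n = suc m)"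
  by (rule om_induct[of n "\<lambda>n. n = emp \<or> (\<exists>m. m \<epsilon> om \<and> n = suc m)"]) (intro dfns | auto)+

lemma mem_suc_cases:
  assumes "l \<epsilon> om" "k \<epsilon> suc l"
  shows "k = emp \<or> (\<exists>i. i \<epsilon> l \<and> k = suc i)"
proof -
  have "\<forall>k. k \<epsilon> suc l \<longrightarrow> k = emp \<or> (\<exists>i. i \<epsilon> l \<and> k = suc i)"
    by (rule om_induct[OF assms(1), of "\<lambda>l. \<forall>k. k \<epsilon> suc l \<longrightarrow> k = emp \<or> (\<exists>i. i \<epsilon> l \<and> k = suc i)"])
      (intro dfns | auto)+
  then show ?thesis using assms(2) by blast
qed

primrec nm :: "nat \<Rightarrow> 'a" where
  "nm 0 = emp"
| "nm (Suc k) = suc (nm k)"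

lemma nm_om [simp]: "nm k \<epsilon> om"
  by (induction k) auto

lemma nm_eq [simp]: "nm m = nm n \<longleftrightarrow> m = n"
proof (induction m arbitrary: n)
  case 0
  then show ?case by (cases n) auto
next
  case (Suc m)
  then show ?case using suc_inj[OF nm_om nm_om] by (cases n) auto
qed

lemma cart_ex: "\<exists>p. \<forall>z. z \<epsilon> p \<longleftrightarrow> (\<exists>a b. a \<epsilon> x \<and> b \<epsilon> y \<and> z = pair a b)"
proof -
  let ?P = "\<lambda>z. \<exists>a b. a \<epsilon> x \<and> b \<epsilon> y \<and> z = pair a b"
  have "Dfn E (\<lambda>e. ?P (e 0))" by (intro dfns)
  \<comment> \<open>Here \<open>bigun (upair x y)\<close> is the union of \<open>x\<close> and
    \<open>y\<close>; a Kuratowski pair from \<open>x\<close> and \<open>y\<close> is a set of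
    subsets of it.\<close>
  from separation[OF this, of "pow (pow (bigun (upair x y)))"] obtain p where
    p: "\<forall>z. z \<epsilon> p \<longleftrightarrow> z \<epsilon> pow (pow (bigun (upair x y))) \<and> ?P z" ..
  have "?P z \<Longrightarrow> z \<epsilon> pow (pow (bigun (upair x y)))" for z
    by (auto simp: pair_def conj_disj_distribL ex_disj_distrib)
  then have "\<forall>z. z \<epsilon> p \<longleftrightarrow> ?P z" using p by blast
  then show ?thesis ..
qed

definition "cart x y = the_set (\<lambda>z. \<exists>a b. a \<epsilon> x \<and> b \<epsilon> y \<and> z = pair a b)"

lemmas mem_cart = the_set(1)[OF cart_ex, folded cart_def]

lemma pair_mem_cart [simp]: "pair a b \<epsilon> cart x y \<longleftrightarrow> a \<epsilon> x \<and> b \<epsilon> y"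
  by (auto simp: mem_cart)


section \<open>The formalized notions in a model\<close>

definition "seq f n \<longleftrightarrow> n \<epsilon> om \<and> (\<forall>p. p \<epsilon> f \<longrightarrow> (\<exists>i y. i \<epsilon> n \<and> p = pair i y)) \<and>
  (\<forall>i. i \<epsilon> n \<longrightarrow> (\<exists>y. \<forall>z. pair i z \<epsilon> f \<longleftrightarrow> z = y))"

lemma sat_app [simp]: "sat t e (app_fm f x y) \<longleftrightarrow> pair (val t e x) (val t e y) \<epsilon> val t e f"
  by (simp add: app_fm_def)

lemma sat_seq [simp]: "sat t e (seq_fm f n) \<longleftrightarrow> seq (val t e f) (val t e n)"
  by (simp add: seq_fm_def seq_def multi_quantifiers)

lemma seq_dom: "seq f n \<Longrightarrow> pair i y \<epsilon> f \<Longrightarrow> i \<epsilon> n"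
  unfolding seq_def by auto

lemma seq_fun: "seq f n \<Longrightarrow> pair i y \<epsilon> f \<Longrightarrow> pair i z \<epsilon> f \<Longrightarrow> y = z"
proof -
  assume *: "seq f n" "pair i y \<epsilon> f" "pair i z \<epsilon> f"
  have "i \<epsilon> n" using *(1,2) by (rule seq_dom)
  then have "\<exists>w. \<forall>z. pair i z \<epsilon> f \<longleftrightarrow> z = w" using *(1) unfolding seq_def by simp
  then obtain w where "\<forall>z. pair i z \<epsilon> f \<longleftrightarrow> z = w" ..
  then show "y = z" using * by simp
qed

lemma sat_numv: "x \<noteq> y \<Longrightarrow> sat t e (numv k x y) \<longleftrightarrow> e x = nm k"
  by (induction k arbitrary: e) (auto simp: fun_upd_apply eq_emp)

lemma sat_num [simp]: "sat t e (num_fm k u) \<longleftrightarrow> val t e u = nm k"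
  by (auto simp: num_fm_def Let_def sat_numv)

lemma sat_one_of [simp]: "sat t e (one_of_fm ks u) \<longleftrightarrow> val t e u \<in> nm ` set ks"
  by (auto simp: one_of_fm_def)

lemma sat_add [simp]: "sat t e (add_fm d k m) \<longleftrightarrow> val t e m = (suc ^^ d) (val t e k)"
  by (induction d arbitrary: e m) auto

lemma sat_entry [simp]: "sat t e (entry_fm f n y) \<longleftrightarrow> pair (nm n) (val t e y) \<epsilon> val t e f"
  by (simp add: entry_fm_def)

lemma sat_length [simp]: "sat t e (length_fm f n) \<longleftrightarrow> seq (val t e f) (nm n)"
  by (simp add: length_fm_def)

definition "tri a q h = pair a (pair q h)"

lemma tri_eq [simp]: "tri a q h = tri a' q' h' \<longleftrightarrow> a = a' \<and> q = q' \<and> h = h'"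
  by (simp add: tri_def)

abbreviation "tab t i j v \<equiv> pair (pair i j) v \<epsilon> t"
abbreviation "ntri a q h \<equiv> tri (nm (sym_num a)) (nm q) (nm h)"

lemma sat_triple [simp]:
  "sat t e (triple_fm a q h v) \<longleftrightarrow> val t e v = tri (val t e a) (val t e q) (val t e h)"
  by (simp add: triple_fm_def tri_def)

lemma sat_tab [simp]:
  "sat t e (tab_fm f i j v) \<longleftrightarrow> tab (val t e f) (val t e i) (val t e j) (val t e v)"
  by (simp add: tab_fm_def)

lemma sat_cell [simp]:
  "sat t e (cell_fm f i j a q h) \<longleftrightarrow>
   tab (val t e f) (val t e i) (val t e j) (tri (val t e a) (val t e q) (val t e h))"
  by (simp add: cell_fm_def)

lemma sat_ncell [simp]:
  "sat t e (ncell_fm f i j a q h) \<longleftrightarrow> tab (val t e f) (val t e i) (val t e j) (ntri a q h)"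
  by (simp add: ncell_fm_def multi_quantifiers)

fun mv :: "move \<Rightarrow> 'a \<Rightarrow> 'a \<Rightarrow> bool" where
  "mv Lft j j' \<longleftrightarrow> j = suc j' \<or> j = emp \<and> j' = emp"
| "mv Stay j j' \<longleftrightarrow> j' = j"
| "mv Rgt j j' \<longleftrightarrow> j' = suc j"

lemma sat_move [simp]: "sat t e (move_fm d j j') \<longleftrightarrow> mv d (val t e j) (val t e j')"
  by (cases d) auto

lemma sat_init_cell [simp]:
  "sat t e (init_cell_fm M f j a h) \<longleftrightarrow> tab (val t e f) emp (val t e j) (ntri a (init M) h)"
  by (simp add: init_cell_fm_def)

definition "blank M t l \<longleftrightarrow> (\<forall>j. j \<epsilon> om \<and> l \<epsilon> j \<longrightarrow> tab t emp j (ntri Blank (init M) 0))"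

lemma sat_blank [simp]: "sat t e (blank_fm M f l) \<longleftrightarrow> blank M (val t e f) (val t e l)"
  by (simp add: blank_fm_def blank_def)

definition "binary s l \<longleftrightarrow> seq s l \<and> (\<forall>k y. pair k y \<epsilon> s \<longrightarrow> y = nm 0 \<or> y = nm 1)"

lemma sat_binary [simp]: "sat t e (binary_fm s l) \<longleftrightarrow> binary (val t e s) (val t e l)"
  by (simp add: binary_fm_def binary_def multi_quantifiers del: nm.simps One_nat_def)

section \<open>Codes of formulas in a model\<close>

primrec ct :: "tm \<Rightarrow> 'a" where
  "ct (Var n) = pair (nm 0) (nm n)"
| "ct Ct = pair (nm 1) (nm 0)"

definition "kneg x = pair (nm 2) x"
definition "kimp x y = pair (nm 3) (pair x y)"
definition "kall v x = pair (nm 4) (pair v x)"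
definition "kand x y = kneg (kimp x (kneg y))"
definition "kex v x = kneg (kall v (kneg x))"

text \<open>Codes of formulas of the metatheory only. If \<open>om\<close> has nonstandard elements,
  other objects also pass for codes in the model, so the inversion lemmas below start from some
  \<open>cd a\<close>.\<close>

primrec cd :: "fm \<Rightarrow> 'a" where
  "cd (Eq s t) = pair (nm 0) (pair (ct s) (ct t))"
| "cd (Mem s t) = pair (nm 1) (pair (ct s) (ct t))"
| "cd (Neg a) = kneg (cd a)"
| "cd (Imp a b) = kimp (cd a) (cd b)"
| "cd (All n a) = kall (nm n) (cd a)"

lemma ct_eq [simp]: "ct s = ct t \<longleftrightarrow> s = t"
  by (cases s; cases t) (simp_all del: nm.simps One_nat_def)

lemma cd_eq [simp]: "cd a = cd b \<longleftrightarrow> a = b"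
proof (induction a arbitrary: b)
  case (Eq s t)
  then show ?case
    by (cases b) (simp_all add: kneg_def kimp_def kall_def del: nm.simps One_nat_def)
next
  case (Mem s t)
  then show ?case
    by (cases b) (simp_all add: kneg_def kimp_def kall_def del: nm.simps One_nat_def)
next
  case (Neg a)
  then show ?case
    by (cases b) (simp_all add: kneg_def kimp_def kall_def del: nm.simps One_nat_def)
next
  case (Imp a1 a2)
  then show ?case
    by (cases b) (simp_all add: kneg_def kimp_def kall_def del: nm.simps One_nat_def)
next
  case (All n a)
  then show ?case
    by (cases b) (simp_all add: kneg_def kimp_def kall_def del: nm.simps One_nat_def)
qed

lemma cd_kneg: "cd a = kneg x \<Longrightarrow> \<exists>b. a = Neg b \<and> x = cd b"
  by (cases a) (simp_all add: kneg_def kimp_def kall_def del: nm.simps One_nat_def)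

lemma cd_kimp: "cd a = kimp x y \<Longrightarrow> \<exists>b c. a = Imp b c \<and> x = cd b \<and> y = cd c"
  by (cases a) (simp_all add: kneg_def kimp_def kall_def del: nm.simps One_nat_def)

lemma cd_kall: "cd a = kall v x \<Longrightarrow> \<exists>n b. a = All n b \<and> v = nm n \<and> x = cd b"
  by (cases a) (simp_all add: kneg_def kimp_def kall_def del: nm.simps One_nat_def)

lemma cd_kand: "cd a = kand x y \<Longrightarrow> \<exists>b c. a = And b c \<and> x = cd b \<and> y = cd c"
  unfolding kand_def And_def by (drule cd_kneg, elim exE conjE, drule sym, drule cd_kimp, elim exE conjE,
      drule sym[of "kneg y"], drule cd_kneg, elim exE conjE) simp

lemma cd_kex: "cd a = kex (nm n) x \<Longrightarrow> \<exists>b. a = Ex n b \<and> x = cd b"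
  unfolding kex_def Ex_def by (drule cd_kneg, elim exE conjE, drule sym, drule cd_kall, elim exE conjE,
      drule sym[of "kneg x"], drule cd_kneg, elim exE conjE) simp

lemma sat_tag [simp]: "sat t e (tag_fm k a c) \<longleftrightarrow> val t e c = pair (nm k) (val t e a)"
  by (simp add: tag_fm_def)

lemma sat_tag2 [simp]:
  "sat t e (tag2_fm k a b c) \<longleftrightarrow> val t e c = pair (nm k) (pair (val t e a) (val t e b))"
  by (simp add: tag2_fm_def)

lemma sat_code_tm [simp]: "sat t e (code_tm s c) \<longleftrightarrow> val t e c = ct s"
  by (cases s) (simp_all add: cVar_def cCt_def del: nm.simps)

lemmas k_defs = cEq_def cMem_def cNeg_def cImp_def cAll_def kneg_def kimp_def kall_def

lemma sat_code [simp]: "sat t e (code_fm a c) \<longleftrightarrow> val t e c = cd a"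
  by (induction a arbitrary: e c) (simp_all add: multi_quantifiers k_defs del: nm.simps)

text \<open>On codes, the context that turns \<open>numv k 0 1\<close> into
  \<open>numv (Suc k) 0 1\<close>.\<close>

definition "succ_code a = kex (nm 1) (kand (cd (succ_fm (Var 1) (Var 0)))
  (kex (nm 0) (kand (cd (Eq (Var 0) (Var 1))) a)))"

definition "num_code k c \<longleftrightarrow> (\<exists>f. seq f (suc k) \<and> pair k c \<epsilon> f \<and>
  (\<forall>i y. i \<epsilon> suc k \<and> pair i y \<epsilon> f \<longrightarrow> i = emp \<and> y = cd (numv 0 0 1) \<or>
     (\<exists>j a. i = suc j \<and> pair j a \<epsilon> f \<and> y = succ_code a)))"

text \<open>Admits the schemes without term metavariables, which are those describing the input
  formulas. For them \<open>scheme_fm\<close> determines the code as a function of its arguments,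
  namely \<open>scheme_code\<close>; the value \<open>emp\<close> there is a dummy for the excluded
  cases.\<close>

fun scheme_ok :: "nat \<Rightarrow> nat \<Rightarrow> scheme \<Rightarrow> bool" where
  "scheme_ok m n (FH k) \<longleftrightarrow> k < m"
| "scheme_ok m n (PFm a) \<longleftrightarrow> True"
| "scheme_ok m n (PNeg p) \<longleftrightarrow> scheme_ok m n p"
| "scheme_ok m n (PImp p q) \<longleftrightarrow> scheme_ok m n p \<and> scheme_ok m n q"
| "scheme_ok m n (PAll k p) \<longleftrightarrow> k < n \<and> scheme_ok m n p"
| "scheme_ok m n _ \<longleftrightarrow> False"

fun scheme_code :: "'a list \<Rightarrow> 'a list \<Rightarrow> scheme \<Rightarrow> 'a" where
  "scheme_code fs vs (FH k) = fs ! k"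
| "scheme_code fs vs (PFm a) = cd a"
| "scheme_code fs vs (PNeg p) = kneg (scheme_code fs vs p)"
| "scheme_code fs vs (PImp p q) = kimp (scheme_code fs vs p) (scheme_code fs vs q)"
| "scheme_code fs vs (PAll k p) = kall (vs ! k) (scheme_code fs vs p)"
| "scheme_code fs vs _ = emp"

lemma map_val_fresh [simp]:
  "set us \<subseteq> set ps \<Longrightarrow> map (val t (e(fresh ps := d))) us = map (val t e) us"
  by (simp add: subset_iff)

lemma sat_scheme:
  "scheme_ok (length Fs) (length Vs) p \<Longrightarrow> sat t e (scheme_fm Fs Vs Ts p c) \<longleftrightarrow>
     val t e c = scheme_code (map (val t e) Fs) (map (val t e) Vs) p"
proof (induction p arbitrary: e c)
  case (PNeg p)
  then show ?case by (simp add: le_supI1 subsetI k_defs del: nm.simps)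
next
  case (PImp p q)
  then show ?case by (simp add: multi_quantifiers subsetI k_defs del: nm.simps)
next
  case (PAll k p)
  then have "Vs ! k \<in> set Vs" by simp
  then show ?case using PAll by (simp add: subsetI k_defs del: nm.simps)
qed (simp_all del: nm.simps)

lemma scheme_code_PAnd: "scheme_code fs vs (PAnd p q) = kand (scheme_code fs vs p) (scheme_code fs vs q)"
  by (simp add: PAnd_def kand_def)

lemma scheme_code_PEx: "scheme_code fs vs (PEx k p) = kex (vs ! k) (scheme_code fs vs p)"
  by (simp add: PEx_def kex_def)

lemma scheme_ok_PAnd: "scheme_ok m n (PAnd p q) \<longleftrightarrow> scheme_ok m n p \<and> scheme_ok m n q"
  by (simp add: PAnd_def)

lemma scheme_ok_PEx: "scheme_ok m n (PEx k p) \<longleftrightarrow> k < n \<and> scheme_ok m n p"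
  by (simp add: PEx_def)

lemmas scheme_simps = sat_scheme scheme_code_PAnd scheme_code_PEx scheme_ok_PAnd scheme_ok_PEx

lemma sat_num_code_step:
  "sat t e (ex4 [m, f, i, y] (\<lambda>j a x0 x1. Conj
     [succ_fm j i, app_fm f j a, num_fm 0 x0, num_fm 1 x1,
      scheme_fm [a] [x0, x1] []
        (PEx 1 (PAnd (PFm (succ_fm (Var 1) (Var 0)))
           (PEx 0 (PAnd (PFm (Eq (Var 0) (Var 1))) (FH 0))))) y])) \<longleftrightarrow>
   (\<exists>j a. val t e i = suc j \<and> pair j a \<epsilon> val t e f \<and> val t e y = succ_code a)"
  by (simp add: multi_quantifiers scheme_simps succ_code_def del: nm.simps cd.simps)

lemma sat_num_code [simp]: "sat t e (num_code_fm k c) \<longleftrightarrow> num_code (val t e k) (val t e c)"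
  unfolding num_code_fm_def num_code_def
  by (simp add: multi_quantifiers(1,3) sat_num_code_step
      del: nm.simps cd.simps mem_suc numv.simps One_nat_def)

text \<open>A priori \<open>k\<close> may be nonstandard, with a sequence of nonstandard length
  behind the code. But each step backwards strips one layer from the actual formula
  \<open>a\<close>, so an induction on its height in the metatheory reaches the base case after
  finitely many steps and exhibits \<open>k\<close> as a standard numeral.\<close>

lemma num_code_decode:
  assumes "num_code k (cd a)"
  shows "\<exists>j. a = numv j 0 1 \<and> k = nm j"
proof -
  obtain f where f: "seq f (suc k)" "pair k (cd a) \<epsilon> f" and
    step: "\<forall>i y. i \<epsilon> suc k \<and> pair i y \<epsilon> f \<longrightarrow> i = emp \<and> y = cd (numv 0 0 1) \<or>
     (\<exists>j a. i = suc j \<and> pair j a \<epsilon> f \<and> y = succ_code a)"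
    using assms unfolding num_code_def by (elim exE conjE)
  have "pair i (cd a) \<epsilon> f \<Longrightarrow> \<exists>j. a = numv j 0 1 \<and> i = nm j" for i a
  proof (induction "height a" arbitrary: a i rule: less_induct)
    case less
    have "i \<epsilon> suc k" using seq_dom[OF f(1) less.prems] .
    then have "i = emp \<and> cd a = cd (numv 0 0 1) \<or>
      (\<exists>j b. i = suc j \<and> pair j b \<epsilon> f \<and> cd a = succ_code b)"
      using step less.prems by simp
    then show ?case
    proof
      assume "i = emp \<and> cd a = cd (numv 0 0 1)"
      then show ?thesis by (intro exI[of _ 0]) (simp del: numv.simps)
    next
      assume "\<exists>j b. i = suc j \<and> pair j b \<epsilon> f \<and> cd a = succ_code b"
      then obtain j b where j: "i = suc j" "pair j b \<epsilon> f" "cd a = succ_code b" by (elim exE conjE)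
      \<comment> \<open>Four inversions peel off the two existential quantifiers and the two
        conjunctions of the context, until \<open>a6\<close> is the formula coded by
        \<open>b\<close>.\<close>
      from cd_kex[OF j(3)[unfolded succ_code_def]] obtain a1 where a1: "a = Ex 1 a1"
        "kand (cd (succ_fm (Var 1) (Var 0))) (kex (nm 0) (kand (cd (Eq (Var 0) (Var 1))) b)) = cd a1"
        by (elim exE conjE)
      from cd_kand[OF a1(2)[symmetric]] obtain a2 a3 where a2: "a1 = And a2 a3"
        "a2 = succ_fm (Var 1) (Var 0)" "kex (nm 0) (kand (cd (Eq (Var 0) (Var 1))) b) = cd a3"
        by (simp del: cd.simps) metis
      from cd_kex[OF a2(3)[symmetric]] obtain a4 where a4: "a3 = Ex 0 a4"
        "kand (cd (Eq (Var 0) (Var 1))) b = cd a4" by (elim exE conjE)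
      from cd_kand[OF a4(2)[symmetric]] obtain a5 a6 where a6: "a4 = And a5 a6"
        "a5 = Eq (Var 0) (Var 1)" "b = cd a6"
        by (simp del: cd.simps) metis
      have a: "a = Ex 1 (And (succ_fm (Var 1) (Var 0)) (Ex 0 (And (Eq (Var 0) (Var 1)) a6)))"
        using a1 a2 a4 a6 by simp
      then have "height a6 < height a" by (simp add: Ex_def And_def)
      from less.hyps[OF this] j(2) a6(3) obtain m where "a6 = numv m 0 1" "j = nm m" by auto
      then show ?thesis using a j(1) by (intro exI[of _ "Suc m"]) simp
    qed
  qed
  then show ?thesis using f(2) by simp
qed

definition "with_code k a c \<longleftrightarrow> (\<exists>d. num_code k d \<and> c = kex (nm 0) (kand d (cd a)))"

lemma sat_with_num_code [simp]:
  "sat t e (with_num_code_fm k a c) \<longleftrightarrow> with_code (val t e k) a (val t e c)"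
  by (simp add: with_num_code_fm_def with_code_def multi_quantifiers scheme_simps del: nm.simps)

text \<open>Through this, a length or position mentioned by an actual formula in the theory of
  \<open>s\<close> turns out to be standard, even if \<open>s\<close> is not.\<close>

lemma with_code_decode:
  assumes "with_code k a (cd b)"
  shows "\<exists>j. b = with_num j a \<and> k = nm j"
proof -
  obtain d where d: "num_code k d" "cd b = kex (nm 0) (kand d (cd a))"
    using assms unfolding with_code_def by (elim exE conjE)
  from cd_kex[OF d(2)] obtain b1 where b1: "b = Ex 0 b1" "kand d (cd a) = cd b1" by (elim exE conjE)
  from cd_kand[OF b1(2)[symmetric]] obtain b2 where b2: "b1 = And b2 a" "d = cd b2" by auto
  from num_code_decode[of k b2] d(1) b2(2) obtain j where "b2 = numv j 0 1" "k = nm j" by auto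
  then show ?thesis using b1 b2 by (intro exI[of _ j]) (simp add: with_num_def)
qed

lemma sat_with_num [simp]:
  "sat t e (with_num k a) \<longleftrightarrow> sat t (e(0 := nm k)) a"
  by (auto simp: with_num_def sat_numv)

lemma sat_bool_val: "sat t e (bool_val_fm a v) \<Longrightarrow> val t e v = nm 1 \<Longrightarrow> sat t e a"
  by (auto simp: bool_val_fm_def simp del: nm.simps)

definition "input_code M s U D k \<longleftrightarrow>
  (\<exists>y a. pair ((suc ^^ (D + 2)) k) y \<epsilon> U \<and> pair k a \<epsilon> s \<and>
      (a = nm 0 \<and> with_code (suc k) (init_cell_fm M Ct (Var 0) Zero 0) y \<or>
       a = nm 1 \<and> with_code (suc k) (init_cell_fm M Ct (Var 0) One 0) y))"

lemma sat_input_code: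
  "sat t e (ex4 [s, U, l, k] (\<lambda>i y k' a. Conj
     [add_fm (D + 2) k i, app_fm U i y, succ_fm k k', app_fm s k a,
      Or (And (num_fm 0 a) (with_num_code_fm k' (init_cell_fm M Ct (Var 0) Zero 0) y))
         (And (num_fm 1 a) (with_num_code_fm k' (init_cell_fm M Ct (Var 0) One 0) y))])) \<longleftrightarrow>
   input_code M (val t e s) (val t e U) D (val t e k)"
  unfolding input_code_def
  by (simp add: multi_quantifiers del: nm.simps funpow.simps One_nat_def add_2_eq_Suc' cd.simps)

definition "thy M s U l \<longleftrightarrow> (let D = length (def_fms M Ct) in
    binary s l \<and> seq U ((suc ^^ (D + 2)) l) \<and>
    (\<forall>i < D. pair (nm i) (cd (def_fms M Ct ! i)) \<epsilon> U) \<and>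
    (\<exists>y. pair (nm D) y \<epsilon> U \<and> with_code l (blank_fm M Ct (Var 0)) y) \<and>
    pair (nm (D + 1)) (cd (with_num 0 (init_cell_fm M Ct (Var 0) Start 1))) \<epsilon> U \<and>
    (\<forall>k. k \<epsilon> l \<longrightarrow> input_code M s U D k))"

lemma sat_Thy [simp]:
  "sat t e (Thy_fm M s U) \<longleftrightarrow> (\<exists>l. thy M (val t e s) (val t e U) l)"
  unfolding Thy_fm_def thy_def Let_def
  by (simp add: multi_quantifiers(3) sat_input_code
      del: nm.simps funpow.simps One_nat_def add_2_eq_Suc' cd.simps add_fm.simps) auto

section \<open>Existence of the computation table in a model\<close>

definition "halt_ok (M :: turing) t a \<longleftrightarrow> (\<forall>i j. tab t i j (ntri a (halt M) 1) \<longrightarrow>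
  (\<forall>k v. tab t i k v \<longrightarrow> tab t (suc i) k v))"

definition "trans_ok (M :: turing) t q a \<longleftrightarrow> (case delta M q a of (q', a', d) \<Rightarrow>
  \<forall>i j. tab t i j (ntri a q 1) \<longrightarrow> (\<forall>j' k b p h. mv d j j' \<longrightarrow> tab t i k (tri b p h) \<longrightarrow>
    tab t (suc i) k (tri (if k = j then nm (sym_num a') else b) (nm q')
      (if k = j' then nm 1 else nm 0))))"

definition "rules_ok (M :: turing) t \<longleftrightarrow>
  (\<forall>a. halt_ok M t a) \<and> (\<forall>q \<in> states M - {halt M}. \<forall>a. trans_ok M t q a)"

definition "value_ok (M :: turing) v \<longleftrightarrow> (\<exists>a q h. v = tri a q h \<and> a \<in> nm ` {0, 1, 2, 3} \<and>
  q \<in> nm ` states M \<and> h \<in> nm ` {0, 1})"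

definition "total_ok (M :: turing) t \<longleftrightarrow>
  (\<forall>x. x \<epsilon> t \<longrightarrow> (\<exists>i j v. i \<epsilon> om \<and> j \<epsilon> om \<and> value_ok M v \<and> x = pair (pair i j) v)) \<and>
  (\<forall>i j. i \<epsilon> om \<and> j \<epsilon> om \<longrightarrow> (\<exists>v. \<forall>w. tab t i j w \<longleftrightarrow> w = v))"

lemma sat_halt: "sat t e (halt_fm M f a) \<longleftrightarrow> halt_ok M (val t e f) a"
  unfolding halt_fm_def halt_ok_def
  by (simp add: multi_quantifiers(1,2) del: nm.simps One_nat_def)

text \<open>The nested terms \<open>fresh ps\<close> grow exponentially with the number of quantifiers, so that long
  quantifier prefixes are evaluated blockwise, with variables for the terms.\<close>

lemma sat_trans_result:
  "sat t e (ex3 [f, i, j, i', j', k, b, p, h] (\<lambda>c r g. Conj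
     [Or (And (Eq k j) (num_fm n c)) (And (Neg (Eq k j)) (Eq c b)),
      num_fm q' r,
      Or (And (Eq k j') (num_fm 1 g)) (And (Neg (Eq k j')) (num_fm 0 g)),
      cell_fm f i' k c r g])) \<longleftrightarrow>
   tab (val t e f) (val t e i') (val t e k)
     (tri (if val t e k = val t e j then nm n else val t e b) (nm q')
       (if val t e k = val t e j' then nm 1 else nm 0))"
  by (simp add: multi_quantifiers del: nm.simps One_nat_def)

lemma sat_trans_cell:
  "sat t e (all3 [f, i, j, i', j', k] (\<lambda>b p h.
     Imp (Conj [succ_fm i i', move_fm d j j', cell_fm f i k b p h])
       (ex3 [f, i, j, i', j', k, b, p, h] (\<lambda>c r g. Conj
         [Or (And (Eq k j) (num_fm n c)) (And (Neg (Eq k j)) (Eq c b)),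
          num_fm q' r,
          Or (And (Eq k j') (num_fm 1 g)) (And (Neg (Eq k j')) (num_fm 0 g)),
          cell_fm f i' k c r g])))) \<longleftrightarrow>
   (\<forall>b p h. val t e i' = suc (val t e i) \<and> mv d (val t e j) (val t e j') \<and>
      tab (val t e f) (val t e i) (val t e k) (tri b p h) \<longrightarrow>
      tab (val t e f) (val t e i') (val t e k)
        (tri (if val t e k = val t e j then nm n else b) (nm q')
          (if val t e k = val t e j' then nm 1 else nm 0)))"
  by (simp add: multi_quantifiers(1,2) sat_trans_result split del: if_split cong: if_cong
      del: nm.simps One_nat_def)

lemma sat_trans_row:
  "sat t e (all3 [f, i, j] (\<lambda>i' j' k. all3 [f, i, j, i', j', k] (\<lambda>b p h.
     Imp (Conj [succ_fm i i', move_fm d j j', cell_fm f i k b p h])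
       (ex3 [f, i, j, i', j', k, b, p, h] (\<lambda>c r g. Conj
         [Or (And (Eq k j) (num_fm n c)) (And (Neg (Eq k j)) (Eq c b)),
          num_fm q' r,
          Or (And (Eq k j') (num_fm 1 g)) (And (Neg (Eq k j')) (num_fm 0 g)),
          cell_fm f i' k c r g]))))) \<longleftrightarrow>
   (\<forall>j' k b p h. mv d (val t e j) j' \<longrightarrow> tab (val t e f) (val t e i) k (tri b p h) \<longrightarrow>
      tab (val t e f) (suc (val t e i)) k
        (tri (if k = val t e j then nm n else b) (nm q') (if k = j' then nm 1 else nm 0)))"
  by (simp add: all3_def[of "[f, i, j]"] all2_def sat_trans_cell split del: if_split cong: if_cong
      del: nm.simps One_nat_def) blast

lemma sat_trans: "sat t e (trans_fm M f q a) \<longleftrightarrow> trans_ok M (val t e f) q a"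
proof -
  obtain q' a' d where delta: "delta M q a = (q', a', d)" by (cases "delta M q a")
  show ?thesis
    unfolding trans_fm_def trans_ok_def delta prod.case
    by (simp add: all2_def[of "[f]"] sat_trans_row split del: if_split cong: if_cong del: nm.simps One_nat_def)
qed

lemma sat_value [simp]:
  assumes "finite (states M)"
  shows "sat t e (value_fm M v) \<longleftrightarrow> value_ok M (val t e v)"
  using assms by (simp add: value_fm_def value_ok_def multi_quantifiers del: nm.simps One_nat_def)

lemma set_syms: "set [Zero, One, Blank, Start] = UNIV"
proof -
  have "x \<in> set [Zero, One, Blank, Start]" for x by (cases x) auto
  then show ?thesis by blast
qed

lemma UNIV_sym: "UNIV = {Zero, One, Blank, Start}"
  using set_syms by simp

lemma finite_sym: "finite (UNIV :: sym set)"
  by (metis set_syms List.finite_set)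

definition "rule_fms (M :: turing) f = map (halt_fm M f) [Zero, One, Blank, Start] @
   concat (map (\<lambda>q. map (trans_fm M f q) [Zero, One, Blank, Start])
     (sorted_list_of_set (states M - {halt M})))"

lemma sat_rule_fms:
  assumes "finite (states M)"
  shows "(\<forall>a \<in> set (rule_fms M f). sat t e a) \<longleftrightarrow> rules_ok M (val t e f)"
proof -
  have *: "set (rule_fms M f) = range (halt_fm M f) \<union> (\<Union>q \<in> states M - {halt M}. range (trans_fm M f q))"
    using assms by (simp add: rule_fms_def UNIV_sym)
  show ?thesis unfolding * by (simp add: ball_Un rules_ok_def sat_halt sat_trans)
qed

lemma sat_def_fms:
  assumes "finite (states M)"
  shows "(\<forall>a \<in> set (def_fms M f). sat t e a) \<longleftrightarrow> total_ok M (val t e f) \<and> rules_ok M (val t e f)"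
proof -
  define A where "A = all [f] (\<lambda>e. Imp (Mem e f) (ex4 [f, e] (\<lambda>i j v p. Conj
      [nat_fm i, nat_fm j, value_fm M v, pair_fm i j p, pair_fm p v e])))"
  define B where
    "B = all2 [f] (\<lambda>i j. Imp (And (nat_fm i) (nat_fm j)) (ex1 [f, i, j] (\<lambda>v. tab_fm f i j v)))"
  have *: "def_fms M f = [A, B] @ rule_fms M f"
    by (simp add: def_fms_def rule_fms_def A_def B_def)
  have "sat t e A \<and> sat t e B \<longleftrightarrow> total_ok M (val t e f)"
    unfolding total_ok_def A_def B_def using assms by (simp add: multi_quantifiers)
  then show ?thesis using sat_rule_fms[OF assms, of f t e] unfolding * by auto
qed

definition "start (M :: turing) s l t \<longleftrightarrow> blank M t l \<and> tab t emp emp (ntri Start (init M) 1) \<and>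
  (\<forall>k a. k \<epsilon> l \<and> pair k a \<epsilon> s \<longrightarrow> a = nm 0 \<and> tab t emp (suc k) (ntri Zero (init M) 0) \<or>
     a = nm 1 \<and> tab t emp (suc k) (ntri One (init M) 0))"

lemma sat_table:
  assumes "finite (states M)"
  shows "sat t e (table_fm M s f) \<longleftrightarrow> total_ok M (val t e f) \<and> rules_ok M (val t e f) \<and>
    (\<exists>l. binary (val t e s) l \<and> start M (val t e s) l (val t e f))"
  unfolding table_fm_def ev_connectives ev_Conj sat_def_fms[OF assms] start_def
  by (simp add: multi_quantifiers(1,2) del: nm.simps(2) One_nat_def)

text \<open>Definability is read off from the formulas, because \<open>rules_ok\<close> itself
  quantifies over states and symbols of the metatheory.\<close>

lemma Dfn_rules_ok:
  assumes "finite (states M)"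
  shows "Dfn E (\<lambda>e. rules_ok M (e 0))"
proof -
  have "sat c0 e (Conj (rule_fms M (Var 0))) = rules_ok M (e 0)" for e
    by (simp add: sat_rule_fms[OF assms])
  then show ?thesis using Dfn_ev[of E c0 "Conj (rule_fms M (Var 0))"] by simp
qed

lemma Dfn_start: "Dfn E (\<lambda>e. start M s l (e 0))"
  unfolding start_def blank_def by (intro dfns)

text \<open>The table is the least relation that contains the initial cells and is closed under the
  transitions.\<close>

definition "closed_ok (M :: turing) s l R \<longleftrightarrow> start M s l R \<and> rules_ok M R"

definition "start_cell (M :: turing) s l i k v \<longleftrightarrow> i = emp \<and>
  (k = emp \<and> v = ntri Start (init M) 1 \<or>
   (\<exists>m. m \<epsilon> l \<and> k = suc m \<and> (pair m (nm 0) \<epsilon> s \<and> v = ntri Zero (init M) 0 \<or>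
      pair m (nm 1) \<epsilon> s \<and> v = ntri One (init M) 0)) \<or>
   k \<epsilon> om \<and> l \<epsilon> k \<and> v = ntri Blank (init M) 0)"

definition "halt_step (M :: turing) t i k v \<longleftrightarrow> (\<exists>a j. tab t i j (ntri a (halt M) 1) \<and> tab t i k v)"

definition "trans_step (M :: turing) t i k v \<longleftrightarrow> (\<exists>q \<in> states M - {halt M}. \<exists>a q' a' d j j' b p h.
  delta M q a = (q', a', d) \<and> tab t i j (ntri a q 1) \<and> mv d j j' \<and> tab t i k (tri b p h) \<and>
  v = tri (if k = j then nm (sym_num a') else b) (nm q') (if k = j' then nm 1 else nm 0))"

text \<open>In this form the rules only demand further cells, monotonically in the table. So the
  intersection of closed tables is closed, and a cell that nothing demands can be removed.\<close>

lemma rules_ok_iff: "rules_ok M t \<longleftrightarrow>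
  (\<forall>i k v. halt_step M t i k v \<or> trans_step M t i k v \<longrightarrow> tab t (suc i) k v)"
proof
  assume r: "rules_ok M t"
  show "\<forall>i k v. halt_step M t i k v \<or> trans_step M t i k v \<longrightarrow> tab t (suc i) k v"
  proof (intro allI impI)
    fix i k v assume "halt_step M t i k v \<or> trans_step M t i k v"
    then show "tab t (suc i) k v"
    proof
      assume "halt_step M t i k v"
      then show ?thesis using r unfolding rules_ok_def halt_step_def halt_ok_def by metis
    next
      assume "trans_step M t i k v"
      then obtain q a q' a' d j j' b p h where s: "q \<in> states M - {halt M}"
        "delta M q a = (q', a', d)" "tab t i j (ntri a q 1)" "mv d j j'" "tab t i k (tri b p h)"
        "v = tri (if k = j then nm (sym_num a') else b) (nm q') (if k = j' then nm 1 else nm 0)"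
        unfolding trans_step_def by (elim bexE exE conjE)
      have "trans_ok M t q a" using r s(1) unfolding rules_ok_def by simp
      from this[unfolded trans_ok_def s(2) prod.case, rule_format, OF s(3,4,5)]
      show ?thesis unfolding s(6) .
    qed
  qed
next
  assume r: "\<forall>i k v. halt_step M t i k v \<or> trans_step M t i k v \<longrightarrow> tab t (suc i) k v"
  have "halt_ok M t a" for a using r unfolding halt_ok_def halt_step_def by metis
  moreover have "trans_ok M t q a" if q: "q \<in> states M - {halt M}" for q a
  proof -
    obtain q' a' d where delta: "delta M q a = (q', a', d)" by (cases "delta M q a")
    have "trans_step M t i k (tri (if k = j then nm (sym_num a') else b) (nm q')
        (if k = j' then nm 1 else nm 0))"
      if "tab t i j (ntri a q 1)" "mv d j j'" "tab t i k (tri b p h)" for i j j' k b p h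
      unfolding trans_step_def by (intro bexI[OF _ q] exI conjI, rule delta) (use that in simp_all)
    then show ?thesis using r unfolding trans_ok_def delta prod.case by blast
  qed
  ultimately show "rules_ok M t" unfolding rules_ok_def by blast
qed

lemma start_iff:
  assumes "binary s l"
  shows "start M s l t \<longleftrightarrow> (\<forall>i k v. start_cell M s l i k v \<longrightarrow> tab t i k v)"
proof
  assume st: "start M s l t"
  show "\<forall>i k v. start_cell M s l i k v \<longrightarrow> tab t i k v"
  proof (intro allI impI)
    fix i k v assume "start_cell M s l i k v"
    then have i: "i = emp" and "k = emp \<and> v = ntri Start (init M) 1 \<or>
      (\<exists>m. m \<epsilon> l \<and> k = suc m \<and> (pair m (nm 0) \<epsilon> s \<and> v = ntri Zero (init M) 0 \<or>
         pair m (nm 1) \<epsilon> s \<and> v = ntri One (init M) 0)) \<or>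
      k \<epsilon> om \<and> l \<epsilon> k \<and> v = ntri Blank (init M) 0"
      unfolding start_cell_def by blast+
    then consider "k = emp" "v = ntri Start (init M) 1"
      | m where "m \<epsilon> l" "k = suc m" "pair m (nm 0) \<epsilon> s" "v = ntri Zero (init M) 0"
      | m where "m \<epsilon> l" "k = suc m" "pair m (nm 1) \<epsilon> s" "v = ntri One (init M) 0"
      | "k \<epsilon> om" "l \<epsilon> k" "v = ntri Blank (init M) 0" by blast
    then show "tab t i k v"
    proof cases
      case 1
      then show ?thesis using st i unfolding start_def by blast
    next
      case (2 m)
      then have "nm 0 = nm 0 \<and> tab t emp (suc m) (ntri Zero (init M) 0) \<or>
        nm 0 = nm 1 \<and> tab t emp (suc m) (ntri One (init M) 0)"
        using st unfolding start_def by blast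
      then show ?thesis using 2 i by (simp del: nm.simps)
    next
      case (3 m)
      then have "nm 1 = nm 0 \<and> tab t emp (suc m) (ntri Zero (init M) 0) \<or>
        nm 1 = nm 1 \<and> tab t emp (suc m) (ntri One (init M) 0)"
        using st unfolding start_def by blast
      then show ?thesis using 3 i by (simp del: nm.simps)
    next
      case 4
      then show ?thesis using st i unfolding start_def blank_def by blast
    qed
  qed
next
  assume r: "\<forall>i k v. start_cell M s l i k v \<longrightarrow> tab t i k v"
  have "a = nm 0 \<or> a = nm 1" if "pair k a \<epsilon> s" for k a
    using assms that unfolding binary_def by blast
  then show "start M s l t"
    using r unfolding start_def blank_def start_cell_def by blast
qed

lemma suc_le: "l \<epsilon> om \<Longrightarrow> k \<epsilon> l \<Longrightarrow> suc k \<epsilon> l \<or> suc k = l"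
proof -
  assume l: "l \<epsilon> om"
  have "\<forall>k. k \<epsilon> l \<longrightarrow> suc k \<epsilon> l \<or> suc k = l"
    by (rule om_induct[OF l, of "\<lambda>l. \<forall>k. k \<epsilon> l \<longrightarrow> suc k \<epsilon> l \<or> suc k = l"]) (intro dfns | auto)+
  then show "k \<epsilon> l \<Longrightarrow> suc k \<epsilon> l \<or> suc k = l" by simp
qed

lemma emp_least: "l \<epsilon> om \<Longrightarrow> l = emp \<or> emp \<epsilon> l"
  by (rule om_induct[of l "\<lambda>l. l = emp \<or> emp \<epsilon> l"]) (intro dfns | auto)+

text \<open>The alternatives match the three kinds of initial cells. Bit \<open>k\<close> sits at
  position \<open>suc k\<close> because position \<open>emp\<close> holds the start symbol.
  Positions may be nonstandard, hence the induction inside the model.\<close>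

lemma input_cases:
  assumes "l \<epsilon> om" "j \<epsilon> om"
  shows "j = emp \<or> (\<exists>k. k \<epsilon> l \<and> j = suc k) \<or> l \<epsilon> j"
proof (rule om_induct[OF assms(2), of "\<lambda>j. j = emp \<or> (\<exists>k. k \<epsilon> l \<and> j = suc k) \<or> l \<epsilon> j"])
  show "Dfn E (\<lambda>e. e 0 = emp \<or> (\<exists>k. k \<epsilon> l \<and> e 0 = suc k) \<or> l \<epsilon> e 0)" by (intro dfns)
  fix j assume "j = emp \<or> (\<exists>k. k \<epsilon> l \<and> j = suc k) \<or> l \<epsilon> j"
  then show "suc j = emp \<or> (\<exists>k. k \<epsilon> l \<and> suc j = suc k) \<or> l \<epsilon> suc j"
    using suc_le[OF assms(1)] emp_least[OF assms(1)] by auto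
qed simp

lemma mv_ex: "j \<epsilon> om \<Longrightarrow> \<exists>j'. j' \<epsilon> om \<and> mv d j j'"
  using om_cases[of j] suc_om by (cases d) auto

lemma mv_unique: "j \<epsilon> om \<Longrightarrow> mv d j j1 \<Longrightarrow> mv d j j2 \<Longrightarrow> j1 = j2"
proof (cases d)
  case Lft
  have "m \<epsilon> om" if "suc m \<epsilon> om" for m using om_mem[OF that] by simp
  moreover assume "j \<epsilon> om" "mv d j j1" "mv d j j2"
  ultimately show ?thesis using Lft suc_inj by auto
qed auto

lemma sym_num_eq [simp]: "sym_num a = sym_num b \<longleftrightarrow> a = b"
  by (cases a; cases b) auto

section \<open>The least closed table and the shape of its rows\<close>

context
  fixes M :: turing and s l :: 'a
  assumes M: "turing_machine M" and s: "binary s l"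
begin

lemma finite_states: "finite (states M)"
  using M by (simp add: turing_machine_def)

lemma l_om: "l \<epsilon> om"
  using s by (simp add: binary_def seq_def)

text \<open>The set from which the table is separated: it contains the initial cells and is
  preserved by steps. That entries lie in the finite set of admissible values is shown in
  \<open>tbl_total\<close>.\<close>

abbreviation "cells \<equiv> cart (cart om om) (cart om (cart om om))"

lemma tri_cart: "tri a q h \<epsilon> cart om (cart om om) \<longleftrightarrow> a \<epsilon> om \<and> q \<epsilon> om \<and> h \<epsilon> om"
  by (simp add: tri_def)

lemma least_ex: "\<exists>t. \<forall>x. x \<epsilon> t \<longleftrightarrow> x \<epsilon> cells \<and> (\<forall>R. closed_ok M s l R \<longrightarrow> x \<epsilon> R)"
proof (rule separation)
  show "Dfn E (\<lambda>e. \<forall>R. closed_ok M s l R \<longrightarrow> e 0 \<epsilon> R)"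
    unfolding closed_ok_def
    by (intro Dfn_all Dfn.imp Dfn_conj Dfn_start Dfn_rules_ok finite_states dfns)
qed

definition "tbl = (SOME t. \<forall>x. x \<epsilon> t \<longleftrightarrow> x \<epsilon> cells \<and> (\<forall>R. closed_ok M s l R \<longrightarrow> x \<epsilon> R))"

lemma mem_tbl: "x \<epsilon> tbl \<longleftrightarrow> x \<epsilon> cells \<and> (\<forall>R. closed_ok M s l R \<longrightarrow> x \<epsilon> R)"
  using someI_ex[OF least_ex] unfolding tbl_def by blast

lemma tbl_om: "tab tbl i j v \<Longrightarrow> i \<epsilon> om \<and> j \<epsilon> om"
  using mem_tbl by simp

lemma tbl_tri_om: "tab tbl i j (tri a q h) \<Longrightarrow> a \<epsilon> om"
  using mem_tbl tri_cart by simp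

lemma start_cell_cells: "start_cell M s l i k v \<Longrightarrow> tab cells i k v"
  unfolding start_cell_def using om_mem[OF l_om] suc_om by (auto simp: tri_cart simp del: nm.simps)

lemma tbl_start: "start_cell M s l i k v \<Longrightarrow> tab tbl i k v"
  using start_cell_cells unfolding mem_tbl closed_ok_def start_iff[OF s] by blast

lemma step_mono:
  assumes "\<And>x. x \<epsilon> t \<Longrightarrow> x \<epsilon> R"
  shows "halt_step M t i k v \<Longrightarrow> halt_step M R i k v" "trans_step M t i k v \<Longrightarrow> trans_step M R i k v"
proof -
  show "halt_step M t i k v \<Longrightarrow> halt_step M R i k v"
    using assms unfolding halt_step_def by blast
  assume "trans_step M t i k v"
  then obtain q a q' a' d j j' b p h where *: "q \<in> states M - {halt M}"
    "delta M q a = (q', a', d)" "tab t i j (ntri a q 1)" "mv d j j'" "tab t i k (tri b p h)"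
    "v = tri (if k = j then nm (sym_num a') else b) (nm q') (if k = j' then nm 1 else nm 0)"
    unfolding trans_step_def by (elim bexE exE conjE)
  show "trans_step M R i k v" unfolding trans_step_def
    by (intro bexI[OF _ *(1)] exI conjI, rule *(2)) (rule assms *(3) *(4) *(5) *(6))+
qed

lemma step_cells:
  assumes "halt_step M tbl i k v \<or> trans_step M tbl i k v"
  shows "tab cells (suc i) k v"
  using assms
proof
  assume "halt_step M tbl i k v"
  then have "tab tbl i k v" unfolding halt_step_def by blast
  then have "tab cells i k v" unfolding mem_tbl by blast
  then show ?thesis using suc_om by simp
next
  assume "trans_step M tbl i k v"
  then obtain q' a' j j' b p h where *: "tab tbl i k (tri b p h)"
    "v = tri (if k = j then nm (sym_num a') else b) (nm q') (if k = j' then nm 1 else nm 0)"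
    unfolding trans_step_def by (elim bexE exE conjE)
  then show ?thesis using tbl_om[OF *(1)] tbl_tri_om[OF *(1)] suc_om by (simp add: tri_cart del: nm.simps)
qed

lemma tbl_step:
  assumes "halt_step M tbl i k v \<or> trans_step M tbl i k v"
  shows "tab tbl (suc i) k v"
  unfolding mem_tbl
proof (intro conjI allI impI step_cells[OF assms])
  fix R assume R: "closed_ok M s l R"
  then have "x \<epsilon> tbl \<Longrightarrow> x \<epsilon> R" for x using mem_tbl by blast
  then have "halt_step M R i k v \<or> trans_step M R i k v" using assms step_mono[of tbl R] by blast
  then show "tab R (suc i) k v" using R unfolding closed_ok_def rules_ok_iff by blast
qed

lemma tbl_rules: "rules_ok M tbl"
  unfolding rules_ok_iff using tbl_step by blast

lemma tbl_start_ok: "start M s l tbl"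
  unfolding start_iff[OF s] using tbl_start by blast

text \<open>If nothing demanded the cell, removing it from \<open>tbl\<close> would leave a closed
  set, since steps from the smaller table are also steps from \<open>tbl\<close>. This contradicts
  minimality.\<close>

lemma tbl_inversion:
  assumes "tab tbl i k v"
  shows "start_cell M s l i k v \<or>
    (\<exists>i'. i' \<epsilon> om \<and> i = suc i' \<and> (halt_step M tbl i' k v \<or> trans_step M tbl i' k v))"
proof (rule ccontr)
  let ?x = "pair (pair i k) v"
  assume no: "\<not> ?thesis"
  have "Dfn E (\<lambda>e. e 0 \<noteq> ?x)" by (intro Dfn.neg Dfn_eq Dt_var Dt_const)
  from separation[OF this, of tbl] obtain R where R: "\<forall>x. x \<epsilon> R \<longleftrightarrow> x \<epsilon> tbl \<and> x \<noteq> ?x" ..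
  have "tab R i' k' v'" if "start_cell M s l i' k' v'" for i' k' v'
    using R that tbl_start[OF that] no by auto
  then have "start M s l R" unfolding start_iff[OF s] by blast
  moreover have "tab R (suc i') k' v'" if st: "halt_step M R i' k' v' \<or> trans_step M R i' k' v'" for i' k' v'
  proof -
    have st': "halt_step M tbl i' k' v' \<or> trans_step M tbl i' k' v'"
      using st step_mono[of R tbl] R by blast
    have "i' \<epsilon> om" using st' tbl_om unfolding halt_step_def trans_step_def by blast
    then have "pair (pair (suc i') k') v' \<noteq> ?x" using no st' by auto
    then show ?thesis using R tbl_step[OF st'] by blast
  qed
  then have "rules_ok M R" unfolding rules_ok_iff by blast
  ultimately have "?x \<epsilon> R" using assms unfolding mem_tbl closed_ok_def by blast
  then show False using R by blast
qed

text \<open>Spelled with disjunctions so that the closure rules for definability apply;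
  \<open>row_cell_iff\<close> gives the form used for computation.\<close>

definition "row_cell i n h k x \<longleftrightarrow> (\<forall>v. tab tbl i k v \<longleftrightarrow>
  k = h \<and> v = ntri x n 1 \<or> k \<noteq> h \<and> v = ntri x n 0)"

text \<open>Row \<open>i\<close> is a configuration: one state, one head position, one symbol in
  every cell. The set \<open>UNIV\<close> of symbols is written out so that \<open>Dfn_bex\<close>
  applies and the invariant is definable.\<close>

definition "good i \<longleftrightarrow> (\<exists>n \<in> states M. \<exists>h. h \<epsilon> om \<and>
  (\<forall>k. k \<epsilon> om \<longrightarrow> (\<exists>x \<in> UNIV. row_cell i n h k x)))"

lemma row_cell_iff: "row_cell i n h k x \<longleftrightarrow>
  (\<forall>v. tab tbl i k v \<longleftrightarrow> v = ntri x n (if k = h then 1 else 0))"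
  unfolding row_cell_def by simp

lemma Dfn_good: "Dfn E (\<lambda>e. good (e 0))"
  unfolding good_def row_cell_def
  by (intro Dfn_bex finite_states finite_sym dfns)

lemma good_0: "good emp"
proof -
  have "\<exists>x \<in> UNIV. row_cell emp (init M) emp k x" if k: "k \<epsilon> om" for k
  proof -
    \<comment> \<open>A cell made by a step lies in a successor row, so row \<open>emp\<close> has
      only initial cells.\<close>
    have inv: "tab tbl emp k v \<longleftrightarrow> start_cell M s l emp k v" for v
      using tbl_inversion[of emp k v] tbl_start[of emp k v] by (metis suc_neq_emp(2))
    consider "k = emp" | m where "m \<epsilon> l" "k = suc m" | "l \<epsilon> k"
      using input_cases[OF l_om k] by blast
    then show ?thesis
    proof cases
      case 1
      have "row_cell emp (init M) emp k Start"
        unfolding row_cell_def inv start_cell_def using 1 by (simp del: nm.simps One_nat_def)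
      then show ?thesis by blast
    next
      case (2 m)
      have m: "m \<epsilon> om" using om_mem[OF l_om 2(1)] .
      \<comment> \<open>With \<open>m\<close> below \<open>l\<close>, position \<open>suc m\<close>
        is at most \<open>l\<close> and therefore not one of the blanks.\<close>
      have "\<not> l \<epsilon> suc m" using om_trans[OF l_om] om_irrefl[OF l_om] 2(1) by auto
      moreover have "m' = m" if "m' \<epsilon> l" "suc m = suc m'" for m'
        using suc_inj[OF m om_mem[OF l_om that(1)] that(2)] by simp
      ultimately have cell: "start_cell M s l emp k v \<longleftrightarrow>
        pair m (nm 0) \<epsilon> s \<and> v = ntri Zero (init M) 0 \<or> pair m (nm 1) \<epsilon> s \<and> v = ntri One (init M) 0" for v
        unfolding start_cell_def using 2 by (auto simp del: nm.simps One_nat_def sym_num.simps)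
      have "\<exists>a. \<forall>z. pair m z \<epsilon> s \<longleftrightarrow> z = a" using s 2(1) unfolding binary_def seq_def by blast
      then obtain a where a: "\<forall>z. pair m z \<epsilon> s \<longleftrightarrow> z = a" ..
      then have "a = nm 0 \<or> a = nm 1" using s unfolding binary_def by blast
      then have "row_cell emp (init M) emp k (if a = nm 0 then Zero else One)"
        unfolding row_cell_def inv cell using 2 a
        by (auto simp del: nm.simps One_nat_def sym_num.simps)
      then show ?thesis by blast
    next
      case 3
      then have "k \<noteq> emp" by auto
      moreover have "k \<noteq> suc m" if "m \<epsilon> l" for m
      proof
        assume "k = suc m"
        then show False using 3 that om_trans[OF l_om] om_irrefl[OF l_om] by auto
      qed
      ultimately have "row_cell emp (init M) emp k Blank"
        unfolding row_cell_def inv start_cell_def using 3 k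
        by (auto simp del: nm.simps One_nat_def sym_num.simps)
      then show ?thesis by blast
    qed
  qed
  then show ?thesis unfolding good_def
    using M emp_om unfolding turing_machine_def by blast
qed

text \<open>A configuration has a single head cell, so a single transition, or the halting rule,
  applies to it. This rule produces one value for each cell of the next row, and inversion excludes
  any other.\<close>

lemma good_suc:
  assumes i: "i \<epsilon> om" and "good i"
  shows "good (suc i)"
proof -
  from assms(2) obtain n h where n: "n \<in> states M" and h: "h \<epsilon> om"
    and "\<forall>k. k \<epsilon> om \<longrightarrow> (\<exists>x \<in> UNIV. row_cell i n h k x)" unfolding good_def by (elim bexE exE conjE)
  then have "\<forall>k. \<exists>x. k \<epsilon> om \<longrightarrow> row_cell i n h k x" by blast
  from choice[OF this] obtain T where T: "\<forall>k. k \<epsilon> om \<longrightarrow> row_cell i n h k (T k)" ..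
  have row: "tab tbl i k v \<longleftrightarrow> k \<epsilon> om \<and> v = ntri (T k) n (if k = h then 1 else 0)" for k v
    using T[rule_format, of k] tbl_om[of i k v] unfolding row_cell_iff by blast
  have head: "j = h \<and> a = T h \<and> q = n" if "tab tbl i j (ntri a q 1)" for j a q
  proof -
    have "(1 :: nat) = (if j = h then 1 else 0)" "a = T j" "q = n"
      using that unfolding row tri_eq nm_eq sym_num_eq by blast+
    then show ?thesis by (simp split: if_splits)
  qed
  have here: "tab tbl i h (ntri (T h) n 1)" using h unfolding row by simp
  \<comment> \<open>\<open>suc\<close> is injective on \<open>om\<close>, so the row delivered by
    inversion is row \<open>i\<close> itself.\<close>
  have inv: "tab tbl (suc i) k v \<longleftrightarrow> halt_step M tbl i k v \<or> trans_step M tbl i k v" for k v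
  proof
    assume "tab tbl (suc i) k v"
    moreover have "\<not> start_cell M s l (suc i) k v" unfolding start_cell_def by simp
    ultimately obtain i' where i': "i' \<epsilon> om" "suc i = suc i'"
      "halt_step M tbl i' k v \<or> trans_step M tbl i' k v" using tbl_inversion[of "suc i" k v] by blast
    then show "halt_step M tbl i k v \<or> trans_step M tbl i k v" using suc_inj[OF i i'(1,2)] by simp
  qed (rule tbl_step)
  show ?thesis
  proof (cases "n = halt M")
    case True
    have "halt_step M tbl i k v \<or> trans_step M tbl i k v \<longleftrightarrow> tab tbl i k v" for k v
    proof -
      have "\<not> trans_step M tbl i k v" using head True unfolding trans_step_def by blast
      moreover have "halt_step M tbl i k v \<longleftrightarrow> tab tbl i k v"
        using here True unfolding halt_step_def by blast
      ultimately show ?thesis by blast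
    qed
    then have "row_cell (suc i) n h k (T k)" if "k \<epsilon> om" for k
      unfolding row_cell_iff inv row using that by simp
    then show ?thesis unfolding good_def using n h by blast
  next
    case False
    obtain q' a' d where delta: "delta M n (T h) = (q', a', d)" by (cases "delta M n (T h)")
    have q': "q' \<in> states M" using M n delta unfolding turing_machine_def by (metis fst_conv)
    obtain j' where j': "j' \<epsilon> om" "mv d h j'" using mv_ex[OF h] by blast
    define T' where "T' k = (if k = h then a' else T k)" for k
    have new: "tri (if k = h then nm (sym_num a') else nm (sym_num (T k))) (nm q')
        (if k = j' then nm 1 else nm 0) = ntri (T' k) q' (if k = j' then 1 else 0)" for k
      unfolding T'_def by simp
    have "halt_step M tbl i k v \<or> trans_step M tbl i k v \<longleftrightarrow>
      v = ntri (T' k) q' (if k = j' then 1 else 0)" if k: "k \<epsilon> om" for k v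
    proof
      assume "halt_step M tbl i k v \<or> trans_step M tbl i k v"
      moreover have "\<not> halt_step M tbl i k v" using head False unfolding halt_step_def by blast
      ultimately have "trans_step M tbl i k v" by blast
      then obtain q a q1 a1 d1 j j1 b p g where *: "q \<in> states M - {halt M}"
        "delta M q a = (q1, a1, d1)" "tab tbl i j (ntri a q 1)" "mv d1 j j1" "tab tbl i k (tri b p g)"
        "v = tri (if k = j then nm (sym_num a1) else b) (nm q1) (if k = j1 then nm 1 else nm 0)"
        unfolding trans_step_def by (elim bexE exE conjE)
      have jh: "j = h" "a = T h" "q = n" using head[OF *(3)] by blast+
      then have d: "q1 = q'" "a1 = a'" "d1 = d" using *(2) delta by auto
      have "j1 = j'" using mv_unique[OF h _ j'(2)] *(4) jh(1) d(3) by blast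
      moreover have "b = nm (sym_num (T k))" using *(5) unfolding row tri_eq by blast
      ultimately show "v = ntri (T' k) q' (if k = j' then 1 else 0)"
        unfolding new[symmetric] *(6) jh d by simp
    next
      assume v: "v = ntri (T' k) q' (if k = j' then 1 else 0)"
      have c: "tab tbl i k (tri (nm (sym_num (T k))) (nm n) (nm (if k = h then 1 else 0)))"
        using k unfolding row by blast
      have "trans_step M tbl i k v" unfolding trans_step_def v new[symmetric]
        by (intro bexI[of _ n] exI conjI, rule delta, rule here, rule j'(2), rule c, rule refl)
          (use n False in simp)
      then show "halt_step M tbl i k v \<or> trans_step M tbl i k v" ..
    qed
    then have "row_cell (suc i) q' j' k (T' k)" if "k \<epsilon> om" for k
      unfolding row_cell_iff inv using that by simp
    then show ?thesis unfolding good_def using q' j'(1) by blast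
  qed
qed

lemma good_all: "i \<epsilon> om \<Longrightarrow> good i"
  by (rule om_induct[OF _ Dfn_good good_0 good_suc])

lemma tbl_total: "total_ok M tbl"
  unfolding total_ok_def
proof (intro conjI allI impI)
  have cell: "\<exists>n \<in> states M. \<exists>x b. \<forall>v. tab tbl i j v \<longleftrightarrow> v = ntri x n (if b then 1 else 0)"
    if "i \<epsilon> om" "j \<epsilon> om" for i j
    using good_all[OF that(1)] that(2) unfolding good_def row_cell_iff by blast
  {
    fix x assume x: "x \<epsilon> tbl"
    then obtain i j v where ij: "i \<epsilon> om" "j \<epsilon> om" "x = pair (pair i j) v"
      unfolding mem_tbl mem_cart by blast
    obtain n y b where "n \<in> states M" "\<forall>v. tab tbl i j v \<longleftrightarrow> v = ntri y n (if b then 1 else 0)"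
      using cell[OF ij(1,2)] by blast
    then have v: "v = ntri y n (if b then 1 else 0)" "n \<in> states M" using x ij(3) by blast+
    have "sym_num y \<in> {0, 1, 2, 3}" by (cases y) auto
    then have "value_ok M v" unfolding value_ok_def
      by (intro exI[of _ "nm (sym_num y)"] exI[of _ "nm n"] exI[of _ "nm (if b then 1 else 0)"] conjI
          imageI v) auto
    then show "\<exists>i j v. i \<epsilon> om \<and> j \<epsilon> om \<and> value_ok M v \<and> x = pair (pair i j) v"
      using ij by blast
  next
    fix i j assume "i \<epsilon> om \<and> j \<epsilon> om"
    then show "\<exists>v. \<forall>w. tab tbl i j w \<longleftrightarrow> w = v" using cell[of i j] by blast
  }
qed

lemma table_ex: "\<exists>t. total_ok M t \<and> rules_ok M t \<and> start M s l t"
  using tbl_total tbl_rules tbl_start_ok by blast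

end

section \<open>Running the proof in a model\<close>

lemma funpow_suc_om: "l \<epsilon> om \<Longrightarrow> (suc ^^ m) l \<epsilon> om"
  by (induction m) auto

text \<open>Splits the positions of \<open>U\<close>, whose length is \<open>l\<close> plus a
  standard constant: the fixed formulas occupy the standard positions below that constant, and the
  bits of the input follow, shifted by it.\<close>

lemma mem_funpow_suc:
  assumes "l \<epsilon> om"
  shows "k \<epsilon> (suc ^^ m) l \<Longrightarrow> (\<exists>n<m. k = nm n) \<or> (\<exists>i. i \<epsilon> l \<and> k = (suc ^^ m) i)"
proof (induction m arbitrary: k)
  case (Suc m)
  then have "k \<epsilon> suc ((suc ^^ m) l)" by simp
  from mem_suc_cases[OF funpow_suc_om[OF assms] this] show ?case
  proof
    assume "k = emp"
    then show ?thesis by (intro disjI1 exI[of _ 0]) simp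
  next
    assume "\<exists>i. i \<epsilon> (suc ^^ m) l \<and> k = suc i"
    then obtain i where i: "i \<epsilon> (suc ^^ m) l" "k = suc i" by blast
    from Suc.IH[OF i(1)] show ?thesis
    proof
      assume "\<exists>n<m. i = nm n"
      then obtain n where "n < m" "i = nm n" by blast
      then show ?thesis using i(2) by (intro disjI1 exI[of _ "Suc n"]) simp
    next
      assume "\<exists>j. j \<epsilon> l \<and> i = (suc ^^ m) j"
      then show ?thesis using i(2) by auto
    qed
  qed
qed simp

text \<open>The position \<open>k\<close> need not be standard. For entries depending on
  \<open>s\<close>, decoding shows that \<open>l\<close>, respectively \<open>suc i\<close>, is a
  standard numeral, and then \<open>with_num\<close> says about \<open>t\<close> what
  \<open>start\<close> provides.\<close>

lemma theory_true:
  assumes M: "turing_machine M" and thy: "thy M s U l"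
    and t: "total_ok M t" "rules_ok M t" "start M s l t"
    and U: "pair k (cd \<phi>) \<epsilon> U"
  shows "sat t e \<phi>"
proof -
  define D where "D = length (def_fms M Ct)"
  have l: "l \<epsilon> om" and seq: "seq U ((suc ^^ (D + 2)) l)"
    and defs: "\<forall>i<D. pair (nm i) (cd (def_fms M Ct ! i)) \<epsilon> U"
    and blk: "\<exists>y. pair (nm D) y \<epsilon> U \<and> with_code l (blank_fm M Ct (Var 0)) y"
    and st: "pair (nm (D + 1)) (cd (with_num 0 (init_cell_fm M Ct (Var 0) Start 1))) \<epsilon> U"
    and inp: "\<forall>k. k \<epsilon> l \<longrightarrow> input_code M s U D k"
    using thy unfolding thy_def Let_def D_def[symmetric] binary_def seq_def by blast+
  have fin: "finite (states M)" using M by (simp add: turing_machine_def)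
  note same = seq_fun[OF seq U]
  from mem_funpow_suc[OF l seq_dom[OF seq U]]
  consider n where "n < D" "k = nm n" | "k = nm D" | "k = nm (D + 1)"
    | i where "i \<epsilon> l" "k = (suc ^^ (D + 2)) i"
    by (metis Suc_1 Suc_eq_plus1 add_Suc_right less_SucE)
  then show ?thesis
  proof cases
    case (1 n)
    then have "cd \<phi> = cd (def_fms M Ct ! n)" using same defs by blast
    then have "\<phi> \<in> set (def_fms M Ct)" using 1(1) unfolding D_def by simp
    moreover have "\<forall>a \<in> set (def_fms M Ct). sat t e a"
      using sat_def_fms[OF fin, of Ct t e] t by simp
    ultimately show ?thesis by blast
  next
    case 2
    then have "with_code l (blank_fm M Ct (Var 0)) (cd \<phi>)" using same blk by blast
    from with_code_decode[OF this] obtain j where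
      "\<phi> = with_num j (blank_fm M Ct (Var 0))" "l = nm j" by blast
    then show ?thesis using t(3) by (simp add: start_def)
  next
    case 3
    then have "cd \<phi> = cd (with_num 0 (init_cell_fm M Ct (Var 0) Start 1))" using same st by blast
    then have "\<phi> = with_num 0 (init_cell_fm M Ct (Var 0) Start 1)" by (simp only: cd_eq)
    then show ?thesis using t(3) by (simp add: start_def)
  next
    case (4 i)
    obtain a y where y: "pair k y \<epsilon> U" "pair i a \<epsilon> s"
      "a = nm 0 \<and> with_code (suc i) (init_cell_fm M Ct (Var 0) Zero 0) y \<or>
       a = nm 1 \<and> with_code (suc i) (init_cell_fm M Ct (Var 0) One 0) y"
      using inp 4 unfolding input_code_def by blast
    have y': "y = cd \<phi>" using same y(1) by blast
    have cell: "a = nm 0 \<and> tab t emp (suc i) (ntri Zero (init M) 0) \<or>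
      a = nm 1 \<and> tab t emp (suc i) (ntri One (init M) 0)"
      using t(3) 4(1) y(2) unfolding start_def by blast
    \<comment> \<open>Rules out the mixed cases, in which the entry of \<open>U\<close> and the cell
      of \<open>t\<close> would record different digits \<open>a\<close>.\<close>
    have "(nm 0 :: 'a) \<noteq> nm 1" by (simp del: nm.simps)
    with y(3) cell show ?thesis
    proof (elim disjE conjE)
      assume "with_code (suc i) (init_cell_fm M Ct (Var 0) Zero 0) y"
        and c: "tab t emp (suc i) (ntri Zero (init M) 0)"
      then obtain j where "\<phi> = with_num j (init_cell_fm M Ct (Var 0) Zero 0)" "suc i = nm j"
        using with_code_decode y' by blast
      then show ?thesis using c by simp
    next
      assume "with_code (suc i) (init_cell_fm M Ct (Var 0) One 0) y"
        and c: "tab t emp (suc i) (ntri One (init M) 0)"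
      then obtain j where "\<phi> = with_num j (init_cell_fm M Ct (Var 0) One 0)" "suc i = nm j"
        using with_code_decode y' by blast
      then show ?thesis using c by simp
    qed simp_all
  qed
qed

definition "out M t \<longleftrightarrow> (\<exists>i. i \<epsilon> om \<and> tab t i (nm 1) (ntri One (halt M) 1))"

lemma sat_out: "sat t e (out_fm M f) \<longleftrightarrow> out M (val t e f)"
  by (simp add: out_fm_def out_def multi_quantifiers del: nm.simps One_nat_def)

lemma sat_outputs:
  assumes "finite (states M)"
  shows "sat t e (outputs_1_fm M s) \<longleftrightarrow> (\<exists>f. total_ok M f \<and> rules_ok M f \<and>
    (\<exists>l. binary (val t e s) l \<and> start M (val t e s) l f) \<and> out M f)"
  by (simp add: outputs_1_fm_def sat_table[OF assms] sat_out)

lemma sat_code_seq: "sat t e (code_seq_fm \<pi> p) \<longleftrightarrow> seq (val t e p) (nm (length \<pi>)) \<and>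
  (\<forall>i < length \<pi>. pair (nm i) (cd (\<pi> ! i)) \<epsilon> val t e p)"
  by (auto simp: code_seq_fm_def)

text \<open>An accepting answer of \<open>AL\<close> reveals that the entry occurs somewhere in
  \<open>U\<close>, at a position that may be nonstandard.\<close>

lemma sat_valid_Thy: "sat t e (valid_fm AL_fm U p i Thy_J) \<Longrightarrow>
  \<exists>y k. pair (nm i) y \<epsilon> val t e p \<and> pair k y \<epsilon> val t e U"
  by (auto simp: valid_fm_def AL_fm_def bool_val_fm_def simp del: nm.simps One_nat_def)

lemma sat_CK:
  assumes "sat t e (CK_fm Js AL_fm U p v)" "val t e v = nm 1" "i < length Js" "Js ! i = Thy_J"
  shows "\<exists>y k. pair (nm i) y \<epsilon> val t e p \<and> pair k y \<epsilon> val t e U"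
proof (rule sat_valid_Thy)
  have "\<forall>a \<in> set (map (\<lambda>i. valid_fm AL_fm U p i (Js ! i)) [0..<length Js]). sat t e a"
    using sat_bool_val[OF assms(1)[unfolded CK_fm_def] assms(2)]
    unfolding ev_connectives ev_Conj by blast
  then show "sat t e (valid_fm AL_fm U p i Thy_J)" using assms(3,4) by force
qed

text \<open>The claim is made for all assignments, since a generalized formula needs its premise for
  every value of the bound variable.\<close>

lemma proof_true:
  assumes M: "turing_machine M" and rec: "recorded (Thy_AL M r) \<pi> Js"
    and thy: "thy M s U l" and t: "total_ok M t" "rules_ok M t" "start M s l t"
    and seq: "seq p (nm (length \<pi>))"
    and code: "\<And>i. i < length \<pi> \<Longrightarrow> pair (nm i) (cd (\<pi> ! i)) \<epsilon> p"
    and valid: "\<And>i. i < length \<pi> \<Longrightarrow> Js ! i = Thy_J \<Longrightarrow> \<exists>y k. pair (nm i) y \<epsilon> p \<and> pair k y \<epsilon> U"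
  shows "i < length \<pi> \<Longrightarrow> sat t e (\<pi> ! i)"
proof (induction i arbitrary: e rule: less_induct)
  case (less i)
  \<comment> \<open>These justifications refer to the theory of \<open>r\<close>. For kind (3) the
    assumption \<open>valid\<close> supplies membership in the theory of \<open>s\<close>
    instead.\<close>
  have J: "justifies (Thy_AL M r) \<pi> i (Js ! i)" using rec less.prems unfolding recorded_def by simp
  have less_len: "j < length \<pi>" if "j < i" for j using that less.prems by simp
  show ?case
  proof (cases "Js ! i")
    case Log_J
    then show ?thesis using J logical_axiom_sound by (simp add: Thy_AL_def)
  next
    case ZFC_J
    then have "zfc_axiom (\<pi> ! i)" using J by (simp add: Thy_AL_def)
    then show ?thesis by (rule zfc_axiom_any_constant[rotated]) (rule zfc_true)
  next
    case Thy_J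
    from valid[OF less.prems this] obtain y k where y: "pair (nm i) y \<epsilon> p" "pair k y \<epsilon> U" by blast
    have "y = cd (\<pi> ! i)" by (rule seq_fun[OF seq y(1) code[OF less.prems]])
    then show ?thesis using theory_true[OF M thy t] y(2) by blast
  next
    case (MP_J j k)
    then have j: "j < i" "k < i" "\<pi> ! j = Imp (\<pi> ! k) (\<pi> ! i)" using J by (simp_all add: Thy_AL_def)
    have "sat t e (\<pi> ! j)" "sat t e (\<pi> ! k)" using less.IH less_len j(1,2) by blast+
    then show ?thesis unfolding j(3) by simp
  next
    case (Gen_J j k)
    then have j: "j < i" "\<pi> ! i = All k (\<pi> ! j)" using J by (simp_all add: Thy_AL_def)
    have "sat t (e(k := d)) (\<pi> ! j)" for d using less.IH less_len j(1) by blast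
    then show ?thesis unfolding j(2) by simp
  qed
qed

lemma checker_sound:
  assumes M: "turing_machine M" and "normal_proof M r \<pi>" and rec: "recorded (Thy_AL M r) \<pi> Js"
    and sat: "sat c e (Thy_fm M s U)" "sat c e (code_seq_fm \<pi> p)" "sat c e (CK_fm Js AL_fm U p v)"
      "val c e v = nm 1"
  shows "sat c e (outputs_1_fm M s)"
proof -
  have fin: "finite (states M)" using M by (simp add: turing_machine_def)
  have \<pi>: "\<pi> \<noteq> []" "last \<pi> = out_fm M Ct" using assms(2) by (simp_all add: normal_proof_def proves_def)
  have len: "length Js = length \<pi>" using rec by (simp add: recorded_def)
  from sat(1) obtain l where thy: "thy M (val c e s) (val c e U) l" unfolding sat_Thy by blast
  then have bin: "binary (val c e s) l" unfolding thy_def Let_def by blast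
  from table_ex[OF M bin] obtain t where
    t: "total_ok M t" "rules_ok M t" "start M (val c e s) l t" by blast
  have code: "seq (val c e p) (nm (length \<pi>))"
    "\<And>i. i < length \<pi> \<Longrightarrow> pair (nm i) (cd (\<pi> ! i)) \<epsilon> val c e p"
    using sat(2) unfolding sat_code_seq by blast+
  \<comment> \<open>The constant now denotes the table \<open>t\<close> instead of \<open>c\<close>,
    so the final formula \<open>out_fm M Ct\<close> speaks of this table.\<close>
  have "sat t e (\<pi> ! (length \<pi> - 1))"
  proof (rule proof_true[OF M rec thy t code])
    show "\<exists>y k. pair (nm i) y \<epsilon> val c e p \<and> pair k y \<epsilon> val c e U"
      if "i < length \<pi>" "Js ! i = Thy_J" for i
      using sat_CK[OF sat(3,4)] that len by simp
  qed (use \<pi>(1) in simp_all)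
  then have "out M t" using \<pi> sat_out[of t e M Ct] by (simp add: last_conv_nth)
  then show ?thesis unfolding sat_outputs[OF fin] using t bin by blast
qed

lemma checker_formula_true:
  assumes "turing_machine M" "normal_proof M r \<pi>" "recorded (Thy_AL M r) \<pi> Js"
  shows "sat c e (checker_formula M \<pi> Js)"
proof -
  have "sat c e' (outputs_1_fm M s)"
    if "sat c e' (ex3 [s] (\<lambda>U p v. Conj [Thy_fm M s U, code_seq_fm \<pi> p, CK_fm Js AL_fm U p v, num_fm 1 v]))"
    for s e'
  proof -
    let ?U = "Var (fresh [s])"
    let ?p = "Var (fresh [?U, s])"
    let ?v = "Var (fresh [?p, ?U, s])"
    from that obtain d1 d2 d3 where
      *: "sat c (e'(fresh [s] := d1, fresh [?U, s] := d2, fresh [?p, ?U, s] := d3))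
        (Conj [Thy_fm M s ?U, code_seq_fm \<pi> ?p, CK_fm Js AL_fm ?U ?p ?v, num_fm 1 ?v])"
      unfolding ex3_def ex2_def ev_ex by blast
    let ?e = "e'(fresh [s] := d1, fresh [?U, s] := d2, fresh [?p, ?U, s] := d3)"
    have **: "sat c ?e (Thy_fm M s ?U)" "sat c ?e (code_seq_fm \<pi> ?p)"
      "sat c ?e (CK_fm Js AL_fm ?U ?p ?v)" "sat c ?e (num_fm 1 ?v)"
      using * unfolding ev_Conj list.set ball_simps by blast+
    have "sat c ?e (outputs_1_fm M s)"
      by (rule checker_sound[OF assms **(1-3) **(4)[unfolded sat_num]])
    \<comment> \<open>By \<open>sat_outputs\<close> the truth of this formula depends only on the
      value of \<open>s\<close>, which the updates at fresh variables leave unchanged.\<close>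
    then show ?thesis
      using assms(1) sat_outputs[of M] by (simp add: turing_machine_def)
  qed
  then show ?thesis unfolding checker_formula_def by simp
qed

end


section \<open>The checker formula does not contain the constant\<close>

declare t_free_connectives(6,7) [simp del] \<comment> \<open>the rules below hide the terms \<open>fresh ps\<close>\<close>

lemma t_free_all: "(\<And>x. x \<noteq> Ct \<Longrightarrow> t_free (F x)) \<Longrightarrow> t_free (all ps F)"
  by (simp add: all_def)

lemma t_free_ex: "(\<And>x. x \<noteq> Ct \<Longrightarrow> t_free (F x)) \<Longrightarrow> t_free (ex ps F)"
  by (simp add: ex_def Ex_def)

lemma t_free_multi:
  "(\<And>x y. x \<noteq> Ct \<Longrightarrow> y \<noteq> Ct \<Longrightarrow> t_free (F2 x y)) \<Longrightarrow> t_free (all2 ps F2)"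
  "(\<And>x y. x \<noteq> Ct \<Longrightarrow> y \<noteq> Ct \<Longrightarrow> t_free (F2 x y)) \<Longrightarrow> t_free (ex2 ps F2)"
  "(\<And>x y z. x \<noteq> Ct \<Longrightarrow> y \<noteq> Ct \<Longrightarrow> z \<noteq> Ct \<Longrightarrow> t_free (F3 x y z)) \<Longrightarrow> t_free (all3 ps F3)"
  "(\<And>x y z. x \<noteq> Ct \<Longrightarrow> y \<noteq> Ct \<Longrightarrow> z \<noteq> Ct \<Longrightarrow> t_free (F3 x y z)) \<Longrightarrow> t_free (ex3 ps F3)"
  "(\<And>x y z w. x \<noteq> Ct \<Longrightarrow> y \<noteq> Ct \<Longrightarrow> z \<noteq> Ct \<Longrightarrow> w \<noteq> Ct \<Longrightarrow> t_free (F4 x y z w)) \<Longrightarrow> t_free (ex4 ps F4)"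
  "(\<And>x. x \<noteq> Ct \<Longrightarrow> t_free (F x)) \<Longrightarrow> t_free (ex1 ps F)"
  by (auto simp: multi_quantifiers intro!: t_free_all t_free_ex)

lemma t_free_Conj [simp]: "t_free (Conj as) \<longleftrightarrow> (\<forall>a \<in> set as. t_free a)"
  unfolding Conj_def by (induction as) auto

lemma t_free_Disj [simp]: "t_free (Disj as) \<longleftrightarrow> (\<forall>a \<in> set as. t_free a)"
  unfolding Disj_def by (induction as) auto

lemmas t_free_intros = t_free_all t_free_ex t_free_multi

lemma t_free_basic [simp]:
  "x \<noteq> Ct \<Longrightarrow> t_free (empty_fm x)"
  "x \<noteq> Ct \<Longrightarrow> y \<noteq> Ct \<Longrightarrow> t_free (succ_fm x y)"
  "x \<noteq> Ct \<Longrightarrow> y \<noteq> Ct \<Longrightarrow> p \<noteq> Ct \<Longrightarrow> t_free (upair_fm x y p)"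
  by (auto simp: empty_fm_def succ_fm_def upair_fm_def intro!: t_free_intros)

lemma t_free_pair [simp]: "x \<noteq> Ct \<Longrightarrow> y \<noteq> Ct \<Longrightarrow> p \<noteq> Ct \<Longrightarrow> t_free (pair_fm x y p)"
  by (auto simp: pair_fm_def intro!: t_free_intros)

lemma t_free_nat [simp]: "n \<noteq> Ct \<Longrightarrow> t_free (nat_fm n)"
  by (auto simp: nat_fm_def inductive_fm_def intro!: t_free_intros)

lemma t_free_app [simp]: "f \<noteq> Ct \<Longrightarrow> x \<noteq> Ct \<Longrightarrow> y \<noteq> Ct \<Longrightarrow> t_free (app_fm f x y)"
  by (auto simp: app_fm_def intro!: t_free_intros)

lemma t_free_seq [simp]: "f \<noteq> Ct \<Longrightarrow> n \<noteq> Ct \<Longrightarrow> t_free (seq_fm f n)"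
  by (auto simp: seq_fm_def intro!: t_free_intros)

lemma t_free_num [simp]: "u \<noteq> Ct \<Longrightarrow> t_free (num_fm k u)"
proof -
  have "t_free (numv k x y)" for x y by (induction k) auto
  then show "u \<noteq> Ct \<Longrightarrow> t_free (num_fm k u)" by (auto simp: num_fm_def Let_def)
qed

lemma t_free_arith [simp]:
  "x \<noteq> Ct \<Longrightarrow> t_free (one_of_fm ks x)"
  "k \<noteq> Ct \<Longrightarrow> m \<noteq> Ct \<Longrightarrow> t_free (add_fm d k m)"
  "f \<noteq> Ct \<Longrightarrow> y \<noteq> Ct \<Longrightarrow> t_free (entry_fm f n y)"
  "f \<noteq> Ct \<Longrightarrow> t_free (length_fm f n)"
proof -
  show "k \<noteq> Ct \<Longrightarrow> m \<noteq> Ct \<Longrightarrow> t_free (add_fm d k m)"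
    by (induction d arbitrary: m) (auto intro!: t_free_intros)
qed (auto simp: one_of_fm_def entry_fm_def length_fm_def intro!: t_free_intros)

lemma t_free_tab [simp]:
  "t \<noteq> Ct \<Longrightarrow> i \<noteq> Ct \<Longrightarrow> j \<noteq> Ct \<Longrightarrow> v \<noteq> Ct \<Longrightarrow> t_free (tab_fm t i j v)"
  "a \<noteq> Ct \<Longrightarrow> q \<noteq> Ct \<Longrightarrow> h \<noteq> Ct \<Longrightarrow> v \<noteq> Ct \<Longrightarrow> t_free (triple_fm a q h v)"
  by (auto simp: tab_fm_def triple_fm_def intro!: t_free_intros)

lemma t_free_cell [simp]:
  "t \<noteq> Ct \<Longrightarrow> i \<noteq> Ct \<Longrightarrow> j \<noteq> Ct \<Longrightarrow> a \<noteq> Ct \<Longrightarrow> q \<noteq> Ct \<Longrightarrow> h \<noteq> Ct \<Longrightarrow> t_free (cell_fm t i j a q h)"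
  by (auto simp: cell_fm_def intro!: t_free_intros)

lemma t_free_ncell [simp]:
  "t \<noteq> Ct \<Longrightarrow> i \<noteq> Ct \<Longrightarrow> j \<noteq> Ct \<Longrightarrow> t_free (ncell_fm t i j b n k)"
  by (auto simp: ncell_fm_def intro!: t_free_intros)

lemma t_free_machine [simp]:
  "v \<noteq> Ct \<Longrightarrow> t_free (value_fm M v)"
  "j \<noteq> Ct \<Longrightarrow> j' \<noteq> Ct \<Longrightarrow> t_free (move_fm d j j')"
  "t \<noteq> Ct \<Longrightarrow> t_free (halt_fm M t a)"
  "t \<noteq> Ct \<Longrightarrow> j \<noteq> Ct \<Longrightarrow> t_free (init_cell_fm M t j a k)"
  "t \<noteq> Ct \<Longrightarrow> t_free (out_fm M t)"
proof -
  show "j \<noteq> Ct \<Longrightarrow> j' \<noteq> Ct \<Longrightarrow> t_free (move_fm d j j')" by (cases d) auto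
qed (auto simp: value_fm_def halt_fm_def init_cell_fm_def out_fm_def intro!: t_free_intros)

lemma t_free_trans [simp]: "t \<noteq> Ct \<Longrightarrow> t_free (trans_fm M t q a)"
  by (auto simp: trans_fm_def split: prod.split intro!: t_free_intros)

lemma t_free_blank [simp]: "t \<noteq> Ct \<Longrightarrow> l \<noteq> Ct \<Longrightarrow> t_free (blank_fm M t l)"
  by (auto simp: blank_fm_def intro!: t_free_intros)

lemma t_free_def_fms: "t \<noteq> Ct \<Longrightarrow> a \<in> set (def_fms M t) \<Longrightarrow> t_free a"
  by (auto simp: def_fms_def intro!: t_free_intros)

lemma t_free_tag [simp]:
  "a \<noteq> Ct \<Longrightarrow> c \<noteq> Ct \<Longrightarrow> t_free (tag_fm k a c)"
  by (auto simp: tag_fm_def intro!: t_free_intros)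

lemma t_free_tag2 [simp]:
  "a \<noteq> Ct \<Longrightarrow> b \<noteq> Ct \<Longrightarrow> c \<noteq> Ct \<Longrightarrow> t_free (tag2_fm k a b c)"
  by (auto simp: tag2_fm_def intro!: t_free_intros)

lemma t_free_codes [simp]:
  "a \<noteq> Ct \<Longrightarrow> c \<noteq> Ct \<Longrightarrow> t_free (cVar a c)"
  "c \<noteq> Ct \<Longrightarrow> t_free (cCt c)"
  "a \<noteq> Ct \<Longrightarrow> b \<noteq> Ct \<Longrightarrow> c \<noteq> Ct \<Longrightarrow> t_free (cEq a b c)"
  "a \<noteq> Ct \<Longrightarrow> b \<noteq> Ct \<Longrightarrow> c \<noteq> Ct \<Longrightarrow> t_free (cMem a b c)"
  "a \<noteq> Ct \<Longrightarrow> c \<noteq> Ct \<Longrightarrow> t_free (cNeg a c)"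
  "a \<noteq> Ct \<Longrightarrow> b \<noteq> Ct \<Longrightarrow> c \<noteq> Ct \<Longrightarrow> t_free (cImp a b c)"
  "a \<noteq> Ct \<Longrightarrow> b \<noteq> Ct \<Longrightarrow> c \<noteq> Ct \<Longrightarrow> t_free (cAll a b c)"
  by (auto simp: cVar_def cCt_def cEq_def cMem_def cNeg_def cImp_def cAll_def intro!: t_free_intros)

lemma t_free_code [simp]: "c \<noteq> Ct \<Longrightarrow> t_free (code_fm a c)"
proof -
  have "c \<noteq> Ct \<Longrightarrow> t_free (code_tm s c)" for s c by (cases s) (auto intro!: t_free_intros)
  then show "c \<noteq> Ct \<Longrightarrow> t_free (code_fm a c)"
    by (induction a arbitrary: c) (auto intro!: t_free_intros)
qed

text \<open>A metavariable out of range would make \<open>!\<close> return an unspecified term,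
  possibly \<open>Ct\<close>; the bounds exclude this.\<close>

fun stm_bounded :: "nat \<Rightarrow> nat \<Rightarrow> stm \<Rightarrow> bool" where
  "stm_bounded n k (TH i) \<longleftrightarrow> i < k"
| "stm_bounded n k (VH i) \<longleftrightarrow> i < n"

primrec scheme_bounded :: "nat \<Rightarrow> nat \<Rightarrow> nat \<Rightarrow> scheme \<Rightarrow> bool" where
  "scheme_bounded m n k (FH i) \<longleftrightarrow> i < m"
| "scheme_bounded m n k (PFm a) \<longleftrightarrow> True"
| "scheme_bounded m n k (PEq s t) \<longleftrightarrow> stm_bounded n k s \<and> stm_bounded n k t"
| "scheme_bounded m n k (PMem s t) \<longleftrightarrow> stm_bounded n k s \<and> stm_bounded n k t"
| "scheme_bounded m n k (PNeg p) \<longleftrightarrow> scheme_bounded m n k p"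
| "scheme_bounded m n k (PImp p q) \<longleftrightarrow> scheme_bounded m n k p \<and> scheme_bounded m n k q"
| "scheme_bounded m n k (PAll i p) \<longleftrightarrow> i < n \<and> scheme_bounded m n k p"

lemma t_free_scheme:
  assumes "Ct \<notin> set Fs \<union> set Vs \<union> set Ts"
  shows "c \<noteq> Ct \<Longrightarrow> scheme_bounded (length Fs) (length Vs) (length Ts) p \<Longrightarrow>
    t_free (scheme_fm Fs Vs Ts p c)"
proof -
  have nth: "i < length us \<Longrightarrow> us ! i \<noteq> Ct" if "set us \<subseteq> set Fs \<union> set Vs \<union> set Ts" for us i
    using assms that nth_mem by fastforce
  have F: "i < length Fs \<Longrightarrow> Fs ! i \<noteq> Ct" for i by (rule nth) auto
  have V: "i < length Vs \<Longrightarrow> Vs ! i \<noteq> Ct" for i by (rule nth) auto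
  have T: "i < length Ts \<Longrightarrow> Ts ! i \<noteq> Ct" for i by (rule nth) auto
  have tm: "c \<noteq> Ct \<Longrightarrow> stm_bounded (length Vs) (length Ts) s \<Longrightarrow> t_free (scheme_tm Vs Ts s c)" for s c
    using V T by (cases s) (auto dest: sym)
  show "c \<noteq> Ct \<Longrightarrow> scheme_bounded (length Fs) (length Vs) (length Ts) p \<Longrightarrow>
    t_free (scheme_fm Fs Vs Ts p c)"
  proof (induction p arbitrary: c)
    case (FH i)
    then show ?case using F by (auto dest: sym)
  qed (use V tm in \<open>auto intro!: t_free_intros\<close>)
qed

lemma t_free_deriv:
  "(\<And>f i y. f \<noteq> Ct \<Longrightarrow> i \<noteq> Ct \<Longrightarrow> y \<noteq> Ct \<Longrightarrow> t_free (F f i y)) \<Longrightarrow> x \<noteq> Ct \<Longrightarrow> t_free (deriv_fm ps F x)"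
  by (auto simp: deriv_fm_def intro!: t_free_intros)

lemma t_free_prev [simp]: "f \<noteq> Ct \<Longrightarrow> i \<noteq> Ct \<Longrightarrow> y \<noteq> Ct \<Longrightarrow> t_free (prev_fm f i y)"
  by (auto simp: prev_fm_def intro!: t_free_intros)

lemma t_free_is_tm [simp]: "c \<noteq> Ct \<Longrightarrow> t_free (is_tm_fm c)"
  by (auto simp: is_tm_fm_def intro!: t_free_intros)

lemma t_free_is_fm [simp]: "c \<noteq> Ct \<Longrightarrow> t_free (is_fm_fm c)"
  unfolding is_fm_fm_def by (rule t_free_deriv) (auto intro!: t_free_intros)

lemma t_free_not_free [simp]: "v \<noteq> Ct \<Longrightarrow> c \<noteq> Ct \<Longrightarrow> t_free (not_free_fm v c)"
  unfolding not_free_fm_def by (rule t_free_deriv) (auto intro!: t_free_intros)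

lemma t_free_subst_tm [simp]:
  "v \<noteq> Ct \<Longrightarrow> u \<noteq> Ct \<Longrightarrow> a \<noteq> Ct \<Longrightarrow> b \<noteq> Ct \<Longrightarrow> t_free (subst_tm_fm v u a b)"
  by (auto simp: subst_tm_fm_def)

lemma t_free_subst [simp]:
  "v \<noteq> Ct \<Longrightarrow> u \<noteq> Ct \<Longrightarrow> a \<noteq> Ct \<Longrightarrow> b \<noteq> Ct \<Longrightarrow> t_free (subst_fm v u a b)"
  unfolding subst_fm_def by (auto intro!: t_free_intros t_free_deriv)

lemma scheme_bounded_connectives [simp]:
  "scheme_bounded m n k (PAnd p q) \<longleftrightarrow> scheme_bounded m n k p \<and> scheme_bounded m n k q"
  "scheme_bounded m n k (PIff p q) \<longleftrightarrow> scheme_bounded m n k p \<and> scheme_bounded m n k q"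
  "scheme_bounded m n k (PEx i p) \<longleftrightarrow> i < n \<and> scheme_bounded m n k p"
  by (auto simp: PAnd_def PIff_def PEx_def)

lemma t_free_logical_axiom [simp]: "x \<noteq> Ct \<Longrightarrow> t_free (logical_axiom_fm x)"
  by (auto simp: logical_axiom_fm_def prop_schemes_def eq_schemes_def
      intro!: t_free_intros t_free_scheme)

lemma t_free_zfc_axiom [simp]: "x \<noteq> Ct \<Longrightarrow> t_free (zfc_axiom_fm x)"
  by (auto simp: zfc_axiom_fm_def separation_scheme_def replacement_scheme_def
      intro!: t_free_intros t_free_scheme)

lemma t_free_AL [simp]: "U \<noteq> Ct \<Longrightarrow> y \<noteq> Ct \<Longrightarrow> v \<noteq> Ct \<Longrightarrow> t_free (AL_fm U y v)"
  by (auto simp: AL_fm_def bool_val_fm_def intro!: t_free_intros)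

lemma t_free_valid [simp]: "U \<noteq> Ct \<Longrightarrow> p \<noteq> Ct \<Longrightarrow> t_free (valid_fm AL_fm U p i J)"
  by (cases J) (auto simp: valid_fm_def intro!: t_free_intros)

lemma t_free_CK [simp]: "U \<noteq> Ct \<Longrightarrow> p \<noteq> Ct \<Longrightarrow> v \<noteq> Ct \<Longrightarrow> t_free (CK_fm Js AL_fm U p v)"
  by (auto simp: CK_fm_def bool_val_fm_def)

lemma t_free_code_seq [simp]: "p \<noteq> Ct \<Longrightarrow> t_free (code_seq_fm \<pi> p)"
  by (auto simp: code_seq_fm_def intro!: t_free_intros)

lemma t_free_binary [simp]: "s \<noteq> Ct \<Longrightarrow> l \<noteq> Ct \<Longrightarrow> t_free (binary_fm s l)"
  by (auto simp: binary_fm_def intro!: t_free_intros)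

lemma t_free_num_code [simp]: "k \<noteq> Ct \<Longrightarrow> c \<noteq> Ct \<Longrightarrow> t_free (num_code_fm k c)"
  by (auto simp: num_code_fm_def intro!: t_free_intros t_free_scheme)

lemma t_free_with_num_code [simp]: "k \<noteq> Ct \<Longrightarrow> c \<noteq> Ct \<Longrightarrow> t_free (with_num_code_fm k a c)"
  by (auto simp: with_num_code_fm_def intro!: t_free_intros t_free_scheme)

lemma t_free_Thy_fm [simp]: "s \<noteq> Ct \<Longrightarrow> U \<noteq> Ct \<Longrightarrow> t_free (Thy_fm M s U)"
  by (auto simp: Thy_fm_def Let_def intro!: t_free_intros)

lemma t_free_table [simp]: "s \<noteq> Ct \<Longrightarrow> t \<noteq> Ct \<Longrightarrow> t_free (table_fm M s t)"
  by (auto simp: table_fm_def t_free_def_fms intro!: t_free_intros)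

lemma t_free_checker_formula: "t_free (checker_formula M \<pi> Js)"
  by (auto simp: checker_formula_def outputs_1_fm_def intro!: t_free_intros)

theorem theorem3p19:
  fixes M :: turing and r :: "bool list" and \<pi> :: "fm list" and Js :: "justification list"
  assumes "turing_machine M"
    and "outputs_1 M r"
    and "normal_proof M r \<pi>"
    and "recorded (Thy_AL M r) \<pi> Js"
  shows "zfc_provable (checker_formula M \<pi> Js)"
proof (rule pr_zfc_provable[OF completeness t_free_checker_formula])
  fix E :: "nat \<Rightarrow> nat \<Rightarrow> bool" and c e
  assume "\<And>a e. zfc_axiom a \<Longrightarrow> ev (=) E c e a"
  then interpret zf E c by unfold_locales
  show "ev (=) E c e (checker_formula M \<pi> Js)"
    by (rule checker_formula_true[OF assms(1,3,4)])
qed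

end
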